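(* Let $M$ be an $n$-dimensional smooth manifold and let $\{f:M\to\mathbb{R}^{n+1},\xi\}$ be an equiaffine immersion. Let $(h,(E=E^+\oplus E^-,\theta,I),\Phi=\Phi^+\oplus\Phi^-,\nabla^+,\nabla^-)$ be the quasi-Codazzi structure on $M$ induced by $\{f,\xi\}$. Then $\nabla^-$ is projectively flat (with respect to $\Phi^-=-\nu_*$), and $\operatorname{tr}\{\eta^-\mapsto R^{\nabla^-}(X,Y)\eta^-\}=0$ for all $X,Y\in\Gamma(TM)$ (the trace being over $\eta^-\in E^-$).
   Context: All objects are $C^\infty$. $R^{\nabla}(X,Y)=\nabla_X\nabla_Y-\nabla_Y\nabla_X-\nabla_{[X,Y]}$ denotes the curvature of a connection on a vector bundle. Affine immersions. An affine immersion $\{f,\xi\}$ is an immersion $f:M\to\mathbb{R}^{n+1}$ with a vector field $\xi$ along $f$ such that $T_{f(p)}\mathbb{R}^{n+1}=f_*(T_pM)\oplus\operatorname{span}\{\xi_p\}$ for all $p\in M$. With $D$ the standard flat connection of $\mathbb{R}^{n+1}$, one writes $D_Xf_*Y=f_*(\nabla_XY)+h(X,Y)\xi$ and $D_X\xi=-f_*(S(X))+\tau(X)\xi$; $\nabla$ is a torsion-free connection (the induced connection), $h$ a symmetric $(0,2)$-tensor field (the second fundamental form, possibly degenerate), $S$ a $(1,1)$-tensor field, $\tau$ a 1-form. $\{f,\xi\}$ is equiaffine if $\tau\equiv 0$. The conormal map $\nu:M\to(\mathbb{R}^{n+1})^*$ is defined by $\langle\nu(p),f_*X_p\rangle=0$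 for $X_p\in T_pM$ and $\langle\nu(p),\xi_p\rangle=1$. Induced quasi-Codazzi structure of an equiaffine immersion. $E^+_p=f_*(T_pM)$, $E^-_p=(f_*(T_pM))^*$, $E=E^+\oplus E^-$; $\theta(\eta^+\oplus\eta^-,\zeta^+\oplus\zeta^-)=\frac12\{\langle\zeta^-,\eta^+\rangle+\langle\eta^-,\zeta^+\rangle\}$; $I(\eta^+\oplus\eta^-)=\eta^+\oplus(-\eta^-)$; $\Phi:TM\to E$, $\Phi(X)=f_*X\oplus(-\nu_*X)$, where $\nu_*X\in(\mathbb{R}^{n+1})^*$ is regarded as an element of $(f_*(TM))^*$ by restriction, so $\Phi^+=f_*$ and $\Phi^-=-\nu_*$; $\nabla^+$ is the connection on $E^+$ with $\nabla^+_Xf_*Y=f_*(\nabla_XY)$; $\nabla^-$ is the connection on $E^-$ defined by $X\theta(\eta^+,\zeta^-)=\theta(\nabla^+_X\eta^+,\zeta^-)+\theta(\eta^+,\nabla^-_X\zeta^-)$; $h$ is the second fundamental form. Projective flatness. Let $\mathcal{E}\to M$ be a rank $n$ vector bundle and $\phi:TM\to\mathcal{E}$ a bundle map over $\mathrm{id}_M$ (fiberwise linear, rank may vary). A connection $\nabla^{\mathcal{E}}$ on $\mathcal{E}$ is relatively torsion-free with respect to $\phi$ if $\nabla^{\mathcal{E}}_X\phi(Y)-\nabla^{\mathcal{E}}_Y\phi(X)-\phi([X,Y])=0$ for all $X,Y\in\Gamma(TM)$. Two such connections $\nabla^{\mathcal{E}},\widehat\nabla^{\mathcal{E}}$ are projectively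 equivalent with respect to $\phi$ if there is $\rho\in\Gamma(\mathcal{E}^* )$ with $\widehat\nabla^{\mathcal{E}}_X\eta=\nabla^{\mathcal{E}}_X\eta+\rho(\phi(X))\eta+\rho(\eta)\phi(X)$ for all $X\in\Gamma(TM)$, $\eta\in\Gamma(\mathcal{E})$. $\nabla^{\mathcal{E}}$ is projectively flat with respect to $\phi$ if every point of $M$ has a neighborhood on which $\nabla^{\mathcal{E}}$ is projectively equivalent with respect to $\phi$ to a connection with vanishing curvature. *)

theory Defs
  imports "HOL-Analysis.Analysis" "HOL-Library.Function_Algebras"
begin

text \<open>Pointwise scalar multiplication, so that spaces of functionals (tangent vectors, duals)
  are subspaces of a real vector space in the sense of the library.\<close>

instantiation "fun" :: (type, real_vector) real_vector
begin

definition scaleR_fun :: "real \<Rightarrow> ('a \<Rightarrow> 'b) \<Rightarrow> 'a \<Rightarrow> 'b"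
  where "scaleR_fun c f = (\<lambda>x. c *\<^sub>R f x)"

instance
  by standard (auto simp: fun_eq_iff scaleR_fun_def scaleR_add_right scaleR_add_left)

end


section \<open>Smooth manifolds\<close>

text \<open>On an open subset of a finite-dimensional space, \<open>f\<close> is \<open>C\<^sup>k\<^sup>+\<^sup>1\<close> iff it is differentiable
  and all its directional derivatives are \<open>C\<^sup>k\<close>.\<close>

primrec Ck_on :: "nat \<Rightarrow> 'e::real_normed_vector set \<Rightarrow> ('e \<Rightarrow> 'b::real_normed_vector) \<Rightarrow> bool" where
  "Ck_on 0 S f \<longleftrightarrow> continuous_on S f"
| "Ck_on (Suc k) S f \<longleftrightarrow>
     (\<forall>x\<in>S. f differentiable (at x)) \<and> (\<forall>v. Ck_on k S (\<lambda>x. frechet_derivative f (at x) v))"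

definition smooth_on :: "'e::real_normed_vector set \<Rightarrow> ('e \<Rightarrow> 'b::real_normed_vector) \<Rightarrow> bool"
  where "smooth_on S f \<longleftrightarrow> (\<forall>k. Ck_on k S f)"

type_synonym ('a, 'n) atlas = "('a set \<times> ('a \<Rightarrow> real ^ 'n)) set"

definition smooth_atlas :: "('a::topological_space, 'n::finite) atlas \<Rightarrow> bool" where
  "smooth_atlas A \<longleftrightarrow>
     (\<forall>(U, \<phi>)\<in>A. open U \<and> open (\<phi> ` U) \<and> homeomorphism U (\<phi> ` U) \<phi> (inv_into U \<phi>)) \<and>
     (\<Union>(U, \<phi>)\<in>A. U) = UNIV \<and>
     (\<forall>(U, \<phi>)\<in>A. \<forall>(V, \<psi>)\<in>A. smooth_on (\<phi> ` (U \<inter> V)) (\<psi> \<circ> inv_into U \<phi>))"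

text \<open>Only used for open \<open>W\<close>; the values of \<open>g\<close> outside \<open>W\<close> are irrelevant.\<close>

definition smooth_fn ::
    "('a::topological_space, 'n::finite) atlas \<Rightarrow> 'a set \<Rightarrow> ('a \<Rightarrow> 'b::real_normed_vector) \<Rightarrow> bool" where
  "smooth_fn A W g \<longleftrightarrow> (\<forall>(U, \<phi>)\<in>A. smooth_on (\<phi> ` (U \<inter> W)) (g \<circ> inv_into U \<phi>))"

definition smooth_near ::
    "('a::topological_space, 'n::finite) atlas \<Rightarrow> 'a \<Rightarrow> ('a \<Rightarrow> 'b::real_normed_vector) \<Rightarrow> bool" where
  "smooth_near A p g \<longleftrightarrow> (\<exists>W. open W \<and> p \<in> W \<and> smooth_fn A W g)"


section \<open>Vector bundles\<close>

text \<open>A vector bundle is given by its fibres, realised as subspaces of one ambient vector space,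
  and by its smooth sections over each open set. Sections are total functions whose values outside
  the open set are irrelevant.\<close>

record ('a, 'v) vbundle =
  fibre :: "'a \<Rightarrow> 'v set"
  sections :: "'a set \<Rightarrow> ('a \<Rightarrow> 'v) set"

definition vector_bundle ::
    "('a::topological_space, 'n::finite) atlas \<Rightarrow> nat \<Rightarrow> ('a, 'v::real_vector) vbundle \<Rightarrow> bool" where
  "vector_bundle A k E \<longleftrightarrow>
     (\<forall>p. subspace (fibre E p)) \<and>
     (\<forall>W s. open W \<longrightarrow> s \<in> sections E W \<longrightarrow> (\<forall>p\<in>W. s p \<in> fibre E p)) \<and>
     (\<forall>W s. open W \<longrightarrow> (s \<in> sections E W \<longleftrightarrow>
        (\<forall>p\<in>W. \<exists>V. open V \<and> p \<in> V \<and> V \<subseteq> W \<and> s \<in> sections E V))) \<and>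
     (\<forall>p. \<exists>U (e :: nat \<Rightarrow> 'a \<Rightarrow> 'v). open U \<and> p \<in> U \<and>
        (\<forall>q\<in>U. inj_on (\<lambda>i. e i q) {..<k} \<and> independent ((\<lambda>i. e i q) ` {..<k}) \<and>
           span ((\<lambda>i. e i q) ` {..<k}) = fibre E q) \<and>
        (\<forall>W s. open W \<longrightarrow> W \<subseteq> U \<longrightarrow> (s \<in> sections E W \<longleftrightarrow>
           (\<exists>c :: nat \<Rightarrow> 'a \<Rightarrow> real. (\<forall>i<k. smooth_fn A W (c i)) \<and>
              (\<forall>q\<in>W. s q = (\<Sum>i<k. c i q *\<^sub>R e i q))))))"

definition lin_on :: "'v::real_vector set \<Rightarrow> ('v \<Rightarrow> 'w::real_vector) \<Rightarrow> bool" where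
  "lin_on V \<alpha> \<longleftrightarrow>
     (\<forall>u\<in>V. \<forall>w\<in>V. \<alpha> (u + w) = \<alpha> u + \<alpha> w) \<and> (\<forall>c. \<forall>u\<in>V. \<alpha> (c *\<^sub>R u) = c *\<^sub>R \<alpha> u)"

text \<open>The dual of a subspace \<open>V\<close> consists of the functions that are linear on \<open>V\<close>, made unique
  by the value \<open>0\<close> outside \<open>V\<close>.\<close>

definition restrict0 :: "'v set \<Rightarrow> ('v \<Rightarrow> real) \<Rightarrow> 'v \<Rightarrow> real"
  where "restrict0 V \<alpha> = (\<lambda>w. if w \<in> V then \<alpha> w else 0)"

definition dual_space :: "'v::real_vector set \<Rightarrow> ('v \<Rightarrow> real) set"
  where "dual_space V = {\<alpha>. lin_on V \<alpha> \<and> (\<forall>w. w \<notin> V \<longrightarrow> \<alpha> w = 0)}"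

definition dual_bundle ::
    "('a::topological_space, 'n::finite) atlas \<Rightarrow> ('a, 'v::real_vector) vbundle
       \<Rightarrow> ('a, 'v \<Rightarrow> real) vbundle" where
  "dual_bundle A E =
     \<lparr>fibre = (\<lambda>p. dual_space (fibre E p)),
      sections = (\<lambda>U. {\<zeta>. (\<forall>p\<in>U. \<zeta> p \<in> dual_space (fibre E p)) \<and>
         (\<forall>W s. open W \<longrightarrow> W \<subseteq> U \<longrightarrow> s \<in> sections E W \<longrightarrow> smooth_fn A W (\<lambda>q. \<zeta> q (s q)))})\<rparr>"

definition sum_bundle :: "('a, 'v) vbundle \<Rightarrow> ('a, 'w) vbundle \<Rightarrow> ('a, 'v \<times> 'w) vbundle" where
  "sum_bundle E F =
     \<lparr>fibre = (\<lambda>p. fibre E p \<times> fibre F p),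
      sections = (\<lambda>U. {s. (\<lambda>p. fst (s p)) \<in> sections E U \<and> (\<lambda>p. snd (s p)) \<in> sections F U})\<rparr>"


section \<open>The tangent bundle\<close>

text \<open>Tangent vectors at \<open>p\<close> are the derivations of the functions that are smooth near \<open>p\<close>,
  extended by \<open>0\<close> to all other functions. (They depend only on germs: multiply by an indicator
  function of a neighbourhood of \<open>p\<close>.)\<close>

type_synonym 'a tvec = "('a \<Rightarrow> real) \<Rightarrow> real"

definition tangent_space ::
    "('a::topological_space, 'n::finite) atlas \<Rightarrow> 'a \<Rightarrow> 'a tvec set" where
  "tangent_space A p = {v.
     (\<forall>g. \<not> smooth_near A p g \<longrightarrow> v g = 0) \<and>
     (\<forall>g k. smooth_near A p g \<longrightarrow> smooth_near A p k \<longrightarrow>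
        v (\<lambda>q. g q + k q) = v g + v k \<and> v (\<lambda>q. g q * k q) = v g * k p + g p * v k) \<and>
     (\<forall>c g. smooth_near A p g \<longrightarrow> v (\<lambda>q. c * g q) = c * v g)}"

definition tangent_bundle ::
    "('a::topological_space, 'n::finite) atlas \<Rightarrow> ('a, 'a tvec) vbundle" where
  "tangent_bundle A =
     \<lparr>fibre = tangent_space A,
      sections = (\<lambda>U. {X. (\<forall>p\<in>U. X p \<in> tangent_space A p) \<and>
         (\<forall>W (g :: 'a \<Rightarrow> real). open W \<longrightarrow> W \<subseteq> U \<longrightarrow> smooth_fn A W g
            \<longrightarrow> smooth_fn A W (\<lambda>q. X q g))})\<rparr>"

definition lie_bracket ::
    "('a::topological_space, 'n::finite) atlas \<Rightarrow> ('a \<Rightarrow> 'a tvec) \<Rightarrow> ('a \<Rightarrow> 'a tvec) \<Rightarrow> 'a \<Rightarrow> 'a tvec" where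
  "lie_bracket A X Y p =
     (\<lambda>g. if smooth_near A p g then X p (\<lambda>q. Y q g) - Y p (\<lambda>q. X q g) else 0)"

text \<open>\<open>deriv_along v F\<close> is the differential of \<open>F\<close> applied to \<open>v\<close>; for a vector field \<open>F\<close> along an
  immersion into Euclidean space it is the flat covariant derivative of \<open>F\<close> in direction \<open>v\<close>.\<close>

definition deriv_along :: "'a tvec \<Rightarrow> ('a \<Rightarrow> real ^ 'm) \<Rightarrow> real ^ 'm"
  where "deriv_along v F = (\<chi> i. v (\<lambda>q. F q $ i))"


section \<open>Connections\<close>

text \<open>\<open>D p v s\<close> is the covariant derivative at \<open>p\<close> of the section \<open>s\<close>, smooth near \<open>p\<close>, in direction
  \<open>v\<close>. Being tensorial in the vector field and local in the section, connections restrict to open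
  sets, and this presentation builds the restrictions in.\<close>

type_synonym ('a, 'v) conn = "'a \<Rightarrow> 'a tvec \<Rightarrow> ('a \<Rightarrow> 'v) \<Rightarrow> 'v"

definition connection ::
    "('a::topological_space, 'n::finite) atlas \<Rightarrow> 'a set \<Rightarrow> ('a, 'v::real_vector) vbundle
       \<Rightarrow> ('a, 'v) conn \<Rightarrow> bool" where
  "connection A U E D \<longleftrightarrow>
     (\<forall>W. open W \<longrightarrow> W \<subseteq> U \<longrightarrow>
       (\<forall>s\<in>sections E W. \<forall>p\<in>W.
          (\<forall>v\<in>tangent_space A p. D p v s \<in> fibre E p) \<and>
          lin_on (tangent_space A p) (\<lambda>v. D p v s) \<and>
          (\<forall>t\<in>sections E W. \<forall>v\<in>tangent_space A p. D p v (\<lambda>q. s q + t q) = D p v s + D p v t) \<and>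
          (\<forall>g. smooth_fn A W g \<longrightarrow> (\<forall>v\<in>tangent_space A p.
             D p v (\<lambda>q. g q *\<^sub>R s q) = v g *\<^sub>R s p + g p *\<^sub>R D p v s))) \<and>
       (\<forall>X\<in>sections (tangent_bundle A) W. \<forall>s\<in>sections E W. (\<lambda>p. D p (X p) s) \<in> sections E W))"

definition curvature ::
    "('a::topological_space, 'n::finite) atlas \<Rightarrow> ('a, 'v::real_vector) conn
       \<Rightarrow> ('a \<Rightarrow> 'a tvec) \<Rightarrow> ('a \<Rightarrow> 'a tvec) \<Rightarrow> ('a \<Rightarrow> 'v) \<Rightarrow> 'a \<Rightarrow> 'v" where
  "curvature A D X Y s p =
     D p (X p) (\<lambda>q. D q (Y q) s) - D p (Y p) (\<lambda>q. D q (X q) s) - D p (lie_bracket A X Y p) s"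

definition flat_connection ::
    "('a::topological_space, 'n::finite) atlas \<Rightarrow> 'a set \<Rightarrow> ('a, 'v::real_vector) vbundle
       \<Rightarrow> ('a, 'v) conn \<Rightarrow> bool" where
  "flat_connection A U E D \<longleftrightarrow> connection A U E D \<and>
     (\<forall>W. open W \<longrightarrow> W \<subseteq> U \<longrightarrow>
       (\<forall>X\<in>sections (tangent_bundle A) W. \<forall>Y\<in>sections (tangent_bundle A) W.
          \<forall>s\<in>sections E W. \<forall>p\<in>W. curvature A D X Y s p = 0))"

text \<open>The endomorphism of the fibre at \<open>p\<close> induced by the curvature, which is tensorial in the
  section.\<close>

definition curvature_endo ::
    "('a::topological_space, 'n::finite) atlas \<Rightarrow> ('a, 'v::real_vector) vbundle \<Rightarrow> ('a, 'v) conn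
       \<Rightarrow> ('a \<Rightarrow> 'a tvec) \<Rightarrow> ('a \<Rightarrow> 'a tvec) \<Rightarrow> 'a \<Rightarrow> 'v \<Rightarrow> 'v" where
  "curvature_endo A E D X Y p w =
     (THE z. \<exists>W s. open W \<and> p \<in> W \<and> s \<in> sections E W \<and> s p = w \<and> z = curvature A D X Y s p)"

text \<open>For finite-dimensional \<open>V\<close> and \<open>T\<close> mapping \<open>V\<close> linearly to itself this does not depend on
  the chosen basis.\<close>

definition subspace_trace :: "'v::real_vector set \<Rightarrow> ('v \<Rightarrow> 'v) \<Rightarrow> real" where
  "subspace_trace V T =
     (let B = (SOME B. independent B \<and> span B = V) in \<Sum>b\<in>B. representation B (T b) b)"


section \<open>Projective flatness\<close>

definition bundle_map ::
    "('a::topological_space, 'n::finite) atlas \<Rightarrow> ('a, 'v::real_vector) vbundle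
       \<Rightarrow> ('a \<Rightarrow> 'a tvec \<Rightarrow> 'v) \<Rightarrow> bool" where
  "bundle_map A E \<phi> \<longleftrightarrow>
     (\<forall>p. \<phi> p ` tangent_space A p \<subseteq> fibre E p \<and> lin_on (tangent_space A p) (\<phi> p)) \<and>
     (\<forall>W. open W \<longrightarrow> (\<forall>X\<in>sections (tangent_bundle A) W. (\<lambda>p. \<phi> p (X p)) \<in> sections E W))"

definition rel_torsion_free ::
    "('a::topological_space, 'n::finite) atlas \<Rightarrow> 'a set \<Rightarrow> ('a \<Rightarrow> 'a tvec \<Rightarrow> 'v::real_vector)
       \<Rightarrow> ('a, 'v) conn \<Rightarrow> bool" where
  "rel_torsion_free A U \<phi> D \<longleftrightarrow>
     (\<forall>W. open W \<longrightarrow> W \<subseteq> U \<longrightarrow>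
       (\<forall>X\<in>sections (tangent_bundle A) W. \<forall>Y\<in>sections (tangent_bundle A) W. \<forall>p\<in>W.
          D p (X p) (\<lambda>q. \<phi> q (Y q)) - D p (Y p) (\<lambda>q. \<phi> q (X q)) - \<phi> p (lie_bracket A X Y p) = 0))"

definition projectively_equivalent ::
    "('a::topological_space, 'n::finite) atlas \<Rightarrow> 'a set \<Rightarrow> ('a, 'v::real_vector) vbundle
       \<Rightarrow> ('a \<Rightarrow> 'a tvec \<Rightarrow> 'v) \<Rightarrow> ('a, 'v) conn \<Rightarrow> ('a, 'v) conn \<Rightarrow> bool" where
  "projectively_equivalent A U E \<phi> D D' \<longleftrightarrow>
     connection A U E D \<and> rel_torsion_free A U \<phi> D \<and>
     connection A U E D' \<and> rel_torsion_free A U \<phi> D' \<and>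
     (\<exists>\<rho>\<in>sections (dual_bundle A E) U. \<forall>W. open W \<longrightarrow> W \<subseteq> U \<longrightarrow>
        (\<forall>X\<in>sections (tangent_bundle A) W. \<forall>s\<in>sections E W. \<forall>p\<in>W.
           D' p (X p) s = D p (X p) s + \<rho> p (\<phi> p (X p)) *\<^sub>R s p + \<rho> p (s p) *\<^sub>R \<phi> p (X p)))"

definition projectively_flat ::
    "('a::topological_space, 'n::finite) atlas \<Rightarrow> ('a, 'v::real_vector) vbundle
       \<Rightarrow> ('a \<Rightarrow> 'a tvec \<Rightarrow> 'v) \<Rightarrow> ('a, 'v) conn \<Rightarrow> bool" where
  "projectively_flat A E \<phi> D \<longleftrightarrow>
     vector_bundle A CARD('n) E \<and> bundle_map A E \<phi> \<and>
     connection A UNIV E D \<and> rel_torsion_free A UNIV \<phi> D \<and>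
     (\<forall>p. \<exists>U D'. open U \<and> p \<in> U \<and> flat_connection A U E D' \<and> projectively_equivalent A U E \<phi> D D')"


section \<open>Affine immersions\<close>

definition immersion ::
    "('a::topological_space, 'n::finite) atlas \<Rightarrow> ('a \<Rightarrow> real ^ 'm::finite) \<Rightarrow> bool" where
  "immersion A f \<longleftrightarrow>
     smooth_fn A UNIV f \<and> (\<forall>p. inj_on (\<lambda>v. deriv_along v f) (tangent_space A p))"

text \<open>\<open>f\<^sub>*(T\<^sub>pM)\<close>\<close>

definition image_tangent ::
    "('a::topological_space, 'n::finite) atlas \<Rightarrow> ('a \<Rightarrow> real ^ 'm::finite) \<Rightarrow> 'a \<Rightarrow> (real ^ 'm) set" where
  "image_tangent A f p = (\<lambda>v. deriv_along v f) ` tangent_space A p"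

definition affine_immersion ::
    "('a::topological_space, 'n::finite) atlas \<Rightarrow> ('a \<Rightarrow> real ^ 'm::finite)
       \<Rightarrow> ('a \<Rightarrow> real ^ 'm) \<Rightarrow> bool" where
  "affine_immersion A f \<xi> \<longleftrightarrow>
     immersion A f \<and> smooth_fn A UNIV \<xi> \<and>
     (\<forall>p. {w + z |w z. w \<in> image_tangent A f p \<and> z \<in> span {\<xi> p}} = UNIV \<and>
          image_tangent A f p \<inter> span {\<xi> p} = {0})"

text \<open>The components of \<open>w = f\<^sub>*(u) + c \<xi>\<^sub>p\<close>.\<close>

definition tangential_part ::
    "('a::topological_space, 'n::finite) atlas \<Rightarrow> ('a \<Rightarrow> real ^ 'm::finite)
       \<Rightarrow> ('a \<Rightarrow> real ^ 'm) \<Rightarrow> 'a \<Rightarrow> real ^ 'm \<Rightarrow> 'a tvec" where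
  "tangential_part A f \<xi> p w =
     (THE u. u \<in> tangent_space A p \<and> (\<exists>c. w = deriv_along u f + c *\<^sub>R \<xi> p))"

definition transversal_part ::
    "('a::topological_space, 'n::finite) atlas \<Rightarrow> ('a \<Rightarrow> real ^ 'm::finite)
       \<Rightarrow> ('a \<Rightarrow> real ^ 'm) \<Rightarrow> 'a \<Rightarrow> real ^ 'm \<Rightarrow> real" where
  "transversal_part A f \<xi> p w =
     (THE c. \<exists>u\<in>tangent_space A p. w = deriv_along u f + c *\<^sub>R \<xi> p)"

definition induced_connection ::
    "('a::topological_space, 'n::finite) atlas \<Rightarrow> ('a \<Rightarrow> real ^ 'm::finite)
       \<Rightarrow> ('a \<Rightarrow> real ^ 'm) \<Rightarrow> ('a, 'a tvec) conn" where
  "induced_connection A f \<xi> p v Y =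
     tangential_part A f \<xi> p (deriv_along v (\<lambda>q. deriv_along (Y q) f))"

text \<open>\<open>h\<close> is tensorial: the value does not depend on the local vector field extending \<open>w\<close>.\<close>

definition second_fundamental_form ::
    "('a::topological_space, 'n::finite) atlas \<Rightarrow> ('a \<Rightarrow> real ^ 'm::finite)
       \<Rightarrow> ('a \<Rightarrow> real ^ 'm) \<Rightarrow> 'a \<Rightarrow> 'a tvec \<Rightarrow> 'a tvec \<Rightarrow> real" where
  "second_fundamental_form A f \<xi> p v w =
     (THE c. \<exists>W Y. open W \<and> p \<in> W \<and> Y \<in> sections (tangent_bundle A) W \<and> Y p = w \<and>
        c = transversal_part A f \<xi> p (deriv_along v (\<lambda>q. deriv_along (Y q) f)))"

text \<open>The form \<open>\<tau>\<close> in \<open>D\<^sub>X \<xi> = - f\<^sub>*(S(X)) + \<tau>(X) \<xi>\<close>.\<close>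

definition transversal_form ::
    "('a::topological_space, 'n::finite) atlas \<Rightarrow> ('a \<Rightarrow> real ^ 'm::finite)
       \<Rightarrow> ('a \<Rightarrow> real ^ 'm) \<Rightarrow> 'a \<Rightarrow> 'a tvec \<Rightarrow> real" where
  "transversal_form A f \<xi> p v = transversal_part A f \<xi> p (deriv_along v \<xi>)"

definition equiaffine_immersion ::
    "('a::topological_space, 'n::finite) atlas \<Rightarrow> ('a \<Rightarrow> real ^ 'm::finite)
       \<Rightarrow> ('a \<Rightarrow> real ^ 'm) \<Rightarrow> bool" where
  "equiaffine_immersion A f \<xi> \<longleftrightarrow>
     affine_immersion A f \<xi> \<and> (\<forall>p. \<forall>v\<in>tangent_space A p. transversal_form A f \<xi> p v = 0)"

definition conormal ::
    "('a::topological_space, 'n::finite) atlas \<Rightarrow> ('a \<Rightarrow> real ^ 'm::finite)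
       \<Rightarrow> ('a \<Rightarrow> real ^ 'm) \<Rightarrow> 'a \<Rightarrow> real ^ 'm \<Rightarrow> real" where
  "conormal A f \<xi> p =
     (THE \<alpha>. linear \<alpha> \<and> (\<forall>v\<in>tangent_space A p. \<alpha> (deriv_along v f) = 0) \<and> \<alpha> (\<xi> p) = 1)"

text \<open>\<open>\<nu>\<^sub>* v\<close>, an element of the dual of the ambient space\<close>

definition conormal_deriv ::
    "('a::topological_space, 'n::finite) atlas \<Rightarrow> ('a \<Rightarrow> real ^ 'm::finite)
       \<Rightarrow> ('a \<Rightarrow> real ^ 'm) \<Rightarrow> 'a tvec \<Rightarrow> real ^ 'm \<Rightarrow> real" where
  "conormal_deriv A f \<xi> v = (\<lambda>w. v (\<lambda>q. conormal A f \<xi> q w))"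


section \<open>The induced quasi-Codazzi structure\<close>

record ('a, 'v, 'w) quasi_codazzi =
  qc_h :: "'a \<Rightarrow> 'a tvec \<Rightarrow> 'a tvec \<Rightarrow> real"
  qc_Eplus :: "('a, 'v) vbundle"
  qc_Eminus :: "('a, 'w) vbundle"
  qc_E :: "('a, 'v \<times> 'w) vbundle"
  qc_theta :: "'v \<times> 'w \<Rightarrow> 'v \<times> 'w \<Rightarrow> real"
  qc_I :: "'v \<times> 'w \<Rightarrow> 'v \<times> 'w"
  qc_Phi :: "'a \<Rightarrow> 'a tvec \<Rightarrow> 'v \<times> 'w"
  qc_nabla_plus :: "('a, 'v) conn"
  qc_nabla_minus :: "('a, 'w) conn"

definition Eplus ::
    "('a::topological_space, 'n::finite) atlas \<Rightarrow> ('a \<Rightarrow> real ^ 'm::finite)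
       \<Rightarrow> ('a, real ^ 'm) vbundle" where
  "Eplus A f =
     \<lparr>fibre = image_tangent A f,
      sections = (\<lambda>U. {\<eta>. smooth_fn A U \<eta> \<and> (\<forall>p\<in>U. \<eta> p \<in> image_tangent A f p)})\<rparr>"

definition Eminus ::
    "('a::topological_space, 'n::finite) atlas \<Rightarrow> ('a \<Rightarrow> real ^ 'm::finite)
       \<Rightarrow> ('a, real ^ 'm \<Rightarrow> real) vbundle" where
  "Eminus A f = dual_bundle A (Eplus A f)"

definition pairing_theta ::
    "(real ^ 'm::finite) \<times> (real ^ 'm \<Rightarrow> real) \<Rightarrow> (real ^ 'm) \<times> (real ^ 'm \<Rightarrow> real) \<Rightarrow> real" where
  "pairing_theta \<eta> \<zeta> = (1/2) * (snd \<zeta> (fst \<eta>) + snd \<eta> (fst \<zeta>))"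

definition nabla_plus ::
    "('a::topological_space, 'n::finite) atlas \<Rightarrow> ('a \<Rightarrow> real ^ 'm::finite)
       \<Rightarrow> ('a \<Rightarrow> real ^ 'm) \<Rightarrow> ('a, real ^ 'm) conn" where
  "nabla_plus A f \<xi> p v \<eta> =
     deriv_along (induced_connection A f \<xi> p v
       (\<lambda>q. inv_into (tangent_space A q) (\<lambda>u. deriv_along u f) (\<eta> q))) f"

text \<open>\<open>\<omega> = \<nabla>\<^sup>-\<^sub>v \<zeta>\<close> is determined by
  \<open>v \<theta>(\<eta>, \<zeta>) = \<theta>(\<nabla>\<^sup>+\<^sub>v \<eta>, \<zeta>) + \<theta>(\<eta>, \<omega>)\<close> for all local sections \<open>\<eta>\<close> of \<open>E\<^sup>+\<close>.\<close>

definition nabla_minus ::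
    "('a::topological_space, 'n::finite) atlas \<Rightarrow> ('a \<Rightarrow> real ^ 'm::finite)
       \<Rightarrow> ('a \<Rightarrow> real ^ 'm) \<Rightarrow> ('a, real ^ 'm \<Rightarrow> real) conn" where
  "nabla_minus A f \<xi> p v \<zeta> =
     (THE \<omega>. \<omega> \<in> fibre (Eminus A f) p \<and>
        (\<forall>W \<eta>. open W \<longrightarrow> p \<in> W \<longrightarrow> \<eta> \<in> sections (Eplus A f) W \<longrightarrow>
           v (\<lambda>q. pairing_theta (\<eta> q, 0) (0, \<zeta> q)) =
             pairing_theta (nabla_plus A f \<xi> p v \<eta>, 0) (0, \<zeta> p) + pairing_theta (\<eta> p, 0) (0, \<omega>)))"

definition induced_quasi_codazzi ::
    "('a::topological_space, 'n::finite) atlas \<Rightarrow> ('a \<Rightarrow> real ^ 'm::finite)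
       \<Rightarrow> ('a \<Rightarrow> real ^ 'm) \<Rightarrow> ('a, real ^ 'm, real ^ 'm \<Rightarrow> real) quasi_codazzi" where
  "induced_quasi_codazzi A f \<xi> =
     \<lparr>qc_h = second_fundamental_form A f \<xi>,
      qc_Eplus = Eplus A f,
      qc_Eminus = Eminus A f,
      qc_E = sum_bundle (Eplus A f) (Eminus A f),
      qc_theta = pairing_theta,
      qc_I = (\<lambda>(a, \<alpha>). (a, - \<alpha>)),
      qc_Phi = (\<lambda>p v. (deriv_along v f, restrict0 (image_tangent A f p) (- conormal_deriv A f \<xi> v))),
      qc_nabla_plus = nabla_plus A f \<xi>,
      qc_nabla_minus = nabla_minus A f \<xi>\<rparr>"

end

theory Submission
  imports Defs
begin

text \<open>Throughout, \<open>\<langle>_, _\<rangle>\<close> is the pairing of covectors with vectors of \<open>\<real>\<^sup>n\<^sup>+\<^sup>1\<close>; covectors are represented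
  by vectors through the standard inner product.

  An element \<open>\<zeta>\<close> of \<open>E\<^sup>-\<^sub>p\<close>, the dual of the hyperplane \<open>H = f\<^sub>*(T\<^sub>pM)\<close>, has a unique extension
  \<open>Z\<close> to \<open>\<real>\<^sup>n\<^sup>+\<^sup>1\<close> with \<open>\<langle>Z, \<xi>\<rangle> = 0\<close>. Since \<open>\<nabla>\<^sup>+\<close> is the tangential part of the flat derivative
  \<open>d\<close>, duality gives \<open>\<nabla>\<^sup>-\<^sub>X \<zeta> = (dZ(X))|H\<close>. As \<open>\<nu>\<close> spans the covectors vanishing on \<open>H\<close>,
  other extensions differ from \<open>Z\<close> by multiples of \<open>\<nu>\<close>. Everything else is a computation
  with vector-valued functions and their ordinary derivatives. The equiaffine condition enters
  through \<open>\<langle>d\<nu>(X), \<xi>\<rangle> = - \<langle>\<nu>, d\<xi>(X)\<rangle> = 0\<close>, so that \<open>- d\<nu>(X)\<close> is itself the distinguished extension of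
  \<open>\<Phi>\<^sup>-(X)\<close>; hence \<open>\<nabla>\<^sup>-\<^sub>X \<Phi>\<^sup>-(Y) = - (X Y \<nu>)|H\<close>, and \<open>\<nabla>\<^sup>-\<close> is relatively torsion-free.

  Projective flatness. Fix a point \<open>p\<close>, put \<open>w\<^sub>0 = \<xi>\<^sub>p\<close> and \<open>g = \<langle>\<nu>, w\<^sub>0\<rangle>\<close>, which is nonzero near \<open>p\<close>.
  There every \<open>\<zeta>\<close> also has a unique extension annihilating the fixed vector \<open>w\<^sub>0\<close>, namely
  \<open>Z - g\<^sup>-\<^sup>1 \<langle>Z, w\<^sub>0\<rangle> \<nu>\<close>. Divided by \<open>g\<close>, it identifies \<open>E\<^sup>-\<close> locally with the trivial bundle whose
  fibre is the annihilator of \<open>w\<^sub>0\<close>, and pulling back \<open>d\<close> yields a flat connection. Differentiating,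
  this connection is \<open>\<nabla>\<^sup>-\<^sub>X \<zeta> - g\<^sup>-\<^sup>1 (X g) \<zeta> - g\<^sup>-\<^sup>1 \<langle>Z, w\<^sub>0\<rangle> d\<nu>(X)|H\<close>, which is the projective change of
  \<open>\<nabla>\<^sup>-\<close> by \<open>\<rho>(\<zeta>) = g\<^sup>-\<^sup>1 \<langle>Z, w\<^sub>0\<rangle>\<close>, because \<open>\<rho>(\<Phi>\<^sup>-(X)) = - g\<^sup>-\<^sup>1 \<langle>d\<nu>(X), w\<^sub>0\<rangle> = - g\<^sup>-\<^sup>1 X g\<close>. The division by \<open>g\<close>
  is what produces the first of the two correction terms. See \<open>flat_conn_eq\<close> and
  \<open>flat_connection_flat_conn\<close>.

  Trace. From the formula for \<open>\<nabla>\<^sup>-\<close>, the curvature is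
  \<open>R(X,Y) \<zeta> = \<zeta>(d\<xi>(Y)) d\<nu>(X)|H - \<zeta>(d\<xi>(X)) d\<nu>(Y)|H\<close> (lemma \<open>curvature_nabla_minus\<close>), with trace
  \<open>\<langle>d\<nu>(X), d\<xi>(Y)\<rangle> - \<langle>d\<nu>(Y), d\<xi>(X)\<rangle>\<close>. Differentiating \<open>\<langle>d\<nu>(Y), \<xi>\<rangle> = 0\<close> along \<open>X\<close> and conversely shows that
  this equals \<open>\<langle>d\<nu>([X,Y]), \<xi>\<rangle> = 0\<close>.

  Two preliminary facts need more than such computations. The conormal is smooth because it is a quotient of
  determinants in a chart (lemma \<open>conormal_chart_formula\<close>). And \<open>\<xi>\<close> has no zeros: otherwise the
  hyperplane \<open>H\<close> would be all of \<open>\<real>\<^sup>n\<^sup>+\<^sup>1\<close>, which is impossible as tangent vectors, being derivations,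
  form a space of dimension at most \<open>n\<close>. The latter rests on Hadamard's lemma.\<close>


section \<open>Calculus of smooth maps on open sets\<close>

lemma Ck_on_cong:
  assumes "open S" and "\<And>x. x \<in> S \<Longrightarrow> f x = g x"
  shows "Ck_on k S f \<longleftrightarrow> Ck_on k S g"
proof -
  have imp: "Ck_on k S g" if "Ck_on k S f" "\<And>x. x \<in> S \<Longrightarrow> f x = g x"
    for f g :: "'a \<Rightarrow> 'b" and k
    using that
  proof (induction k arbitrary: f g)
    case 0
    then show ?case
      by (simp cong: continuous_on_cong)
  next
    case (Suc k)
    have fr: "frechet_derivative g (at x) = frechet_derivative f (at x)" if "x \<in> S" for x
      using Suc.prems that assms(1)
      by (intro frechet_derivative_transform_within_open[symmetric]) auto
    have "g differentiable (at x)" if x: "x \<in> S" for x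
    proof -
      have "f differentiable (at x)" using Suc.prems x by simp
      then obtain D where "(f has_derivative D) (at x)" unfolding differentiable_def by blast
      then have "(g has_derivative D) (at x)"
        by (rule has_derivative_transform_within_open[OF _ assms(1) x]) (use Suc.prems in auto)
      then show ?thesis unfolding differentiable_def by blast
    qed
    moreover have "Ck_on k S (\<lambda>x. frechet_derivative g (at x) v)" for v
      by (rule Suc.IH[of "\<lambda>x. frechet_derivative f (at x) v"]) (use Suc.prems fr in auto)
    ultimately show ?case by simp
  qed
  show ?thesis
    using imp[of k f g] imp[of k g f] assms(2) by fastforce
qed

lemma Ck_on_subset: "Ck_on k S f \<Longrightarrow> T \<subseteq> S \<Longrightarrow> Ck_on k T f"
  by (induction k arbitrary: f) (auto intro: continuous_on_subset)

text \<open>Smoothness is a local property; for \<open>k = 0\<close> this uses that \<open>T\<close> is open in the whole space.\<close>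

lemma Ck_on_local:
  assumes "\<And>x. x \<in> S \<Longrightarrow> \<exists>T. open T \<and> x \<in> T \<and> Ck_on k T f"
  shows "Ck_on k S f"
  using assms
proof (induction k arbitrary: f)
  case 0
  have "isCont f x" if "x \<in> S" for x
    using 0[OF that] continuous_on_eq_continuous_at by auto
  then show ?case
    by (simp add: continuous_at_imp_continuous_on)
next
  case (Suc k)
  have "Ck_on k S (\<lambda>x. frechet_derivative f (at x) v)" for v
    by (rule Suc.IH) (use Suc.prems in fastforce)
  then show ?case
    using Suc.prems by fastforce
qed

lemma Ck_on_Suc_imp: "Ck_on (Suc k) S f \<Longrightarrow> Ck_on k S f"
proof (induction k arbitrary: f)
  case 0
  then show ?case
    by (auto intro!: continuous_at_imp_continuous_on differentiable_imp_continuous_within)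
next
  case (Suc k)
  have "Ck_on k S (\<lambda>x. frechet_derivative f (at x) v)" for v
    by (rule Suc.IH) (use Suc.prems in simp)
  then show ?case
    using Suc.prems by simp
qed

lemma Ck_on_const: "Ck_on k S (\<lambda>x. c)"
  by (induction k arbitrary: c) auto

lemma Ck_on_add:
  assumes "open S" "Ck_on k S f" "Ck_on k S g"
  shows "Ck_on k S (\<lambda>x. f x + g x)"
  using assms(2,3)
proof (induction k arbitrary: f g)
  case 0
  then show ?case by (auto intro: continuous_on_add)
next
  case (Suc k)
  have fr: "frechet_derivative (\<lambda>x. f x + g x) (at x) v
      = frechet_derivative f (at x) v + frechet_derivative g (at x) v" if "x \<in> S" for x v
    using Suc.prems that
    by (intro fun_cong[OF frechet_derivative_at[symmetric], THEN trans] has_derivative_add)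
       (auto simp: frechet_derivative_works[symmetric])
  have "Ck_on k S (\<lambda>x. frechet_derivative f (at x) v + frechet_derivative g (at x) v)" for v
    by (rule Suc.IH) (use Suc.prems in auto)
  then have "Ck_on k S (\<lambda>x. frechet_derivative (\<lambda>x. f x + g x) (at x) v)" for v
    by (rule iffD2[OF Ck_on_cong[OF assms(1)], rotated]) (rule fr)
  then show ?case using Suc.prems by auto
qed

lemma Ck_on_bilinear:
  assumes "bounded_bilinear B" "open S" "Ck_on k S f" "Ck_on k S g"
  shows "Ck_on k S (\<lambda>x. B (f x) (g x))"
  using assms(3,4)
proof (induction k arbitrary: f g)
  case 0
  then show ?case by (auto intro: bounded_bilinear.continuous_on[OF assms(1)])
next
  case (Suc k)
  have d: "((\<lambda>x. B (f x) (g x)) has_derivative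
      (\<lambda>v. B (f x) (frechet_derivative g (at x) v) + B (frechet_derivative f (at x) v) (g x))) (at x)"
    if "x \<in> S" for x
    using Suc.prems that
    by (intro bounded_bilinear.FDERIV[OF assms(1)]) (auto simp: frechet_derivative_works[symmetric])
  have fr: "frechet_derivative (\<lambda>x. B (f x) (g x)) (at x) v
      = B (f x) (frechet_derivative g (at x) v) + B (frechet_derivative f (at x) v) (g x)"
    if "x \<in> S" for x v
    using frechet_derivative_at[OF d[OF that], symmetric] by simp
  have "Ck_on k S (\<lambda>x. B (f x) (frechet_derivative g (at x) v)
      + B (frechet_derivative f (at x) v) (g x))" for v
    using Suc.prems Ck_on_Suc_imp[OF Suc.prems(1)] Ck_on_Suc_imp[OF Suc.prems(2)]
    by (intro Ck_on_add[OF assms(2)] Suc.IH) auto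
  then have "Ck_on k S (\<lambda>x. frechet_derivative (\<lambda>x. B (f x) (g x)) (at x) v)" for v
    by (rule iffD2[OF Ck_on_cong[OF assms(2)], rotated]) (rule fr)
  moreover have "(\<lambda>x. B (f x) (g x)) differentiable (at x)" if "x \<in> S" for x
    using d[OF that] unfolding differentiable_def by blast
  ultimately show ?case by simp
qed

lemma Ck_on_inverse:
  fixes f :: "_ \<Rightarrow> real"
  assumes "open S" "Ck_on k S f" "\<And>x. x \<in> S \<Longrightarrow> f x \<noteq> 0"
  shows "Ck_on k S (\<lambda>x. inverse (f x))"
  using assms(2)
proof (induction k)
  case 0
  then show ?case using assms(3) by (auto intro: continuous_on_inverse)
next
  case (Suc k)
  have d: "((\<lambda>x. inverse (f x)) has_derivative
      (\<lambda>v. - (inverse (f x) * frechet_derivative f (at x) v * inverse (f x)))) (at x)"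
    if "x \<in> S" for x
    using Suc.prems that assms(3)
    by (intro Deriv.has_derivative_inverse) (auto simp: frechet_derivative_works[symmetric])
  have fr: "frechet_derivative (\<lambda>x. inverse (f x)) (at x) v
      = (- 1) * ((inverse (f x) * frechet_derivative f (at x) v) * inverse (f x))"
    if "x \<in> S" for x v
    using frechet_derivative_at[OF d[OF that], symmetric] by simp
  have "Ck_on k S (\<lambda>x. inverse (f x))"
    using Suc Ck_on_Suc_imp by blast
  then have "Ck_on k S (\<lambda>x. (- 1) * ((inverse (f x) * frechet_derivative f (at x) v) * inverse (f x)))" for v
    using Suc.prems by (intro Ck_on_bilinear[OF bounded_bilinear_mult assms(1)] Ck_on_const) auto
  then have "Ck_on k S (\<lambda>x. frechet_derivative (\<lambda>x. inverse (f x)) (at x) v)" for v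
    by (rule iffD2[OF Ck_on_cong[OF assms(1)], rotated]) (rule fr)
  moreover have "(\<lambda>x. inverse (f x)) differentiable (at x)" if "x \<in> S" for x
    using d[OF that] unfolding differentiable_def by blast
  ultimately show ?case by simp
qed

lemma smooth_on_deriv: "smooth_on S f \<Longrightarrow> smooth_on S (\<lambda>x. frechet_derivative f (at x) v)"
  unfolding smooth_on_def using Ck_on.simps(2) by blast

lemma smooth_on_differentiable: "smooth_on S f \<Longrightarrow> x \<in> S \<Longrightarrow> f differentiable (at x)"
  unfolding smooth_on_def using Ck_on.simps(2) by blast

lemma smooth_on_continuous: "smooth_on S f \<Longrightarrow> continuous_on S f"
  unfolding smooth_on_def using Ck_on.simps(1) by blast

lemma smooth_on_cong:
  "open S \<Longrightarrow> (\<And>x. x \<in> S \<Longrightarrow> f x = g x) \<Longrightarrow> smooth_on S f \<longleftrightarrow> smooth_on S g"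
  unfolding smooth_on_def using Ck_on_cong by blast

lemma Ck_on_sum:
  assumes "finite I" "open S" "\<And>i. i \<in> I \<Longrightarrow> Ck_on k S (f i)"
  shows "Ck_on k S (\<lambda>x. \<Sum>i\<in>I. f i x)"
  using assms(1,3)
  by (induction I rule: finite_induct) (auto intro: Ck_on_const Ck_on_add[OF assms(2)])

lemma linear_Basis_expansion:
  fixes L :: "'e::euclidean_space \<Rightarrow> 'b::real_vector"
  assumes "linear L"
  shows "L w = (\<Sum>b\<in>Basis. (w \<bullet> b) *\<^sub>R L b)"
proof -
  have "L w = L (\<Sum>b\<in>Basis. (w \<bullet> b) *\<^sub>R b)"
    by (simp add: euclidean_representation)
  then show ?thesis
    by (simp add: linear_sum[OF assms] linear_scale[OF assms])
qed

text \<open>The derivative of a composition is a combination of compositions of partial derivatives of the outer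
  map with the inner map, so the induction runs over all outer maps with the inner one fixed.\<close>

lemma smooth_on_compose:
  fixes g :: "'e::euclidean_space \<Rightarrow> 'b::real_normed_vector"
  assumes R: "open R" and sub: "h ` R \<subseteq> S" and h: "smooth_on R h" and "smooth_on S g"
  shows "smooth_on R (\<lambda>x. g (h x))"
proof -
  have "Ck_on k R (\<lambda>x. g (h x))" if "smooth_on S g" for k and g :: "'e \<Rightarrow> 'b"
    using that
  proof (induction k arbitrary: g)
    case 0
    then show ?case
      using continuous_on_compose2[OF smooth_on_continuous smooth_on_continuous[OF h] sub] by simp
  next
    case (Suc k)
    have d: "((\<lambda>x. g (h x)) has_derivative
        (\<lambda>v. frechet_derivative g (at (h x)) (frechet_derivative h (at x) v))) (at x)" if "x \<in> R" for x
      using smooth_on_differentiable[OF h that] smooth_on_differentiable[OF Suc.prems, of "h x"] that sub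
      by (intro has_derivative_compose[of h _ x UNIV g]) (auto simp: frechet_derivative_works[symmetric])
    have fr: "frechet_derivative (\<lambda>x. g (h x)) (at x) v
        = (\<Sum>b\<in>Basis. (frechet_derivative h (at x) v \<bullet> b) *\<^sub>R frechet_derivative g (at (h x)) b)"
      if x: "x \<in> R" for x v
    proof -
      have "linear (frechet_derivative g (at (h x)))"
        using smooth_on_differentiable[OF Suc.prems, of "h x"] x sub by (auto intro: linear_frechet_derivative)
      from linear_Basis_expansion[OF this] show ?thesis
        using frechet_derivative_at[OF d[OF x]] by metis
    qed
    have "Ck_on k R (\<lambda>x. \<Sum>b\<in>Basis. (frechet_derivative h (at x) v \<bullet> b) *\<^sub>R
        frechet_derivative g (at (h x)) b)" for v
      using smooth_on_deriv[OF h]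
      by (intro Ck_on_sum Ck_on_bilinear[OF bounded_bilinear_scaleR] Ck_on_bilinear[OF bounded_bilinear_inner]
          Ck_on_const Suc.IH[OF smooth_on_deriv[OF Suc.prems]] R finite_Basis) (simp add: smooth_on_def)
    then have "Ck_on k R (\<lambda>x. frechet_derivative (\<lambda>x. g (h x)) (at x) v)" for v
      by (rule iffD2[OF Ck_on_cong[OF R], rotated]) (rule fr)
    moreover have "(\<lambda>x. g (h x)) differentiable (at x)" if "x \<in> R" for x
      using d[OF that] unfolding differentiable_def by blast
    ultimately show ?case by simp
  qed
  then show ?thesis using assms unfolding smooth_on_def by blast
qed

lemma segment_point_mem:
  fixes B :: "'e::real_vector set"
  assumes "convex B" "x0 \<in> B" "x \<in> B" "t \<in> {0..1::real}"
  shows "x0 + t *\<^sub>R (x - x0) \<in> B"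
  using convexD_alt[OF assms(1-3), of t] assms(4) by (simp add: algebra_simps)

text \<open>Differentiating \<open>\<integral> t\<^sup>j g(x\<^sub>0 + t (x - x\<^sub>0)) dt\<close> under the integral sign reproduces an integral of the
  same shape with \<open>j + 1\<close> in place of \<open>j\<close> and a derivative of \<open>g\<close> in place of \<open>g\<close>; the weight \<open>t\<^sup>j\<close> is
  there to close the induction.\<close>

lemma smooth_on_weighted_ray_integral:
  fixes g :: "'e::euclidean_space \<Rightarrow> real"
  assumes B: "open B" "convex B" "x0 \<in> B" and "smooth_on B g"
  shows "smooth_on B (\<lambda>x. integral {0..1} (\<lambda>t. t ^ j * g (x0 + t *\<^sub>R (x - x0))))"
proof -
  have cont: "continuous_on (B \<times> {0..1}) (\<lambda>(x, t). t ^ j * g (x0 + t *\<^sub>R (x - x0)))"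
    if "smooth_on B g" for j and g :: "'e \<Rightarrow> real"
    unfolding case_prod_beta
    by (intro continuous_intros continuous_on_compose2[OF smooth_on_continuous[OF that]])
       (auto intro!: segment_point_mem[OF B(2,3)])
  have d: "((\<lambda>x. integral {0..1} (\<lambda>t. t ^ j * g (x0 + t *\<^sub>R (x - x0)))) has_derivative
      (\<lambda>v. integral {0..1} (\<lambda>t. t ^ Suc j * frechet_derivative g (at (x0 + t *\<^sub>R (x - x0))) v))) (at x)"
    if g: "smooth_on B g" and x: "x \<in> B" for j and g :: "'e \<Rightarrow> real" and x
  proof -
    let ?D = "\<lambda>x t. Blinfun (\<lambda>v. t ^ Suc j * frechet_derivative g (at (x0 + t *\<^sub>R (x - x0))) v)"
    have diff: "(g has_derivative frechet_derivative g (at (x0 + t *\<^sub>R (x - x0)))) (at (x0 + t *\<^sub>R (x - x0)))"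
      if "x \<in> B" "t \<in> {0..1}" for x t
      using smooth_on_differentiable[OF g segment_point_mem[OF B(2,3) that]]
      by (simp add: frechet_derivative_works)
    have app: "blinfun_apply (?D x t) = (\<lambda>v. t ^ Suc j * frechet_derivative g (at (x0 + t *\<^sub>R (x - x0))) v)"
      if "x \<in> B" "t \<in> {0..1}" for x t
      using has_derivative_bounded_linear[OF diff[OF that]]
      by (intro bounded_linear_Blinfun_apply bounded_linear_const_mult)
    have contD: "continuous_on (B \<times> {0..1}) (\<lambda>(x, t). ?D x t)"
    proof (rule continuous_on_blinfun_componentwise)
      fix i :: 'e
      show "continuous_on (B \<times> {0..1}) (\<lambda>x. blinfun_apply (case x of (x, t) \<Rightarrow> ?D x t) i)"
        by (rule continuous_on_eq[OF cont[OF smooth_on_deriv[OF g, of i], of "Suc j"]]) (auto simp: app simp del: power_Suc)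
    qed
    have "((\<lambda>x. integral (cbox 0 1) (\<lambda>t. t ^ j * g (x0 + t *\<^sub>R (x - x0)))) has_derivative
        blinfun_apply (integral (cbox 0 1) (?D x))) (at x within B)"
    proof (rule leibniz_rule[OF _ _ _ x B(2)])
      fix y and t :: real assume y: "y \<in> B" and t: "t \<in> cbox 0 1"
      have "((\<lambda>x. x0 + t *\<^sub>R (x - x0)) has_derivative (\<lambda>v. t *\<^sub>R v)) (at y within B)"
        by (auto intro!: derivative_eq_intros)
      from has_derivative_compose[OF this diff[OF y]]
      have "((\<lambda>x. g (x0 + t *\<^sub>R (x - x0))) has_derivative
          (\<lambda>v. frechet_derivative g (at (x0 + t *\<^sub>R (y - x0))) (t *\<^sub>R v))) (at y within B)"
        using t by simp
      then have "((\<lambda>x. t ^ j * g (x0 + t *\<^sub>R (x - x0))) has_derivative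
          (\<lambda>v. t ^ j * frechet_derivative g (at (x0 + t *\<^sub>R (y - x0))) (t *\<^sub>R v))) (at y within B)"
        by (rule has_derivative_mult_right)
      moreover have "linear (frechet_derivative g (at (x0 + t *\<^sub>R (y - x0))))"
        using has_derivative_linear[OF diff[OF y]] t by simp
      ultimately show "((\<lambda>x. t ^ j * g (x0 + t *\<^sub>R (x - x0))) has_derivative blinfun_apply (?D y t)) (at y within B)"
        unfolding app[OF y t[unfolded cbox_interval]] by (simp add: linear_scale algebra_simps)
    next
      fix y assume "y \<in> B"
      then show "(\<lambda>t. t ^ j * g (x0 + t *\<^sub>R (y - x0))) integrable_on cbox 0 1"
        by (intro integrable_continuous continuous_intros continuous_on_compose2[OF smooth_on_continuous[OF g]])
           (auto intro!: segment_point_mem[OF B(2,3)])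
    next
      show "continuous_on (B \<times> cbox 0 1) (\<lambda>(x, t). ?D x t)"
        using contD by simp
    qed
    moreover have "blinfun_apply (integral (cbox 0 1) (?D x))
        = (\<lambda>v. integral {0..1} (\<lambda>t. t ^ Suc j * frechet_derivative g (at (x0 + t *\<^sub>R (x - x0))) v))"
    proof
      fix v
      have "continuous_on {0..1::real} (\<lambda>t. (x, t))" "(\<lambda>t. (x, t)) ` {0..1::real} \<subseteq> B \<times> {0..1}"
        using x by (auto intro!: continuous_on_Pair continuous_on_const continuous_on_id)
      from continuous_on_compose2[OF contD this] have "continuous_on (cbox 0 1) (?D x)"
        by (simp del: power_Suc)
      then have "?D x integrable_on cbox 0 1"
        by (rule integrable_continuous)
      then have "blinfun_apply (integral (cbox 0 1) (?D x)) v = integral (cbox 0 1) (\<lambda>t. blinfun_apply (?D x t) v)"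
        by (rule blinfun_apply_integral)
      also have "\<dots> = integral (cbox 0 1) (\<lambda>t. t ^ Suc j * frechet_derivative g (at (x0 + t *\<^sub>R (x - x0))) v)"
        by (rule integral_cong) (use x in \<open>simp add: app del: power_Suc\<close>)
      finally show "blinfun_apply (integral (cbox 0 1) (?D x)) v
        = integral {0..1} (\<lambda>t. t ^ Suc j * frechet_derivative g (at (x0 + t *\<^sub>R (x - x0))) v)"
        by simp
    qed
    ultimately show ?thesis
      using at_within_open[OF x B(1)] by (simp del: power_Suc)
  qed
  have "Ck_on k B (\<lambda>x. integral {0..1} (\<lambda>t. t ^ j * g (x0 + t *\<^sub>R (x - x0))))"
    if "smooth_on B g" for k j and g :: "'e \<Rightarrow> real"
    using that
  proof (induction k arbitrary: j g)
    case 0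
    show ?case
      using d[OF 0] by (auto intro!: continuous_at_imp_continuous_on has_derivative_continuous)
  next
    case (Suc k)
    have "Ck_on k B (\<lambda>x. frechet_derivative (\<lambda>x. integral {0..1} (\<lambda>t. t ^ j * g (x0 + t *\<^sub>R (x - x0)))) (at x) v)" for v
      by (rule iffD2[OF Ck_on_cong[OF B(1)] Suc.IH[OF smooth_on_deriv[OF Suc.prems, of v], of "Suc j"]])
         (simp flip: frechet_derivative_at[OF d[OF Suc.prems]])
    then show ?case
      using d[OF Suc.prems] unfolding Ck_on.simps differentiable_def by blast
  qed
  then show ?thesis
    using assms unfolding smooth_on_def by blast
qed

text \<open>Integrate the derivative of \<open>g\<close> along the segment from \<open>x\<^sub>0\<close> to \<open>x\<close>. The functions \<open>G b\<close> are the averages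
  of the partial derivatives over this segment.\<close>

lemma hadamard:
  fixes g :: "'e::euclidean_space \<Rightarrow> real"
  assumes B: "open B" "convex B" "x0 \<in> B" and g: "smooth_on B g"
  obtains G where "\<And>b. smooth_on B (G b)"
    and "\<And>b. G b x0 = frechet_derivative g (at x0) b"
    and "\<And>x. x \<in> B \<Longrightarrow> g x = g x0 + (\<Sum>b\<in>Basis. ((x - x0) \<bullet> b) * G b x)"
proof -
  define G where "G b x = integral {0..1} (\<lambda>t. frechet_derivative g (at (x0 + t *\<^sub>R (x - x0))) b)" for b x
  have "smooth_on B (G b)" for b
    using smooth_on_weighted_ray_integral[OF B smooth_on_deriv[OF g, of b], of 0] by (simp add: G_def[abs_def])
  moreover have "G b x0 = frechet_derivative g (at x0) b" for b
    by (simp add: G_def)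
  moreover have "g x = g x0 + (\<Sum>b\<in>Basis. ((x - x0) \<bullet> b) * G b x)" if x: "x \<in> B" for x
  proof -
    let ?D = "\<lambda>t. frechet_derivative g (at (x0 + t *\<^sub>R (x - x0)))"
    have diff: "(g has_derivative ?D t) (at (x0 + t *\<^sub>R (x - x0)))" if "t \<in> {0..1}" for t
      using smooth_on_differentiable[OF g segment_point_mem[OF B(2,3) x that]]
      by (simp add: frechet_derivative_works)
    have "((\<lambda>t. ?D t (x - x0)) has_integral g (x0 + 1 *\<^sub>R (x - x0)) - g (x0 + 0 *\<^sub>R (x - x0))) {0..1}"
    proof (rule fundamental_theorem_of_calculus)
      fix t :: real assume t: "t \<in> {0..1}"
      have "((\<lambda>t. x0 + t *\<^sub>R (x - x0)) has_derivative (\<lambda>s. s *\<^sub>R (x - x0))) (at t within {0..1})"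
        by (auto intro!: derivative_eq_intros)
      from has_derivative_compose[OF this diff[OF t]]
      show "((\<lambda>t. g (x0 + t *\<^sub>R (x - x0))) has_vector_derivative ?D t (x - x0)) (at t within {0..1})"
        using linear_scale[OF has_derivative_linear[OF diff[OF t]]] by (simp add: has_vector_derivative_def)
    qed simp
    then have 1: "integral {0..1} (\<lambda>t. ?D t (x - x0)) = g x - g x0"
      by (simp add: integral_unique)
    have int: "(\<lambda>t. ?D t b) integrable_on {0..1}" for b
      using x by (intro integrable_continuous_interval continuous_intros
          continuous_on_compose2[OF smooth_on_continuous[OF smooth_on_deriv[OF g]]])
        (auto intro!: segment_point_mem[OF B(2,3)])
    have "integral {0..1} (\<lambda>t. ?D t (x - x0)) = integral {0..1} (\<lambda>t. \<Sum>b\<in>Basis. ((x - x0) \<bullet> b) * ?D t b)"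
      by (rule integral_cong)
         (use linear_Basis_expansion[OF has_derivative_linear[OF diff], of _ "x - x0"] in simp)
    also have "\<dots> = (\<Sum>b\<in>Basis. ((x - x0) \<bullet> b) * G b x)"
      using int by (subst integral_sum) (auto simp: G_def intro: integrable_on_mult_right)
    finally show ?thesis using 1 by simp
  qed
  ultimately show thesis by (rule that)
qed

lemma Ck_on_prod:
  fixes f :: "'i \<Rightarrow> 'e::real_normed_vector \<Rightarrow> real"
  assumes "finite I" "open S" "\<And>i. i \<in> I \<Longrightarrow> Ck_on k S (f i)"
  shows "Ck_on k S (\<lambda>x. \<Prod>i\<in>I. f i x)"
  using assms(1,3)
  by (induction I rule: finite_induct)
     (auto intro: Ck_on_const Ck_on_bilinear[OF bounded_bilinear_mult assms(2)])

lemma Ck_on_det: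
  fixes M :: "'e::real_normed_vector \<Rightarrow> real ^ 'm ^ 'm::finite"
  assumes "open S" "\<And>i j. Ck_on k S (\<lambda>x. M x $ i $ j)"
  shows "Ck_on k S (\<lambda>x. det (M x))"
  unfolding det_def
  by (intro Ck_on_sum Ck_on_bilinear[OF bounded_bilinear_mult assms(1)] Ck_on_const Ck_on_prod assms
      finite_permutations finite)


section \<open>Smooth functions on a manifold\<close>

locale smooth_manifold =
  fixes A :: "('a::t2_space, 'n::finite) atlas"
  assumes atlas: "smooth_atlas A"
begin

lemma chart_open: "(U, \<phi>) \<in> A \<Longrightarrow> open U"
  using atlas unfolding smooth_atlas_def by blast

lemma chart_homeomorphism: "(U, \<phi>) \<in> A \<Longrightarrow> homeomorphism U (\<phi> ` U) \<phi> (inv_into U \<phi>)"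
  using atlas unfolding smooth_atlas_def by blast

lemma chart_inverse: "(U, \<phi>) \<in> A \<Longrightarrow> q \<in> U \<Longrightarrow> inv_into U \<phi> (\<phi> q) = q"
  using chart_homeomorphism by (metis homeomorphism_apply1)

lemma chart_image_open:
  assumes "(U, \<phi>) \<in> A" "open W"
  shows "open (\<phi> ` (U \<inter> W))"
proof -
  have "openin (top_of_set (\<phi> ` U)) (\<phi> ` (U \<inter> W))"
    using homeomorphism_imp_open_map[OF chart_homeomorphism[OF assms(1)]] assms
    by (simp add: openin_open_Int)
  moreover have "open (\<phi> ` U)"
    using atlas assms(1) unfolding smooth_atlas_def by blast
  ultimately show ?thesis using openin_open_trans by blast
qed

lemma chart_around: obtains U \<phi> where "(U, \<phi>) \<in> A" "q \<in> U"
  using atlas unfolding smooth_atlas_def by blast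

lemma smooth_fn_cong:
  assumes "open W" "\<And>q. q \<in> W \<Longrightarrow> g q = k q"
  shows "smooth_fn A W g \<longleftrightarrow> smooth_fn A W k"
proof -
  have "smooth_on (\<phi> ` (U \<inter> W)) (g \<circ> inv_into U \<phi>) \<longleftrightarrow> smooth_on (\<phi> ` (U \<inter> W)) (k \<circ> inv_into U \<phi>)"
    if "(U, \<phi>) \<in> A" for U \<phi>
    by (rule smooth_on_cong[OF chart_image_open[OF that assms(1)]])
       (auto simp: chart_inverse[OF that] assms(2))
  then show ?thesis unfolding smooth_fn_def by blast
qed

lemma smooth_fn_subset: "smooth_fn A W g \<Longrightarrow> V \<subseteq> W \<Longrightarrow> smooth_fn A V g"
  unfolding smooth_fn_def smooth_on_def
  by (fast intro: Ck_on_subset[OF _ image_mono[OF Int_mono[OF subset_refl]]])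

lemma smooth_fn_local:
  assumes "\<And>q. q \<in> W \<Longrightarrow> \<exists>V. open V \<and> q \<in> V \<and> smooth_fn A V g"
  shows "smooth_fn A W g"
  unfolding smooth_fn_def smooth_on_def
proof clarify
  fix U \<phi> k assume c: "(U, \<phi>) \<in> A"
  show "Ck_on k (\<phi> ` (U \<inter> W)) (g \<circ> inv_into U \<phi>)"
  proof (rule Ck_on_local)
    fix x assume "x \<in> \<phi> ` (U \<inter> W)"
    then obtain q where q: "q \<in> U" "q \<in> W" "x = \<phi> q" by auto
    then obtain V where V: "open V" "q \<in> V" "smooth_fn A V g" using assms by blast
    show "\<exists>T. open T \<and> x \<in> T \<and> Ck_on k T (g \<circ> inv_into U \<phi>)"
      using chart_image_open[OF c V(1)] q V c unfolding smooth_fn_def smooth_on_def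
      by (intro exI[of _ "\<phi> ` (U \<inter> V)"]) auto
  qed
qed

lemma smooth_fn_const: "smooth_fn A W (\<lambda>q. c)"
  unfolding smooth_fn_def smooth_on_def comp_def by (auto intro: Ck_on_const)

lemma smooth_fn_bilinear:
  assumes "bounded_bilinear B" "open W" "smooth_fn A W g" "smooth_fn A W k"
  shows "smooth_fn A W (\<lambda>q. B (g q) (k q))"
  unfolding smooth_fn_def smooth_on_def comp_def
proof clarify
  fix U \<phi> i assume c: "(U, \<phi>) \<in> A"
  show "Ck_on i (\<phi> ` (U \<inter> W)) (\<lambda>x. B (g (inv_into U \<phi> x)) (k (inv_into U \<phi> x)))"
    by (rule Ck_on_bilinear[OF assms(1) chart_image_open[OF c assms(2)]])
       (use assms(3,4) c in \<open>auto simp: smooth_fn_def smooth_on_def comp_def\<close>)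
qed

lemmas smooth_fn_mult = smooth_fn_bilinear[OF bounded_bilinear_mult]
lemmas smooth_fn_scaleR = smooth_fn_bilinear[OF bounded_bilinear_scaleR]
lemmas smooth_fn_inner = smooth_fn_bilinear[OF bounded_bilinear_inner]

lemma smooth_fn_add:
  "open W \<Longrightarrow> smooth_fn A W g \<Longrightarrow> smooth_fn A W k \<Longrightarrow> smooth_fn A W (\<lambda>q. g q + k q)"
  unfolding smooth_fn_def smooth_on_def comp_def
  by (auto intro!: Ck_on_add chart_image_open)

lemma smooth_fn_minus:
  fixes g :: "'a \<Rightarrow> 'b::real_normed_vector"
  shows "open W \<Longrightarrow> smooth_fn A W g \<Longrightarrow> smooth_fn A W (\<lambda>q. - g q)"
  using smooth_fn_scaleR[OF _ smooth_fn_const, of W g "-1"] by simp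

lemma smooth_fn_diff:
  fixes g k :: "'a \<Rightarrow> 'b::real_normed_vector"
  shows "open W \<Longrightarrow> smooth_fn A W g \<Longrightarrow> smooth_fn A W k \<Longrightarrow> smooth_fn A W (\<lambda>q. g q - k q)"
  using smooth_fn_add[OF _ _ smooth_fn_minus, of W g k] by simp

lemma smooth_fn_inverse:
  fixes g :: "'a \<Rightarrow> real"
  assumes "open W" "smooth_fn A W g" "\<And>q. q \<in> W \<Longrightarrow> g q \<noteq> 0"
  shows "smooth_fn A W (\<lambda>q. inverse (g q))"
  unfolding smooth_fn_def smooth_on_def comp_def
proof clarify
  fix U \<phi> k assume c: "(U, \<phi>) \<in> A"
  show "Ck_on k (\<phi> ` (U \<inter> W)) (\<lambda>x. inverse (g (inv_into U \<phi> x)))"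
    using assms(2,3) c chart_inverse[OF c]
    by (intro Ck_on_inverse chart_image_open[OF c assms(1)])
       (auto simp: smooth_fn_def smooth_on_def comp_def)
qed

lemma smooth_fn_sum:
  assumes "finite I" "open W" "\<And>i. i \<in> I \<Longrightarrow> smooth_fn A W (g i)"
  shows "smooth_fn A W (\<lambda>q. \<Sum>i\<in>I. g i q)"
  using assms(1,3)
  by (induction I rule: finite_induct) (auto intro: smooth_fn_const smooth_fn_add[OF assms(2)])

lemma smooth_fn_vec_iff:
  fixes F :: "'a \<Rightarrow> real ^ 'm::finite"
  assumes "open W"
  shows "smooth_fn A W F \<longleftrightarrow> (\<forall>i. smooth_fn A W (\<lambda>q. F q $ i))"
proof
  assume F: "smooth_fn A W F"
  show "\<forall>i. smooth_fn A W (\<lambda>q. F q $ i)"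
    using smooth_fn_inner[OF assms F smooth_fn_const, of "axis _ 1"] by (simp add: inner_axis)
next
  assume "\<forall>i. smooth_fn A W (\<lambda>q. F q $ i)"
  then have "smooth_fn A W (\<lambda>q. \<Sum>i\<in>UNIV. (F q $ i) *\<^sub>R axis i (1::real))"
    by (intro smooth_fn_sum smooth_fn_scaleR smooth_fn_const assms) auto
  then show "smooth_fn A W F"
    using basis_expansion[of "F _"] by (simp add: scalar_mult_eq_scaleR)
qed

lemma smooth_fn_continuous:
  assumes "smooth_fn A UNIV g"
  shows "continuous_on UNIV g"
proof -
  have "isCont g q" for q
  proof -
    obtain U \<phi> where c: "(U, \<phi>) \<in> A" "q \<in> U" by (rule chart_around)
    have "smooth_on (\<phi> ` U) (g \<circ> inv_into U \<phi>)"
      using assms c unfolding smooth_fn_def by fastforce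
    then have "continuous_on (\<phi> ` U) (g \<circ> inv_into U \<phi>)"
      by (rule smooth_on_continuous)
    then have "continuous_on U ((g \<circ> inv_into U \<phi>) \<circ> \<phi>)"
      using chart_homeomorphism[OF c(1)] by (intro continuous_on_compose[of U \<phi>]) (simp_all only: homeomorphism_def)
    then have "continuous_on U g"
      by (rule continuous_on_eq) (simp add: chart_inverse[OF c(1)])
    then show ?thesis
      using chart_open c by (metis continuous_on_eq_continuous_at)
  qed
  then show ?thesis by (simp add: continuous_at_imp_continuous_on)
qed

lemma smooth_nearI: "open W \<Longrightarrow> p \<in> W \<Longrightarrow> smooth_fn A W g \<Longrightarrow> smooth_near A p g"
  unfolding smooth_near_def by blast

lemma smooth_near_common:
  assumes "smooth_near A p g" "smooth_near A p k"
  obtains W where "open W" "p \<in> W" "smooth_fn A W g" "smooth_fn A W k"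
proof -
  obtain V W where "open V" "p \<in> V" "smooth_fn A V g" "open W" "p \<in> W" "smooth_fn A W k"
    using assms unfolding smooth_near_def by blast
  then show ?thesis
    using that[of "V \<inter> W"] smooth_fn_subset[of V g "V \<inter> W"] smooth_fn_subset[of W k "V \<inter> W"] by auto
qed

lemma smooth_near_const: "smooth_near A p (\<lambda>q. c)"
  using smooth_fn_const smooth_nearI open_UNIV by blast

lemma smooth_near_add: 
  "smooth_near A p g \<Longrightarrow> smooth_near A p k \<Longrightarrow> smooth_near A p (\<lambda>q. g q + k q)"
  by (rule smooth_near_common, assumption+) (rule smooth_nearI[OF _ _ smooth_fn_add])

lemma smooth_near_mult: 
  fixes g k :: "'a \<Rightarrow> real"
  shows "smooth_near A p g \<Longrightarrow> smooth_near A p k \<Longrightarrow> smooth_near A p (\<lambda>q. g q * k q)"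
  by (rule smooth_near_common, assumption+) (rule smooth_nearI[OF _ _ smooth_fn_mult])

lemma smooth_near_vec:
  fixes F :: "'a \<Rightarrow> real ^ 'm::finite"
  shows "smooth_near A p F \<Longrightarrow> smooth_near A p (\<lambda>q. F q $ i)"
  unfolding smooth_near_def using smooth_fn_vec_iff[of _ F] by blast

lemma smooth_near_cong:
  assumes "smooth_near A p g" "open V" "p \<in> V" "\<And>q. q \<in> V \<Longrightarrow> g q = k q"
  shows "smooth_near A p k"
proof -
  obtain W where "open W" "p \<in> W" "smooth_fn A W g"
    using assms(1) unfolding smooth_near_def by blast
  then have "smooth_fn A (W \<inter> V) k"
    using smooth_fn_cong[of "W \<inter> V" g k] smooth_fn_subset[of W g "W \<inter> V"] assms by auto
  then show ?thesis using \<open>open W\<close> \<open>p \<in> W\<close> assms smooth_nearI by (metis IntI open_Int)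
qed


section \<open>Tangent vectors and vector fields\<close>

lemma tangent_not_smooth: "v \<in> tangent_space A p \<Longrightarrow> \<not> smooth_near A p g \<Longrightarrow> v g = 0"
  unfolding tangent_space_def by blast

lemma tangent_add:
  "v \<in> tangent_space A p \<Longrightarrow> smooth_near A p g \<Longrightarrow> smooth_near A p k \<Longrightarrow>
    v (\<lambda>q. g q + k q) = v g + v k"
  unfolding tangent_space_def by blast

lemma tangent_mult:
  "v \<in> tangent_space A p \<Longrightarrow> smooth_near A p g \<Longrightarrow> smooth_near A p k \<Longrightarrow>
    v (\<lambda>q. g q * k q) = v g * k p + g p * v k"
  unfolding tangent_space_def by blast

lemma tangent_scale:
  "v \<in> tangent_space A p \<Longrightarrow> smooth_near A p g \<Longrightarrow> v (\<lambda>q. c * g q) = c * v g"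
  unfolding tangent_space_def by blast

lemma deriv_along_nth: "deriv_along v F $ i = v (\<lambda>q. F q $ i)"
  by (simp add: deriv_along_def)

lemma deriv_along_plus: "deriv_along (u + v) F = deriv_along u F + deriv_along v F"
  by (simp add: deriv_along_def vec_eq_iff)

lemma deriv_along_scale: "deriv_along (c *\<^sub>R v) F = c *\<^sub>R deriv_along v F"
  by (simp add: deriv_along_def vec_eq_iff scaleR_fun_def)

lemma linear_deriv_along: "linear (\<lambda>v. deriv_along v F)"
  by (intro linearI deriv_along_plus deriv_along_scale)

lemma subspace_tangent_space: "subspace (tangent_space A p)"
  unfolding subspace_def tangent_space_def by (auto simp: scaleR_fun_def algebra_simps)

lemma tangent_const:
  assumes "v \<in> tangent_space A p"
  shows "v (\<lambda>q. c) = 0"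
proof -
  have "v (\<lambda>q. 1) = 0"
    using tangent_mult[OF assms smooth_near_const smooth_near_const, of 1 1] by simp
  then show ?thesis
    using tangent_scale[OF assms smooth_near_const, of c 1] by simp
qed

text \<open>Multiplication by the indicator function of a neighbourhood of \<open>p\<close>, which is locally
  constant at \<open>p\<close>, replaces a function by one that vanishes far from \<open>p\<close> without changing its
  derivatives at \<open>p\<close>.\<close>

lemma tangent_local:
  assumes v: "v \<in> tangent_space A p" and V: "open V" "p \<in> V" and eq: "\<And>q. q \<in> V \<Longrightarrow> g q = k q"
  shows "v g = v k"
proof -
  have one: "smooth_near A p (indicat_real V)"
    by (rule smooth_near_cong[OF smooth_near_const V, of 1]) simp
  have "(\<lambda>q. indicat_real V q * indicat_real V q) = indicat_real V"
    by (auto simp: indicator_def)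
  then have "v (indicat_real V) = 0"
    using tangent_mult[OF v one one] V by simp
  then have cut: "v (\<lambda>q. g q * indicat_real V q) = v g" if "smooth_near A p g" for g
    using tangent_mult[OF v that one] V by simp
  have prod: "(\<lambda>q. g q * indicat_real V q) = (\<lambda>q. k q * indicat_real V q)"
    using eq by (auto simp: indicator_def)
  have "smooth_near A p g \<longleftrightarrow> smooth_near A p k"
    using smooth_near_cong[OF _ V] eq by metis
  then show ?thesis
    using cut[of g] cut[of k] prod tangent_not_smooth[OF v] by metis
qed

lemma tangent_sum:
  assumes "finite I" and v: "v \<in> tangent_space A p" and "\<And>i. i \<in> I \<Longrightarrow> smooth_near A p (g i)"
  shows "smooth_near A p (\<lambda>q. \<Sum>i\<in>I. g i q) \<and> v (\<lambda>q. \<Sum>i\<in>I. g i q) = (\<Sum>i\<in>I. v (g i))"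
  using assms(1,3)
proof (induction I rule: finite_induct)
  case empty
  then show ?case by (simp add: smooth_near_const tangent_const[OF v])
next
  case (insert i I)
  then show ?case by (simp add: smooth_near_add tangent_add[OF v])
qed

lemma tangent_inner:
  fixes F G :: "'a \<Rightarrow> real ^ 'm::finite"
  assumes v: "v \<in> tangent_space A p" and F: "smooth_near A p F" and G: "smooth_near A p G"
  shows "v (\<lambda>q. F q \<bullet> G q) = deriv_along v F \<bullet> G p + F p \<bullet> deriv_along v G"
proof -
  note [simp] = smooth_near_vec[OF F] smooth_near_vec[OF G]
  have "v (\<lambda>q. F q \<bullet> G q) = (\<Sum>i\<in>UNIV. v (\<lambda>q. F q $ i * G q $ i))"
    using tangent_sum[OF _ v, of UNIV "\<lambda>i q. F q $ i * G q $ i"] smooth_near_mult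
    by (simp add: inner_vec_def)
  also have "\<dots> = deriv_along v F \<bullet> G p + F p \<bullet> deriv_along v G"
    by (simp add: tangent_mult[OF v] inner_vec_def deriv_along_nth sum.distrib)
  finally show ?thesis .
qed

lemma deriv_along_const: "v \<in> tangent_space A p \<Longrightarrow> deriv_along v (\<lambda>q. c) = 0"
  by (simp add: vec_eq_iff deriv_along_nth tangent_const)

lemma tangent_inner_const:
  fixes F :: "'a \<Rightarrow> real ^ 'm::finite"
  assumes "v \<in> tangent_space A p" "smooth_near A p F"
  shows "v (\<lambda>q. F q \<bullet> w) = deriv_along v F \<bullet> w"
  using tangent_inner[OF assms smooth_near_const] by (simp add: deriv_along_const[OF assms(1)])

lemma deriv_along_add:
  fixes F G :: "'a \<Rightarrow> real ^ 'm::finite"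
  assumes "v \<in> tangent_space A p" "smooth_near A p F" "smooth_near A p G"
  shows "deriv_along v (\<lambda>q. F q + G q) = deriv_along v F + deriv_along v G"
  using assms by (simp add: vec_eq_iff deriv_along_nth tangent_add[OF assms(1)] smooth_near_vec)

lemma deriv_along_scaleR:
  fixes F :: "'a \<Rightarrow> real ^ 'm::finite"
  assumes "v \<in> tangent_space A p" "smooth_near A p g" "smooth_near A p F"
  shows "deriv_along v (\<lambda>q. g q *\<^sub>R F q) = v g *\<^sub>R F p + g p *\<^sub>R deriv_along v F"
  using assms by (simp add: vec_eq_iff deriv_along_nth tangent_mult[OF assms(1)] smooth_near_vec)

lemma deriv_along_minus:
  fixes F :: "'a \<Rightarrow> real ^ 'm::finite"
  assumes "v \<in> tangent_space A p" "smooth_near A p F"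
  shows "deriv_along v (\<lambda>q. - F q) = - deriv_along v F"
  using deriv_along_scaleR[OF assms(1) smooth_near_const assms(2), of "-1"]
  by (simp add: tangent_const[OF assms(1)])

lemma deriv_along_local:
  assumes "v \<in> tangent_space A p" "open V" "p \<in> V" "\<And>q. q \<in> V \<Longrightarrow> F q = G q"
  shows "deriv_along v F = deriv_along v G"
  unfolding deriv_along_def using tangent_local[OF assms(1-3)] assms(4)
  by (metis (no_types, lifting))

lemma vector_field_tangent:
  "X \<in> sections (tangent_bundle A) W \<Longrightarrow> p \<in> W \<Longrightarrow> X p \<in> tangent_space A p"
  unfolding tangent_bundle_def by auto

lemma vector_field_subset:
  "X \<in> sections (tangent_bundle A) W \<Longrightarrow> V \<subseteq> W \<Longrightarrow> X \<in> sections (tangent_bundle A) V"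
  unfolding tangent_bundle_def by auto

lemma vector_field_smooth:
  "X \<in> sections (tangent_bundle A) W \<Longrightarrow> open W \<Longrightarrow> smooth_fn A W g \<Longrightarrow>
    smooth_fn A W (\<lambda>q. X q g)"
  unfolding tangent_bundle_def by auto

lemma deriv_along_smooth:
  fixes F :: "'a \<Rightarrow> real ^ 'm::finite"
  assumes "X \<in> sections (tangent_bundle A) W" "open W" "smooth_fn A W F"
  shows "smooth_fn A W (\<lambda>q. deriv_along (X q) F)"
  using assms vector_field_smooth[OF assms(1,2)]
  by (simp add: smooth_fn_vec_iff[OF assms(2)] deriv_along_nth)

lemma vector_field_smooth_near:
  assumes X: "X \<in> sections (tangent_bundle A) W" "open W" "p \<in> W" and g: "smooth_near A p g"
  shows "smooth_near A p (\<lambda>q. X q g)"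
proof -
  obtain V where V: "open V" "p \<in> V" "smooth_fn A V g"
    using g unfolding smooth_near_def by blast
  have "smooth_fn A (W \<inter> V) (\<lambda>q. X q g)"
    by (rule vector_field_smooth[OF vector_field_subset[OF X(1)]])
       (use V X smooth_fn_subset[OF V(3)] in auto)
  then show ?thesis using V X by (intro smooth_nearI[of "W \<inter> V"]) auto
qed

lemma lie_bracket_tangent:
  assumes X: "X \<in> sections (tangent_bundle A) W" and Y: "Y \<in> sections (tangent_bundle A) W"
    and W: "open W" "p \<in> W"
  shows "lie_bracket A X Y p \<in> tangent_space A p"
proof -
  note XS = vector_field_smooth_near[OF X W] and YS = vector_field_smooth_near[OF Y W]
  note XT = vector_field_tangent[OF X] and YT = vector_field_tangent[OF Y]
  \<comment> \<open>The value of a vector field on a sum or product is known only where both functions are smooth; as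
    this holds near \<open>p\<close>, the resulting identity may be differentiated at \<open>p\<close>.\<close>
  have loc: "v (\<lambda>q. Z q (\<lambda>x. F x)) = v G"
    if v: "v \<in> tangent_space A p" and eq: "\<And>q. q \<in> W \<Longrightarrow> smooth_near A q g \<Longrightarrow> smooth_near A q k \<Longrightarrow> Z q F = G q"
      and gk: "smooth_near A p g" "smooth_near A p k"
    for v Z F G g k
  proof -
    obtain V where V: "open V" "p \<in> V" "smooth_fn A V g" "smooth_fn A V k"
      using smooth_near_common[OF gk] .
    then have "smooth_near A q g" "smooth_near A q k" if "q \<in> V" for q
      using that by (auto intro: smooth_nearI)
    then show ?thesis
      by (intro tangent_local[OF v, of "W \<inter> V"]) (use V W eq in auto)
  qed
  show ?thesis
    unfolding tangent_space_def mem_Collect_eq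
  proof (intro conjI allI impI)
    fix g :: "'a \<Rightarrow> real" assume "\<not> smooth_near A p g"
    then show "lie_bracket A X Y p g = 0" by (simp add: lie_bracket_def)
  next
    fix g k :: "'a \<Rightarrow> real" assume g: "smooth_near A p g" and k: "smooth_near A p k"
    have 1: "X p (\<lambda>q. Y q (\<lambda>x. g x + k x)) = X p (\<lambda>q. Y q g) + X p (\<lambda>q. Y q k)"
      using loc[OF XT[OF W(2)], of g k Y "\<lambda>x. g x + k x" "\<lambda>q. Y q g + Y q k"] g k
      by (simp add: tangent_add[OF YT] tangent_add[OF XT[OF W(2)]] YS)
    have 2: "Y p (\<lambda>q. X q (\<lambda>x. g x + k x)) = Y p (\<lambda>q. X q g) + Y p (\<lambda>q. X q k)"
      using loc[OF YT[OF W(2)], of g k X "\<lambda>x. g x + k x" "\<lambda>q. X q g + X q k"] g k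
      by (simp add: tangent_add[OF XT] tangent_add[OF YT[OF W(2)]] XS)
    show "lie_bracket A X Y p (\<lambda>q. g q + k q) = lie_bracket A X Y p g + lie_bracket A X Y p k"
      using g k 1 2 by (simp add: lie_bracket_def smooth_near_add)
    have 3: "X p (\<lambda>q. Y q (\<lambda>x. g x * k x))
        = X p (\<lambda>q. Y q g) * k p + Y p g * X p k + (X p g * Y p k + g p * X p (\<lambda>q. Y q k))"
      using loc[OF XT[OF W(2)], of g k Y "\<lambda>x. g x * k x" "\<lambda>q. Y q g * k q + g q * Y q k"] g k
      by (simp add: tangent_mult[OF YT] tangent_mult[OF XT[OF W(2)]] YS smooth_near_mult
          tangent_add[OF XT[OF W(2)]])
    have 4: "Y p (\<lambda>q. X q (\<lambda>x. g x * k x))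
        = Y p (\<lambda>q. X q g) * k p + X p g * Y p k + (Y p g * X p k + g p * Y p (\<lambda>q. X q k))"
      using loc[OF YT[OF W(2)], of g k X "\<lambda>x. g x * k x" "\<lambda>q. X q g * k q + g q * X q k"] g k
      by (simp add: tangent_mult[OF XT] tangent_mult[OF YT[OF W(2)]] XS smooth_near_mult
          tangent_add[OF YT[OF W(2)]])
    show "lie_bracket A X Y p (\<lambda>q. g q * k q)
        = lie_bracket A X Y p g * k p + g p * lie_bracket A X Y p k"
      using g k 3 4 by (simp add: lie_bracket_def smooth_near_mult algebra_simps)
  next
    fix c and g :: "'a \<Rightarrow> real" assume g: "smooth_near A p g"
    have 1: "X p (\<lambda>q. Y q (\<lambda>x. c * g x)) = c * X p (\<lambda>q. Y q g)"
      using loc[OF XT[OF W(2)], of g g Y "\<lambda>x. c * g x" "\<lambda>q. c * Y q g"] g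
      by (simp add: tangent_scale[OF YT] tangent_scale[OF XT[OF W(2)]] YS)
    have 2: "Y p (\<lambda>q. X q (\<lambda>x. c * g x)) = c * Y p (\<lambda>q. X q g)"
      using loc[OF YT[OF W(2)], of g g X "\<lambda>x. c * g x" "\<lambda>q. c * X q g"] g
      by (simp add: tangent_scale[OF XT] tangent_scale[OF YT[OF W(2)]] XS)
    show "lie_bracket A X Y p (\<lambda>q. c * g q) = c * lie_bracket A X Y p g"
      using g 1 2 smooth_near_mult[OF smooth_near_const g]
      by (simp add: lie_bracket_def algebra_simps)
  qed
qed

lemma deriv_along_lie_bracket:
  fixes F :: "'a \<Rightarrow> real ^ 'm::finite"
  assumes "smooth_near A p F"
  shows "deriv_along (lie_bracket A X Y p) F =
    deriv_along (X p) (\<lambda>q. deriv_along (Y q) F) - deriv_along (Y p) (\<lambda>q. deriv_along (X q) F)"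
  using smooth_near_vec[OF assms] by (simp add: vec_eq_iff deriv_along_nth lie_bracket_def)

text \<open>The value \<open>0\<close> on functions that are not smooth near \<open>q\<close> follows the convention for tangent vectors.\<close>

definition chart_vector :: "'a set \<Rightarrow> ('a \<Rightarrow> real ^ 'n) \<Rightarrow> 'a \<Rightarrow> real ^ 'n \<Rightarrow> 'a tvec" where
  "chart_vector U \<phi> q c g =
     (if smooth_near A q g then frechet_derivative (g \<circ> inv_into U \<phi>) (at (\<phi> q)) c else 0)"

lemma smooth_near_chart_derivative:
  fixes g :: "'a \<Rightarrow> 'b::real_normed_vector"
  assumes c: "(U, \<phi>) \<in> A" "q \<in> U" and g: "smooth_near A q g"
  shows "((g \<circ> inv_into U \<phi>) has_derivative frechet_derivative (g \<circ> inv_into U \<phi>) (at (\<phi> q))) (at (\<phi> q))"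
proof -
  obtain W where "open W" "q \<in> W" "smooth_fn A W g" using g unfolding smooth_near_def by blast
  then have "smooth_on (\<phi> ` (U \<inter> W)) (g \<circ> inv_into U \<phi>)" "\<phi> q \<in> \<phi> ` (U \<inter> W)"
    using c unfolding smooth_fn_def by auto
  then show ?thesis
    using smooth_on_differentiable frechet_derivative_works by blast
qed

lemma chart_vector_eqI:
  assumes c: "(U, \<phi>) \<in> A" "q \<in> U" and g: "smooth_near A q g"
    and d: "((g \<circ> inv_into U \<phi>) has_derivative D) (at (\<phi> q))"
  shows "chart_vector U \<phi> q w g = D w"
  using frechet_derivative_at[OF d] g by (simp add: chart_vector_def)

lemma chart_vector_tangent:
  assumes c: "(U, \<phi>) \<in> A" "q \<in> U"
  shows "chart_vector U \<phi> q w \<in> tangent_space A q"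
  unfolding tangent_space_def mem_Collect_eq
proof (intro conjI allI impI)
  fix g :: "'a \<Rightarrow> real" assume "\<not> smooth_near A q g"
  then show "chart_vector U \<phi> q w g = 0" by (simp add: chart_vector_def)
next
  fix g k :: "'a \<Rightarrow> real" assume g: "smooth_near A q g" and k: "smooth_near A q k"
  note dg = smooth_near_chart_derivative[OF c g, unfolded comp_def]
    and dk = smooth_near_chart_derivative[OF c k, unfolded comp_def]
  show "chart_vector U \<phi> q w (\<lambda>x. g x + k x) = chart_vector U \<phi> q w g + chart_vector U \<phi> q w k"
    by (subst chart_vector_eqI[OF c smooth_near_add[OF g k], unfolded comp_def,
          OF has_derivative_add[OF dg dk]])
       (use g k in \<open>simp add: chart_vector_def comp_def\<close>)
  show "chart_vector U \<phi> q w (\<lambda>x. g x * k x)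
      = chart_vector U \<phi> q w g * k q + g q * chart_vector U \<phi> q w k"
    by (subst chart_vector_eqI[OF c smooth_near_mult[OF g k], unfolded comp_def,
          OF has_derivative_mult[OF dg dk]])
       (use g k in \<open>simp add: chart_vector_def comp_def chart_inverse[OF c]\<close>)
next
  fix a and g :: "'a \<Rightarrow> real" assume g: "smooth_near A q g"
  note dg = smooth_near_chart_derivative[OF c g, unfolded comp_def]
  show "chart_vector U \<phi> q w (\<lambda>x. a * g x) = a * chart_vector U \<phi> q w g"
    by (subst chart_vector_eqI[OF c smooth_near_mult[OF smooth_near_const g], unfolded comp_def,
          OF has_derivative_mult_right[OF dg]])
       (use g in \<open>simp add: chart_vector_def comp_def\<close>)
qed

lemma chart_coordinate_smooth:
  assumes "(U, \<phi>) \<in> A"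
  shows "smooth_fn A U \<phi>"
  using atlas assms unfolding smooth_fn_def smooth_atlas_def by (fast)

lemma chart_vector_coordinate:
  assumes c: "(U, \<phi>) \<in> A" "q \<in> U"
  shows "chart_vector U \<phi> q w (\<lambda>x. \<phi> x $ j) = w $ j"
proof (rule chart_vector_eqI[OF c])
  show "smooth_near A q (\<lambda>x. \<phi> x $ j)"
    using smooth_near_vec[OF smooth_nearI[OF chart_open[OF c(1)] c(2) chart_coordinate_smooth[OF c(1)]]] .
  have "open (\<phi> ` U)"
    using chart_image_open[OF c(1) open_UNIV] by simp
  moreover have "((\<lambda>x. x $ j) has_derivative (\<lambda>w. w $ j)) (at (\<phi> q))"
    by (intro bounded_linear_imp_has_derivative bounded_linear_vec_nth)
  ultimately show "((\<lambda>x. \<phi> x $ j) \<circ> inv_into U \<phi> has_derivative (\<lambda>w. w $ j)) (at (\<phi> q))"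
    using c by (elim has_derivative_transform_within_open) (auto simp: f_inv_into_f)
qed

lemma deriv_along_chart_vector:
  fixes F :: "'a \<Rightarrow> real ^ 'm::finite"
  assumes c: "(U, \<phi>) \<in> A" "q \<in> U" and F: "smooth_near A q F"
  shows "deriv_along (chart_vector U \<phi> q w) F = frechet_derivative (F \<circ> inv_into U \<phi>) (at (\<phi> q)) w"
proof -
  have "chart_vector U \<phi> q w (\<lambda>x. F x $ i) = frechet_derivative (F \<circ> inv_into U \<phi>) (at (\<phi> q)) w $ i" for i
  proof (rule chart_vector_eqI[OF c smooth_near_vec[OF F]])
    show "((\<lambda>x. F x $ i) \<circ> inv_into U \<phi> has_derivative
        (\<lambda>w. frechet_derivative (F \<circ> inv_into U \<phi>) (at (\<phi> q)) w $ i)) (at (\<phi> q))"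
      using bounded_linear.has_derivative[OF bounded_linear_vec_nth smooth_near_chart_derivative[OF c F]]
      by (simp add: comp_def)
  qed
  then show ?thesis by (simp add: vec_eq_iff deriv_along_nth)
qed

text \<open>Hadamard's lemma writes \<open>g - g(p)\<close> as a combination of products of two smooth functions, of
  which the first is a coordinate function vanishing at \<open>p\<close>; so a derivation at \<open>p\<close> sees only the
  first derivatives of \<open>g\<close>.\<close>

lemma tangent_apply_chart:
  assumes c: "(U, \<phi>) \<in> A" "p \<in> U" and v: "v \<in> tangent_space A p" and g: "smooth_near A p g"
  shows "v g = frechet_derivative (g \<circ> inv_into U \<phi>) (at (\<phi> p)) (deriv_along v \<phi>)"
proof -
  let ?g = "g \<circ> inv_into U \<phi>"
  have \<phi>: "smooth_fn A U \<phi>" "open U"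
    using chart_coordinate_smooth[OF c(1)] chart_open[OF c(1)] .
  have \<phi>p: "smooth_near A p \<phi>"
    using smooth_nearI[OF \<phi>(2) c(2) \<phi>(1)] .
  obtain W where W: "open W" "p \<in> W" "smooth_fn A W g" using g unfolding smooth_near_def by blast
  have sm: "smooth_on (\<phi> ` (U \<inter> W)) ?g" using W(3) c(1) unfolding smooth_fn_def by blast
  have "open (\<phi> ` (U \<inter> W))" "\<phi> p \<in> \<phi> ` (U \<inter> W)"
    using chart_image_open[OF c(1) W(1)] c(2) W(2) by auto
  then obtain e where e: "e > 0" "ball (\<phi> p) e \<subseteq> \<phi> ` (U \<inter> W)"
    by (meson open_contains_ball)
  define B where "B = ball (\<phi> p) e"
  have B: "open B" "convex B" "\<phi> p \<in> B" using e by (auto simp: B_def)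
  have gB: "smooth_on B ?g"
    using sm e(2) Ck_on_subset unfolding smooth_on_def B_def by blast
  obtain G where G: "\<And>b. smooth_on B (G b)" "\<And>b. G b (\<phi> p) = frechet_derivative ?g (at (\<phi> p)) b"
    "\<And>x. x \<in> B \<Longrightarrow> ?g x = ?g (\<phi> p) + (\<Sum>b\<in>Basis. ((x - \<phi> p) \<bullet> b) * G b x)"
    using hadamard[OF B gB] by blast
  define V where "V = U \<inter> \<phi> -` B"
  have "continuous_on U \<phi>"
    using chart_homeomorphism[OF c(1)] by (simp add: homeomorphism_def)
  then have V: "open V" "p \<in> V" "V \<subseteq> U"
    using continuous_open_preimage[OF _ \<phi>(2) B(1)] c B by (auto simp: V_def)
  have Gs: "smooth_near A p (\<lambda>q. G b (\<phi> q))" for b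
  proof (rule smooth_nearI[OF V(1,2)])
    show "smooth_fn A V (\<lambda>q. G b (\<phi> q))"
      unfolding smooth_fn_def
    proof clarify
      fix U' \<psi> assume c': "(U', \<psi>) \<in> A"
      have "smooth_on (\<psi> ` (U' \<inter> V)) (\<lambda>x. G b ((\<phi> \<circ> inv_into U' \<psi>) x))"
      proof (rule smooth_on_compose[OF _ _ _ G(1)])
        show "open (\<psi> ` (U' \<inter> V))" by (rule chart_image_open[OF c' V(1)])
        show "(\<phi> \<circ> inv_into U' \<psi>) ` \<psi> ` (U' \<inter> V) \<subseteq> B"
          using chart_inverse[OF c'] by (auto simp: V_def)
        show "smooth_on (\<psi> ` (U' \<inter> V)) (\<phi> \<circ> inv_into U' \<psi>)"
          using smooth_fn_subset[OF \<phi>(1) V(3)] c' unfolding smooth_fn_def by blast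
      qed
      then show "smooth_on (\<psi> ` (U' \<inter> V)) ((\<lambda>q. G b (\<phi> q)) \<circ> inv_into U' \<psi>)"
        by (simp add: comp_def)
    qed
  qed
  have coord: "smooth_near A p (\<lambda>q. (\<phi> q - \<phi> p) \<bullet> b)" "v (\<lambda>q. (\<phi> q - \<phi> p) \<bullet> b) = deriv_along v \<phi> \<bullet> b" for b
  proof -
    have s: "smooth_near A p (\<lambda>q. \<phi> q + - \<phi> p)"
      by (rule smooth_near_add[OF \<phi>p smooth_near_const])
    then show "v (\<lambda>q. (\<phi> q - \<phi> p) \<bullet> b) = deriv_along v \<phi> \<bullet> b"
      using tangent_inner_const[OF v s, of b] deriv_along_add[OF v \<phi>p smooth_near_const, of "- \<phi> p"]
      by (simp add: deriv_along_const[OF v])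
    obtain W where W: "open W" "p \<in> W" "smooth_fn A W (\<lambda>q. \<phi> q + - \<phi> p)"
      using s unfolding smooth_near_def by blast
    show "smooth_near A p (\<lambda>q. (\<phi> q - \<phi> p) \<bullet> b)"
      using smooth_nearI[OF W(1,2) smooth_fn_inner[OF W(1,3) smooth_fn_const[of _ b]]] by simp
  qed
  have lin: "linear (frechet_derivative ?g (at (\<phi> p)))"
    using smooth_on_differentiable[OF gB B(3)] by (rule linear_frechet_derivative)
  have terms: "smooth_near A p (\<lambda>q. ((\<phi> q - \<phi> p) \<bullet> b) * G b (\<phi> q))"
    "v (\<lambda>q. ((\<phi> q - \<phi> p) \<bullet> b) * G b (\<phi> q)) = (deriv_along v \<phi> \<bullet> b) * G b (\<phi> p)" for b
    using smooth_near_mult[OF coord(1) Gs] tangent_mult[OF v coord(1) Gs, of b b] by (simp_all add: coord(2))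
  have "v g = v (\<lambda>q. g p + (\<Sum>b\<in>Basis. ((\<phi> q - \<phi> p) \<bullet> b) * G b (\<phi> q)))"
  proof (rule tangent_local[OF v V(1,2)])
    fix q assume q: "q \<in> V"
    then have "\<phi> q \<in> B" "q \<in> U" by (auto simp: V_def)
    then show "g q = g p + (\<Sum>b\<in>Basis. ((\<phi> q - \<phi> p) \<bullet> b) * G b (\<phi> q))"
      using G(3)[of "\<phi> q"] chart_inverse[OF c(1)] c(2) by simp
  qed
  also have "\<dots> = (\<Sum>b\<in>Basis. (deriv_along v \<phi> \<bullet> b) * frechet_derivative ?g (at (\<phi> p)) b)"
  proof -
    have "smooth_near A p (\<lambda>q. \<Sum>b\<in>Basis. ((\<phi> q - \<phi> p) \<bullet> b) * G b (\<phi> q)) \<and>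
      v (\<lambda>q. \<Sum>b\<in>Basis. ((\<phi> q - \<phi> p) \<bullet> b) * G b (\<phi> q))
        = (\<Sum>b\<in>Basis. v (\<lambda>q. ((\<phi> q - \<phi> p) \<bullet> b) * G b (\<phi> q)))"
      by (rule tangent_sum[OF finite_Basis v]) (rule terms(1))
    then show ?thesis
      by (simp add: tangent_add[OF v smooth_near_const] tangent_const[OF v] terms(2) G(2))
  qed
  also have "\<dots> = frechet_derivative ?g (at (\<phi> p)) (deriv_along v \<phi>)"
    using linear_Basis_expansion[OF lin, of "deriv_along v \<phi>"] by simp
  finally show ?thesis .
qed

text \<open>In particular the image of the tangent space has dimension at most \<open>n\<close>.\<close>

lemma image_tangent_chart:
  fixes F :: "'a \<Rightarrow> real ^ 'm::finite"
  assumes c: "(U, \<phi>) \<in> A" "p \<in> U" and F: "smooth_near A p F"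
  shows "image_tangent A F p = range (frechet_derivative (F \<circ> inv_into U \<phi>) (at (\<phi> p)))"
proof
  have "deriv_along v F = frechet_derivative (F \<circ> inv_into U \<phi>) (at (\<phi> p)) (deriv_along v \<phi>)"
    if v: "v \<in> tangent_space A p" for v
  proof -
    have "v (\<lambda>q. F q $ i) = deriv_along (chart_vector U \<phi> p (deriv_along v \<phi>)) F $ i" for i
      using tangent_apply_chart[OF c v smooth_near_vec[OF F]] smooth_near_vec[OF F]
      by (simp add: deriv_along_nth chart_vector_def)
    then show ?thesis
      unfolding deriv_along_chart_vector[OF c F, symmetric] by (simp add: vec_eq_iff deriv_along_nth)
  qed
  then show "image_tangent A F p \<subseteq> range (frechet_derivative (F \<circ> inv_into U \<phi>) (at (\<phi> p)))"
    unfolding image_tangent_def by blast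
  show "range (frechet_derivative (F \<circ> inv_into U \<phi>) (at (\<phi> p))) \<subseteq> image_tangent A F p"
    unfolding image_tangent_def deriv_along_chart_vector[OF c F, symmetric]
    using chart_vector_tangent[OF c] by blast
qed

end


section \<open>Dual spaces, traces and connections\<close>

lemma subspace_dual_space:
  assumes "subspace V"
  shows "subspace (dual_space V)"
  using assms unfolding dual_space_def lin_on_def subspace_def
  by (auto simp: scaleR_fun_def algebra_simps)

lemma dual_space_eqI:
  assumes "\<zeta> \<in> dual_space V" "\<eta> \<in> dual_space V" "\<And>w. w \<in> V \<Longrightarrow> \<zeta> w = \<eta> w"
  shows "\<zeta> = \<eta>"
proof
  fix w
  show "\<zeta> w = \<eta> w" using assms by (cases "w \<in> V") (auto simp: dual_space_def)
qed

text \<open>The trace of the rank-one map \<open>\<zeta> \<mapsto> \<zeta>(x) \<alpha>\<close> is \<open>\<alpha>(x)\<close>: expand \<open>\<alpha>\<close> in the chosen basis and evaluate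
  at \<open>x\<close>. The finite spanning set \<open>F\<close> guarantees that this basis is finite.\<close>

lemma subspace_trace_evaluation:
  fixes V :: "('b \<Rightarrow> real) set"
  assumes F: "finite F" "span F = V" and mem: "\<alpha> \<in> V" "\<beta> \<in> V"
    and T: "\<And>\<zeta>. \<zeta> \<in> V \<Longrightarrow> T \<zeta> = \<zeta> x *\<^sub>R \<alpha> - \<zeta> y *\<^sub>R \<beta>"
  shows "subspace_trace V T = \<alpha> x - \<beta> y"
proof -
  define B where "B = (SOME B. independent B \<and> span B = V)"
  have "\<exists>B. independent B \<and> span B = V"
    using F(2) by (metis basis_exists span_span span_eq span_superset subset_trans span_mono)
  then have B: "independent B" "span B = V" unfolding B_def by (metis (mono_tags, lifting) someI_ex)+
  have fin: "finite B"
    using independent_span_bound[OF F(1) B(1)] B(2) F(2) span_superset[of B] by blast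
  have eval: "(\<Sum>b\<in>B. b x * representation B \<gamma> b) = \<gamma> x" if "\<gamma> \<in> V" for \<gamma> x
  proof -
    have sum_apply: "(\<Sum>b\<in>B. h b) x = (\<Sum>b\<in>B. h b x)" for h :: "('b \<Rightarrow> real) \<Rightarrow> 'b \<Rightarrow> real"
      using fin by (induction B rule: finite_induct) auto
    have "\<gamma> = (\<Sum>b\<in>B. representation B \<gamma> b *\<^sub>R b)"
      using real_vector.sum_representation_eq[OF B(1) _ fin subset_refl] that B(2) by simp
    from arg_cong[OF this, of "\<lambda>h. h x"] show ?thesis
      by (simp add: sum_apply scaleR_fun_def mult.commute)
  qed
  have "representation B (T b) b = b x * representation B \<alpha> b - b y * representation B \<beta> b" if "b \<in> B" for b
  proof -
    have "b \<in> V" using that B(2) span_base by blast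
    moreover have "\<alpha> \<in> span B" "\<beta> \<in> span B"
      using B mem by simp_all
    ultimately show ?thesis
      by (simp add: T B(1) real_vector.representation_diff real_vector.representation_scale span_scale)
  qed
  then have "subspace_trace V T = (\<Sum>b\<in>B. b x * representation B \<alpha> b) - (\<Sum>b\<in>B. b y * representation B \<beta> b)"
    unfolding subspace_trace_def Let_def B_def[symmetric] by (simp add: sum_subtractf)
  then show ?thesis using eval mem by simp
qed

lemma connection_section:
  assumes "connection A U E D" "open W" "W \<subseteq> U" "X \<in> sections (tangent_bundle A) W" "s \<in> sections E W"
  shows "(\<lambda>p. D p (X p) s) \<in> sections E W"
  using assms(1)[unfolded connection_def, THEN spec, THEN mp, OF assms(2), THEN mp, OF assms(3), THEN conjunct2]
    assms(4,5) by simp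


section \<open>The conormal map\<close>

locale equiaffine_setting = smooth_manifold A
  for A :: "('a::t2_space, 'n::finite) atlas" +
  fixes f \<xi> :: "'a \<Rightarrow> real ^ 'm::finite"
  assumes card: "CARD('m) = CARD('n) + 1"
    and equiaffine: "equiaffine_immersion A f \<xi>"
begin

lemma f_smooth: "smooth_fn A UNIV f" and \<xi>_smooth: "smooth_fn A UNIV \<xi>"
  and f_immersion: "inj_on (\<lambda>v. deriv_along v f) (tangent_space A p)"
  and transversal_decomposition: "{w + z |w z. w \<in> image_tangent A f p \<and> z \<in> span {\<xi> p}} = UNIV"
  and transversal_disjoint: "image_tangent A f p \<inter> span {\<xi> p} = {0}"
  and transversal_form_zero: "v \<in> tangent_space A p \<Longrightarrow> transversal_form A f \<xi> p v = 0"
  using equiaffine unfolding equiaffine_immersion_def affine_immersion_def immersion_def by auto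

lemma smooth_near_f: "smooth_near A p f" and smooth_near_\<xi>: "smooth_near A p \<xi>"
  using f_smooth \<xi>_smooth smooth_nearI[OF open_UNIV] by auto

lemma subspace_image_tangent: "subspace (image_tangent A f p)"
  unfolding image_tangent_def by (rule linear_subspace_image[OF linear_deriv_along subspace_tangent_space])

lemma decompose:
  obtains t c where "t \<in> image_tangent A f p" "w = t + c *\<^sub>R \<xi> p"
proof -
  have "w \<in> {w + z |w z. w \<in> image_tangent A f p \<and> z \<in> span {\<xi> p}}"
    using transversal_decomposition by blast
  then show ?thesis using that by (auto simp: span_singleton)
qed

text \<open>If \<open>\<xi>\<close> were tangent at \<open>p\<close>, it would lie in both summands of the direct sum and vanish, so that
  the image of the tangent space would be everything, of dimension \<open>n + 1\<close>. But in a chart this image is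
  the range of a linear map defined on an \<open>n\<close>-dimensional space.\<close>

lemma \<xi>_not_tangent: "\<xi> p \<notin> image_tangent A f p"
proof
  assume "\<xi> p \<in> image_tangent A f p"
  then have "\<xi> p = 0"
    using transversal_disjoint[of p] span_base[of "\<xi> p" "{\<xi> p}"] by blast
  then have "w \<in> image_tangent A f p" for w
    using decompose[of p w] by (metis add.right_neutral scaleR_zero_right)
  then have "image_tangent A f p = UNIV" by blast
  moreover obtain U \<phi> where "(U, \<phi>) \<in> A" "p \<in> U" by (rule chart_around)
  ultimately have r: "range (frechet_derivative (f \<circ> inv_into U \<phi>) (at (\<phi> p))) = UNIV"
    and "linear (frechet_derivative (f \<circ> inv_into U \<phi>) (at (\<phi> p)))"
    using image_tangent_chart[OF _ _ smooth_near_f]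
      smooth_near_chart_derivative[OF _ _ smooth_near_f] has_derivative_linear by metis+
  from dim_image_le[OF this(2), of UNIV] show False
    using card r by simp
qed

lemma chart_derivative_inj:
  assumes c: "(U, \<phi>) \<in> A" "q \<in> U"
    and 0: "frechet_derivative (f \<circ> inv_into U \<phi>) (at (\<phi> q)) w = 0"
  shows "w = 0"
proof -
  have "deriv_along (chart_vector U \<phi> q w) f = deriv_along 0 f"
    using 0 by (simp add: deriv_along_chart_vector[OF c smooth_near_f] vec_eq_iff deriv_along_nth)
  then have "chart_vector U \<phi> q w = 0"
    using f_immersion[of q] chart_vector_tangent[OF c] subspace_0[OF subspace_tangent_space]
    by (metis inj_on_def)
  then show ?thesis
    using chart_vector_coordinate[OF c, of w] by (simp add: vec_eq_iff)
qed

text \<open>In a chart the vectors \<open>\<partial>\<^sub>1 f, \<dots>, \<partial>\<^sub>n f, \<xi>\<close> form a frame, so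
  \<open>w \<mapsto> det (\<partial>\<^sub>1 f, \<dots>, \<partial>\<^sub>n f, w) / det (\<partial>\<^sub>1 f, \<dots>, \<partial>\<^sub>n f, \<xi>)\<close> is the conormal. This gives at the same time
  existence and smooth dependence on the point.\<close>

lemma conormal_chart_formula:
  obtains k0 and e :: "'m \<Rightarrow> real ^ 'n" where
    "\<And>U \<phi> q. (U, \<phi>) \<in> A \<Longrightarrow> q \<in> U \<Longrightarrow>
       det (\<chi> i. if i = k0 then \<xi> q else frechet_derivative (f \<circ> inv_into U \<phi>) (at (\<phi> q)) (e i)) \<noteq> 0"
    "\<And>U \<phi> q w. (U, \<phi>) \<in> A \<Longrightarrow> q \<in> U \<Longrightarrow> conormal A f \<xi> q w =
       det (\<chi> i. if i = k0 then w else frechet_derivative (f \<circ> inv_into U \<phi>) (at (\<phi> q)) (e i)) *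
       inverse (det (\<chi> i. if i = k0 then \<xi> q else frechet_derivative (f \<circ> inv_into U \<phi>) (at (\<phi> q)) (e i)))"
    "\<And>q. linear (conormal A f \<xi> q)"
    "\<And>q w. w \<in> image_tangent A f q \<Longrightarrow> conormal A f \<xi> q w = 0"
    "\<And>q. conormal A f \<xi> q (\<xi> q) = 1"
proof -
  fix k0 :: 'm
  have "card (UNIV - {k0}) = card (UNIV :: 'n set)"
    using card by simp
  then obtain j :: "'n \<Rightarrow> 'm" where j: "bij_betw j UNIV (UNIV - {k0})"
    by (metis finite_same_card_bij finite)
  \<comment> \<open>The row \<open>k0\<close> is kept free for the argument; \<open>j\<close> numbers the other rows by the coordinate directions.\<close>
  define e :: "'m \<Rightarrow> real ^ 'n" where "e i = axis (inv j i) 1" for i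
  have inj: "inj j" using j by (simp add: bij_betw_def)
  have ej: "e (j a) = axis a 1" and jk: "j a \<noteq> k0" for a
    using inj bij_betwE[OF j] by (auto simp: e_def)
  have *: "det (\<chi> i. if i = k0 then \<xi> q else L (e i)) \<noteq> 0 \<and>
      linear (\<lambda>w. det (\<chi> i. if i = k0 then w else L (e i))) \<and>
      (\<forall>w\<in>image_tangent A f q. det (\<chi> i. if i = k0 then w else L (e i)) = 0)"
    if c: "(U, \<phi>) \<in> A" "q \<in> U" and L: "L = frechet_derivative (f \<circ> inv_into U \<phi>) (at (\<phi> q))"
    for U \<phi> q L
  proof (intro conjI)
    have lin: "linear L"
      unfolding L using smooth_near_chart_derivative[OF c smooth_near_f] has_derivative_linear by blast
    have expand: "L x = (\<Sum>a\<in>UNIV. (x $ a) *\<^sub>R L (axis a 1))" for x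
    proof -
      have "L x = L (\<Sum>a\<in>UNIV. (x $ a) *\<^sub>R axis a 1)"
        using basis_expansion[of x] by (simp add: scalar_mult_eq_scaleR)
      then show ?thesis by (simp add: linear_sum[OF lin] linear_scale[OF lin])
    qed
    let ?M = "\<lambda>w. (\<chi> i. if i = k0 then w else L (e i)) :: real ^ 'm ^ 'm"
    \<comment> \<open>The determinant is linear in its free row and vanishes on each of the other rows.\<close>
    show linM: "linear (\<lambda>w. det (?M w))"
      using det_row_add[of k0 "\<lambda>_. _" "\<lambda>_. _"] det_row_mul[of k0 _ "\<lambda>_. _ :: real ^ 'm"]
      unfolding scalar_mult_eq_scaleR
      by (intro linearI) simp_all
    show "\<forall>w\<in>image_tangent A f q. det (?M w) = 0"
    proof
      fix w assume "w \<in> image_tangent A f q"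
      then obtain x where "w = L x"
        unfolding image_tangent_chart[OF c smooth_near_f] L by blast
      moreover have "det (?M (L (axis a 1))) = 0" for a
        using jk by (intro det_identical_rows[of k0 "j a"]) (auto simp: row_def vec_eq_iff ej)
      moreover have "det (?M (\<Sum>a\<in>UNIV. (x $ a) *\<^sub>R L (axis a 1)))
          = (\<Sum>a\<in>UNIV. (x $ a) *\<^sub>R det (?M (L (axis a 1))))"
        unfolding linear_sum[OF linM] linear_scale[OF linM] ..
      ultimately show "det (?M w) = 0"
        by (simp only: expand[of x]) simp
    qed
    \<comment> \<open>The rows are independent: \<open>\<xi>\<close> is transversal and the differential of \<open>f\<close> is injective.\<close>
    have "c k = 0" if z: "(\<Sum>i\<in>UNIV. c i *s row i (?M (\<xi> q))) = 0" for c k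
    proof -
      have "row k0 (?M (\<xi> q)) = \<xi> q" "row (j a) (?M (\<xi> q)) = L (axis a 1)" for a
        using jk by (simp_all add: row_def vec_eq_iff ej)
      then have "c k0 *\<^sub>R \<xi> q + (\<Sum>a\<in>UNIV. c (j a) *\<^sub>R L (axis a 1)) = 0"
        using z unfolding sum.remove[OF finite UNIV_I[of k0]]
        by (simp add: scalar_mult_eq_scaleR flip: sum.reindex_bij_betw[OF j])
      then have s: "c k0 *\<^sub>R \<xi> q + L (\<chi> a. c (j a)) = 0"
        by (simp add: expand[of "\<chi> a. c (j a)"])
      have "c k0 = 0"
      proof (rule ccontr)
        assume "c k0 \<noteq> 0"
        have "c k0 *\<^sub>R \<xi> q = - L (\<chi> a. c (j a))"
          using s by (simp add: eq_neg_iff_add_eq_0)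
        then have "inverse (c k0) *\<^sub>R (c k0 *\<^sub>R \<xi> q) = inverse (c k0) *\<^sub>R (- L (\<chi> a. c (j a)))"
          by simp
        then have "\<xi> q = (- inverse (c k0)) *\<^sub>R L (\<chi> a. c (j a))"
          using \<open>c k0 \<noteq> 0\<close> by simp
        moreover have "L (\<chi> a. c (j a)) \<in> image_tangent A f q"
          unfolding image_tangent_chart[OF c smooth_near_f] L by (rule rangeI)
        ultimately show False
          using \<xi>_not_tangent[of q] subspace_scale[OF subspace_image_tangent] by metis
      qed
      moreover from this have "(\<chi> a. c (j a)) = 0"
        using s by (intro chart_derivative_inj[OF c]) (simp flip: L)
      ultimately show "c k = 0"
        using j unfolding bij_betw_def by (metis DiffI UNIV_I imageE singletonD vec_lambda_beta zero_index)
    qed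
    then show "det (?M (\<xi> q)) \<noteq> 0"
      using matrix_right_invertible_independent_rows invertible_right_inverse invertible_det_nz by blast
  qed
  have conormalI: "conormal A f \<xi> q = \<alpha>"
    if "linear \<alpha>" "\<And>w. w \<in> image_tangent A f q \<Longrightarrow> \<alpha> w = 0" "\<alpha> (\<xi> q) = 1" for q \<alpha>
    unfolding conormal_def
  proof (rule the_equality)
    show "linear \<alpha> \<and> (\<forall>v\<in>tangent_space A q. \<alpha> (deriv_along v f) = 0) \<and> \<alpha> (\<xi> q) = 1"
      using that by (auto simp: image_tangent_def)
  next
    fix \<beta> :: "real ^ 'm \<Rightarrow> real"
    assume \<beta>: "linear \<beta> \<and> (\<forall>v\<in>tangent_space A q. \<beta> (deriv_along v f) = 0) \<and> \<beta> (\<xi> q) = 1"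
    show "\<beta> = \<alpha>"
    proof
      fix w
      obtain t c where t: "t \<in> image_tangent A f q" "w = t + c *\<^sub>R \<xi> q" by (rule decompose)
      then have "\<beta> t = 0" using \<beta> by (auto simp: image_tangent_def)
      then show "\<beta> w = \<alpha> w"
        using t that \<beta> by (simp add: linear_add linear_scale)
    qed
  qed
  have scaled: "linear (\<lambda>w. F w * a)" if "linear F" for F :: "real ^ 'm \<Rightarrow> real" and a
    using that by (auto intro!: linearI simp: linear_add linear_scale algebra_simps)
  have conormal: "conormal A f \<xi> q = (\<lambda>w. det (\<chi> i. if i = k0 then w else L (e i)) *
       inverse (det (\<chi> i. if i = k0 then \<xi> q else L (e i))))"
    if c: "(U, \<phi>) \<in> A" "q \<in> U" and L: "L = frechet_derivative (f \<circ> inv_into U \<phi>) (at (\<phi> q))"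
    for U \<phi> q L
    using *[OF that] by (intro conormalI scaled) auto
  have "linear (conormal A f \<xi> q) \<and> (\<forall>w\<in>image_tangent A f q. conormal A f \<xi> q w = 0)
      \<and> conormal A f \<xi> q (\<xi> q) = 1" for q
  proof -
    obtain U \<phi> where c: "(U, \<phi>) \<in> A" "q \<in> U" by (rule chart_around)
    show ?thesis
      using *[OF c refl] unfolding conormal[OF c refl] by (auto intro: scaled)
  qed
  then show thesis
    using * conormal by (intro that[of k0 e]) auto
qed

definition \<nu> :: "'a \<Rightarrow> real ^ 'm" where
  "\<nu> q = (\<chi> i. conormal A f \<xi> q (axis i 1))"

lemma conormal_eq_inner: "conormal A f \<xi> q w = \<nu> q \<bullet> w"
proof -
  have lin: "linear (conormal A f \<xi> q)" by (rule conormal_chart_formula)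
  have "conormal A f \<xi> q w = conormal A f \<xi> q (\<Sum>a\<in>UNIV. (w $ a) *\<^sub>R axis a 1)"
    using basis_expansion[of w] by (simp add: scalar_mult_eq_scaleR)
  then show ?thesis
    by (simp add: linear_sum[OF lin] linear_scale[OF lin] \<nu>_def inner_vec_def mult.commute)
qed

lemma \<nu>_\<xi>: "\<nu> q \<bullet> \<xi> q = 1"
  unfolding conormal_eq_inner[symmetric] by (rule conormal_chart_formula)

lemma image_tangent_iff: "w \<in> image_tangent A f q \<longleftrightarrow> \<nu> q \<bullet> w = 0"
proof -
  have t: "\<nu> q \<bullet> w = 0" if "w \<in> image_tangent A f q" for w
    unfolding conormal_eq_inner[symmetric] by (rule conormal_chart_formula) (use that in auto)
  obtain t c where "t \<in> image_tangent A f q" "w = t + c *\<^sub>R \<xi> q" by (rule decompose)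
  then show ?thesis using t[of w] t[of t] \<nu>_\<xi>[of q] by (auto simp: inner_add_right)
qed

lemma \<nu>_smooth: "smooth_fn A UNIV \<nu>"
  unfolding smooth_fn_vec_iff[OF open_UNIV]
proof
  fix k :: 'm
  obtain k0 and e :: "'m \<Rightarrow> real ^ 'n" where e:
    "\<And>U \<phi> q. (U, \<phi>) \<in> A \<Longrightarrow> q \<in> U \<Longrightarrow>
       det (\<chi> i. if i = k0 then \<xi> q else frechet_derivative (f \<circ> inv_into U \<phi>) (at (\<phi> q)) (e i)) \<noteq> 0"
    "\<And>U \<phi> q w. (U, \<phi>) \<in> A \<Longrightarrow> q \<in> U \<Longrightarrow> conormal A f \<xi> q w =
       det (\<chi> i. if i = k0 then w else frechet_derivative (f \<circ> inv_into U \<phi>) (at (\<phi> q)) (e i)) *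
       inverse (det (\<chi> i. if i = k0 then \<xi> q else frechet_derivative (f \<circ> inv_into U \<phi>) (at (\<phi> q)) (e i)))"
    by (rule conormal_chart_formula) blast
  show "smooth_fn A UNIV (\<lambda>q. \<nu> q $ k)"
    unfolding smooth_fn_def
  proof clarify
    fix U \<phi> assume c: "(U, \<phi>) \<in> A"
    let ?D = "\<lambda>w x. det (\<chi> i. if i = k0 then w x else frechet_derivative (f \<circ> inv_into U \<phi>) (at x) (e i))"
    have op: "open (\<phi> ` U)" using chart_image_open[OF c open_UNIV] by simp
    have s: "smooth_on (\<phi> ` U) (f \<circ> inv_into U \<phi>)" "smooth_on (\<phi> ` U) (\<xi> \<circ> inv_into U \<phi>)"
      using f_smooth \<xi>_smooth c unfolding smooth_fn_def by fastforce+
    have comp: "Ck_on l (\<phi> ` U) (\<lambda>x. F x $ b)" if "smooth_on (\<phi> ` U) F"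
      for l b and F :: "real ^ 'n \<Rightarrow> real ^ 'm"
      using Ck_on_bilinear[OF bounded_bilinear_inner op _ Ck_on_const, of l F "axis b 1"] that
      by (simp add: smooth_on_def inner_axis)
    have D: "Ck_on l (\<phi> ` U) (?D w)" if "smooth_on (\<phi> ` U) w" for l w
    proof (rule Ck_on_det[OF op])
      fix i j
      show "Ck_on l (\<phi> ` U) (\<lambda>x. (\<chi> i. if i = k0 then w x
          else frechet_derivative (f \<circ> inv_into U \<phi>) (at x) (e i)) $ i $ j)"
        using comp[OF that] comp[OF smooth_on_deriv[OF s(1)]] by (cases "i = k0") simp_all
    qed
    have "smooth_on (\<phi> ` U) (\<lambda>x. ?D (\<lambda>_. axis k 1) x * inverse (?D (\<xi> \<circ> inv_into U \<phi>) x))"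
      unfolding smooth_on_def
    proof
      fix l
      show "Ck_on l (\<phi> ` U) (\<lambda>x. ?D (\<lambda>_. axis k 1) x * inverse (?D (\<xi> \<circ> inv_into U \<phi>) x))"
        using e(1)[OF c] chart_inverse[OF c]
        by (intro Ck_on_bilinear[OF bounded_bilinear_mult op] Ck_on_inverse D s op)
           (auto simp: smooth_on_def comp_def intro: Ck_on_const cong: if_cong)
    qed
    moreover have "((\<lambda>q. \<nu> q $ k) \<circ> inv_into U \<phi>) x
        = ?D (\<lambda>_. axis k 1) x * inverse (?D (\<xi> \<circ> inv_into U \<phi>) x)" if "x \<in> \<phi> ` U" for x
      using that e(2)[OF c, of "inv_into U \<phi> x" "axis k 1"] by (auto simp: \<nu>_def comp_def chart_inverse[OF c] cong: if_cong)
    ultimately show "smooth_on (\<phi> ` (U \<inter> UNIV)) ((\<lambda>q. \<nu> q $ k) \<circ> inv_into U \<phi>)"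
      unfolding Int_UNIV_right by (rule iffD2[OF smooth_on_cong[OF op], rotated])
  qed
qed

lemma smooth_near_\<nu>: "smooth_near A p \<nu>"
  using \<nu>_smooth smooth_nearI[OF open_UNIV] by auto

text \<open>Differentiating \<open>\<langle>\<nu>, \<xi>\<rangle> = 1\<close> turns the equiaffine condition \<open>\<tau> = 0\<close> into a condition on \<open>\<nu>\<close>.\<close>

lemma \<nu>_deriv_\<xi>: "v \<in> tangent_space A p \<Longrightarrow> \<nu> p \<bullet> deriv_along v \<xi> = 0"
  and deriv_\<nu>_\<xi>: "v \<in> tangent_space A p \<Longrightarrow> deriv_along v \<nu> \<bullet> \<xi> p = 0"
proof -
  assume v: "v \<in> tangent_space A p"
  have "transversal_part A f \<xi> p w = \<nu> p \<bullet> w" for w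
    unfolding transversal_part_def
  proof (rule the_equality)
    obtain t c where t: "t \<in> image_tangent A f p" "w = t + c *\<^sub>R \<xi> p" by (rule decompose)
    then have "\<nu> p \<bullet> w = c"
      using \<nu>_\<xi>[of p] by (simp add: image_tangent_iff inner_add_right)
    then show "\<exists>u\<in>tangent_space A p. w = deriv_along u f + (\<nu> p \<bullet> w) *\<^sub>R \<xi> p"
      using t by (auto simp: image_tangent_def)
  next
    fix c assume "\<exists>u\<in>tangent_space A p. w = deriv_along u f + c *\<^sub>R \<xi> p"
    then obtain u where u: "u \<in> tangent_space A p" "w = deriv_along u f + c *\<^sub>R \<xi> p" by blast
    then have "\<nu> p \<bullet> deriv_along u f = 0"
      using image_tangent_iff by (auto simp: image_tangent_def)
    then show "c = \<nu> p \<bullet> w" using u \<nu>_\<xi>[of p] by (simp add: inner_add_right)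
  qed
  then show 1: "\<nu> p \<bullet> deriv_along v \<xi> = 0"
    using transversal_form_zero[OF v] by (simp add: transversal_form_def)
  show "deriv_along v \<nu> \<bullet> \<xi> p = 0"
    using tangent_inner[OF v smooth_near_\<nu> smooth_near_\<xi>] tangent_const[OF v] 1 by (simp add: \<nu>_\<xi>)
qed


section \<open>The bundle of restricted covectors\<close>

text \<open>The projection of the ambient space onto the tangent hyperplane along \<open>\<xi>\<close>.\<close>

definition tproj :: "'a \<Rightarrow> real ^ 'm \<Rightarrow> real ^ 'm" where
  "tproj q w = w - (\<nu> q \<bullet> w) *\<^sub>R \<xi> q"

text \<open>The restriction of the covector \<open>\<langle>Z, \<cdot>\<rangle>\<close> to the tangent hyperplane, and the extension of an element
  of the dual of the hyperplane by \<open>0\<close> on \<open>\<xi>\<close>, read as a vector. Composing them one way gives the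
  identity; composing them the other way subtracts a multiple of \<open>\<nu>\<close>.\<close>

definition covector :: "'a \<Rightarrow> real ^ 'm \<Rightarrow> real ^ 'm \<Rightarrow> real" where
  "covector q Z = restrict0 (image_tangent A f q) (\<lambda>w. Z \<bullet> w)"

definition lift :: "'a \<Rightarrow> (real ^ 'm \<Rightarrow> real) \<Rightarrow> real ^ 'm" where
  "lift q \<zeta> = (\<chi> i. \<zeta> (tproj q (axis i 1)))"

lemma tproj_mem: "tproj q w \<in> image_tangent A f q"
  by (simp add: image_tangent_iff tproj_def inner_diff_right \<nu>_\<xi>)

lemma tproj_tangent: "w \<in> image_tangent A f q \<Longrightarrow> tproj q w = w"
  by (simp add: image_tangent_iff tproj_def)

lemma linear_tproj: "linear (tproj q)"
  by (intro linearI) (simp_all add: tproj_def inner_add_right algebra_simps)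

lemma tproj_\<xi>: "tproj q (\<xi> q) = 0"
  by (simp add: tproj_def \<nu>_\<xi>)

lemma covector_apply: "w \<in> image_tangent A f q \<Longrightarrow> covector q Z w = Z \<bullet> w"
  by (simp add: covector_def restrict0_def)

lemma linear_covector: "linear (covector q)"
  by (intro linearI)
     (auto simp: covector_def restrict0_def scaleR_fun_def fun_eq_iff inner_add_left)

lemma covector_mem: "covector q Z \<in> dual_space (image_tangent A f q)"
  using subspace_image_tangent[of q]
  by (auto simp: dual_space_def lin_on_def covector_def restrict0_def inner_add_right subspace_add subspace_scale)

lemma covector_\<nu>: "covector q (\<nu> q) = 0"
  by (auto simp: covector_def restrict0_def fun_eq_iff image_tangent_iff)

lemma lift_inner:
  assumes "\<zeta> \<in> dual_space (image_tangent A f q)"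
  shows "lift q \<zeta> \<bullet> w = \<zeta> (tproj q w)"
proof -
  have lin: "linear (\<lambda>w. \<zeta> (tproj q w))"
    using assms tproj_mem[of q] unfolding dual_space_def lin_on_def
    by (intro linearI) (auto simp: linear_add[OF linear_tproj] linear_scale[OF linear_tproj])
  have "\<zeta> (tproj q w) = \<zeta> (tproj q (\<Sum>a\<in>UNIV. (w $ a) *\<^sub>R axis a 1))"
    using basis_expansion[of w] by (simp add: scalar_mult_eq_scaleR)
  also have "\<dots> = lift q \<zeta> \<bullet> w"
    by (simp add: linear_sum[OF lin] linear_scale[OF lin] lift_def inner_vec_def mult.commute)
  finally show ?thesis by simp
qed

lemma covector_lift:
  assumes "\<zeta> \<in> dual_space (image_tangent A f q)"
  shows "covector q (lift q \<zeta>) = \<zeta>"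
  by (rule dual_space_eqI[OF covector_mem assms])
     (simp add: covector_apply lift_inner[OF assms] tproj_tangent)

lemma lift_\<xi>:
  assumes "\<zeta> \<in> dual_space (image_tangent A f q)"
  shows "lift q \<zeta> \<bullet> \<xi> q = 0"
  using lift_inner[OF covector_mem, of q 0 "\<xi> q"] lift_inner[OF assms, of "\<xi> q"]
    lift_inner[OF assms, of 0] linear_0[OF linear_tproj, of q] by (simp add: tproj_\<xi>)

lemma lift_covector: "lift q (covector q Z) = Z - (Z \<bullet> \<xi> q) *\<^sub>R \<nu> q"
proof (rule vector_eq_ldot[THEN iffD1, rule_format])
  fix w
  show "w \<bullet> lift q (covector q Z) = w \<bullet> (Z - (Z \<bullet> \<xi> q) *\<^sub>R \<nu> q)"
    using lift_inner[OF covector_mem, of q Z w]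
    by (simp add: covector_apply[OF tproj_mem] inner_commute[of w])
       (simp add: tproj_def algebra_simps)
qed

lemma lift_add: "lift q (\<zeta> + \<eta>) = lift q \<zeta> + lift q \<eta>"
  by (simp add: lift_def vec_eq_iff)

lemma lift_scaleR: "lift q (c *\<^sub>R \<zeta>) = c *\<^sub>R lift q \<zeta>"
  by (simp add: lift_def vec_eq_iff scaleR_fun_def)

lemma fibre_Eminus: "fibre (Eminus A f) q = dual_space (image_tangent A f q)"
  by (simp add: Eminus_def dual_bundle_def Eplus_def)

lemma tproj_section: "open W \<Longrightarrow> (\<lambda>q. tproj q w) \<in> sections (Eplus A f) W"
  using smooth_fn_subset[OF \<nu>_smooth, of W] smooth_fn_subset[OF \<xi>_smooth, of W] tproj_mem
  by (auto simp: Eplus_def tproj_def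
      intro!: smooth_fn_diff smooth_fn_const smooth_fn_scaleR smooth_fn_inner)

text \<open>A section of the dual bundle is smooth, in the sense of pairing smoothly with all tangential
  fields, if and only if its extension is a smooth vector-valued function. One direction pairs with the
  projections of constant vectors, which are tangential fields defined everywhere.\<close>

lemma sections_Eminus_iff:
  assumes "open W"
  shows "\<zeta> \<in> sections (Eminus A f) W \<longleftrightarrow>
    (\<forall>q\<in>W. \<zeta> q \<in> dual_space (image_tangent A f q)) \<and> smooth_fn A W (\<lambda>q. lift q (\<zeta> q))"
proof
  assume \<zeta>: "\<zeta> \<in> sections (Eminus A f) W"
  then have "smooth_fn A W (\<lambda>q. \<zeta> q (tproj q w))" for w
    using tproj_section[OF assms, of w] assms by (auto simp: Eminus_def dual_bundle_def)
  then have "smooth_fn A W (\<lambda>q. lift q (\<zeta> q))"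
    by (simp add: smooth_fn_vec_iff[OF assms] lift_def)
  then show "(\<forall>q\<in>W. \<zeta> q \<in> dual_space (image_tangent A f q)) \<and> smooth_fn A W (\<lambda>q. lift q (\<zeta> q))"
    using \<zeta> by (simp add: Eminus_def dual_bundle_def Eplus_def)
next
  assume \<zeta>: "(\<forall>q\<in>W. \<zeta> q \<in> dual_space (image_tangent A f q)) \<and> smooth_fn A W (\<lambda>q. lift q (\<zeta> q))"
  have "smooth_fn A V (\<lambda>q. \<zeta> q (s q))"
    if V: "open V" "V \<subseteq> W" and s: "smooth_fn A V s" "\<forall>q\<in>V. s q \<in> image_tangent A f q" for V s
  proof -
    have "smooth_fn A V (\<lambda>q. lift q (\<zeta> q) \<bullet> s q)"
      using \<zeta> V s(1) smooth_fn_subset by (intro smooth_fn_inner) auto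
    moreover have "lift q (\<zeta> q) \<bullet> s q = \<zeta> q (s q)" if "q \<in> V" for q
      using \<zeta> V s(2) that by (metis lift_inner tproj_tangent subsetD)
    ultimately show ?thesis using smooth_fn_cong[OF V(1)] by (metis (no_types, lifting))
  qed
  then show "\<zeta> \<in> sections (Eminus A f) W"
    using \<zeta> by (auto simp: Eminus_def dual_bundle_def Eplus_def)
qed

lemma section_mem: 
  "\<zeta> \<in> sections (Eminus A f) W \<Longrightarrow> q \<in> W \<Longrightarrow> \<zeta> q \<in> dual_space (image_tangent A f q)"
  by (simp add: Eminus_def dual_bundle_def Eplus_def)

lemma section_lift_smooth:
  "\<zeta> \<in> sections (Eminus A f) W \<Longrightarrow> open W \<Longrightarrow> smooth_fn A W (\<lambda>q. lift q (\<zeta> q))"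
  using sections_Eminus_iff by blast

lemma section_cong:
  assumes "open W" "\<And>q. q \<in> W \<Longrightarrow> \<zeta> q = \<eta> q"
  shows "\<zeta> \<in> sections (Eminus A f) W \<longleftrightarrow> \<eta> \<in> sections (Eminus A f) W"
  unfolding sections_Eminus_iff[OF assms(1)]
  using assms smooth_fn_cong[OF assms(1), of "\<lambda>q. lift q (\<zeta> q)" "\<lambda>q. lift q (\<eta> q)"] by auto

lemma covector_section:
  assumes "open W" "smooth_fn A W Z"
  shows "(\<lambda>q. covector q (Z q)) \<in> sections (Eminus A f) W"
  unfolding sections_Eminus_iff[OF assms(1)] lift_covector
  using assms smooth_fn_subset[OF \<nu>_smooth, of W] smooth_fn_subset[OF \<xi>_smooth, of W] covector_mem
  by (auto intro!: smooth_fn_diff smooth_fn_scaleR smooth_fn_inner)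

lemma section_add:
  assumes "open W" "\<zeta> \<in> sections (Eminus A f) W" "\<eta> \<in> sections (Eminus A f) W"
  shows "(\<lambda>q. \<zeta> q + \<eta> q) \<in> sections (Eminus A f) W"
  using assms subspace_add[OF subspace_dual_space[OF subspace_image_tangent]]
  by (auto simp: sections_Eminus_iff lift_add intro: smooth_fn_add)

lemma section_scaleR:
  assumes "open W" "smooth_fn A W g" "\<zeta> \<in> sections (Eminus A f) W"
  shows "(\<lambda>q. g q *\<^sub>R \<zeta> q) \<in> sections (Eminus A f) W"
  using assms subspace_scale[OF subspace_dual_space[OF subspace_image_tangent]]
  by (auto simp: sections_Eminus_iff lift_scaleR intro: smooth_fn_scaleR)

text \<open>Covectors that agree on the tangent hyperplane differ by a multiple of \<open>\<nu>\<close>, and \<open>w\<^sub>0\<close> detects it.\<close>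

lemma covector_inj:
  assumes "\<nu> q \<bullet> w0 \<noteq> 0"
  shows "inj_on (covector q) {Z. Z \<bullet> w0 = 0}"
proof (rule inj_onI)
  fix Z Z' assume Z: "Z \<in> {Z. Z \<bullet> w0 = 0}" "Z' \<in> {Z. Z \<bullet> w0 = 0}" and eq: "covector q Z = covector q Z'"
  then have "Z - Z' = ((Z - Z') \<bullet> \<xi> q) *\<^sub>R \<nu> q"
    using lift_covector[of q Z] lift_covector[of q Z'] by (simp add: algebra_simps inner_diff_left)
  moreover from arg_cong[OF this, of "\<lambda>w. w \<bullet> w0"] have "(Z - Z') \<bullet> \<xi> q = 0"
    using Z assms by (simp only: inner_scaleR_left) (simp add: inner_diff_left)
  ultimately show "Z = Z'" by simp
qed

text \<open>Where \<open>\<langle>\<nu>, w\<^sub>0\<rangle> \<noteq> 0\<close>, each element of the dual of the tangent hyperplane is the restriction of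
  exactly one covector that annihilates the fixed vector \<open>w\<^sub>0\<close>. This trivialises \<open>E\<^sup>-\<close> by a fixed vector
  space.\<close>

definition annihilating_lift :: "real ^ 'm \<Rightarrow> 'a \<Rightarrow> (real ^ 'm \<Rightarrow> real) \<Rightarrow> real ^ 'm" where
  "annihilating_lift w0 q \<zeta> = lift q \<zeta> - (lift q \<zeta> \<bullet> w0 * inverse (\<nu> q \<bullet> w0)) *\<^sub>R \<nu> q"

lemma annihilating_lift_inner: "\<nu> q \<bullet> w0 \<noteq> 0 \<Longrightarrow> annihilating_lift w0 q \<zeta> \<bullet> w0 = 0"
  by (simp add: annihilating_lift_def inner_diff_left)

lemma covector_annihilating_lift:
  "\<zeta> \<in> dual_space (image_tangent A f q) \<Longrightarrow> covector q (annihilating_lift w0 q \<zeta>) = \<zeta>"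
  by (simp add: annihilating_lift_def linear_diff[OF linear_covector] linear_scale[OF linear_covector]
      covector_\<nu> covector_lift)

lemma annihilating_lift_smooth:
  assumes "open W" "\<And>q. q \<in> W \<Longrightarrow> \<nu> q \<bullet> w0 \<noteq> 0" "\<zeta> \<in> sections (Eminus A f) W"
  shows "smooth_fn A W (\<lambda>q. annihilating_lift w0 q (\<zeta> q))"
  unfolding annihilating_lift_def
  using assms smooth_fn_subset[OF \<nu>_smooth, of W] section_lift_smooth
  by (intro smooth_fn_diff smooth_fn_scaleR smooth_fn_mult smooth_fn_inverse smooth_fn_inner smooth_fn_const) auto

lemma open_\<nu>_nonzero: "open {q. \<nu> q \<bullet> w0 \<noteq> 0}"
  using smooth_fn_continuous[OF \<nu>_smooth]
  by (intro open_Collect_neq continuous_intros) auto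

text \<open>Orthonormal vectors \<open>b\<^sub>1, \<dots>, b\<^sub>n\<close> perpendicular to \<open>w\<^sub>0 = \<xi>\<^sub>p\<close>, restricted to the nearby tangent
  hyperplanes, are a frame. The coefficients of a section are the inner products of the \<open>b\<^sub>i\<close> with its
  extension annihilating \<open>w\<^sub>0\<close>, hence smooth.\<close>

lemma Eminus_frame:
  obtains U and b :: "nat \<Rightarrow> real ^ 'm" where "open U" "p \<in> U"
    "\<And>q. q \<in> U \<Longrightarrow> inj_on (\<lambda>i. covector q (b i)) {..<CARD('n)}"
    "\<And>q. q \<in> U \<Longrightarrow> independent ((\<lambda>i. covector q (b i)) ` {..<CARD('n)})"
    "\<And>q. q \<in> U \<Longrightarrow> span ((\<lambda>i. covector q (b i)) ` {..<CARD('n)}) = dual_space (image_tangent A f q)"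
    "\<And>W \<zeta>. open W \<Longrightarrow> W \<subseteq> U \<Longrightarrow> \<zeta> \<in> sections (Eminus A f) W \<Longrightarrow>
      \<exists>c. (\<forall>i<CARD('n). smooth_fn A W (c i)) \<and> (\<forall>q\<in>W. \<zeta> q = (\<Sum>i<CARD('n). c i q *\<^sub>R covector q (b i)))"
proof -
  define w0 where "w0 = \<xi> p"
  define S where "S = {Z. Z \<bullet> w0 = 0}"
  define U where "U = {q. \<nu> q \<bullet> w0 \<noteq> 0}"
  have S: "subspace S"
    by (auto simp: S_def subspace_def inner_add_left)
  have "w0 \<noteq> 0" using \<nu>_\<xi>[of p] by (auto simp: w0_def)
  then have "dim S = CARD('n)"
    using dim_hyperplane[of w0] card by (simp add: S_def inner_commute)
  then obtain B where B: "B \<subseteq> S" "pairwise orthogonal B" "\<And>x. x \<in> B \<Longrightarrow> norm x = 1"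
    "independent B" "card B = CARD('n)" "span B = S"
    using orthonormal_basis_subspace[OF S] by metis
  have "finite B" using B(4) independent_imp_finite by blast
  then obtain b where b: "bij_betw b {..<CARD('n)} B"
    using ex_bij_betw_nat_finite[of B] B(5) by (auto simp: lessThan_atLeast0)
  have im: "(\<lambda>i. covector q (b i)) ` {..<CARD('n)} = covector q ` B" for q
    using b by (auto simp: bij_betw_def image_image[symmetric])
  have inj: "inj_on (covector q) (span B)" if "q \<in> U" for q
    using covector_inj[of q w0] that B(6) by (simp add: S_def U_def)
  show thesis
  proof (rule that[of U b])
    show "open U" using open_\<nu>_nonzero by (simp add: U_def)
    show "p \<in> U" by (simp add: U_def w0_def \<nu>_\<xi>)
    fix q assume q: "q \<in> U"
    show "inj_on (\<lambda>i. covector q (b i)) {..<CARD('n)}"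
      using comp_inj_on[of b "{..<CARD('n)}" "covector q"] b inj_on_subset[OF inj[OF q]] span_superset[of B]
      by (auto simp: bij_betw_def comp_def)
    show "independent ((\<lambda>i. covector q (b i)) ` {..<CARD('n)})"
      unfolding im by (rule linear_independent_injective_image[OF linear_covector B(4) inj[OF q]])
    have "covector q ` S = dual_space (image_tangent A f q)"
    proof
      show "dual_space (image_tangent A f q) \<subseteq> covector q ` S"
      proof
        fix \<zeta> assume "\<zeta> \<in> dual_space (image_tangent A f q)"
        then have "\<zeta> = covector q (annihilating_lift w0 q \<zeta>)"
          by (simp add: covector_annihilating_lift)
        then show "\<zeta> \<in> covector q ` S"
          using annihilating_lift_inner[of q w0 \<zeta>] q by (auto simp: S_def U_def)
      qed
    qed (auto simp: covector_mem)
    then show "span ((\<lambda>i. covector q (b i)) ` {..<CARD('n)}) = dual_space (image_tangent A f q)"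
      unfolding im span_linear_image[OF linear_covector] B(6) .
  next
    fix W \<zeta> assume W: "open W" "W \<subseteq> U" and \<zeta>: "\<zeta> \<in> sections (Eminus A f) W"
    define c where "c i q = annihilating_lift w0 q (\<zeta> q) \<bullet> b i" for i q
    have "smooth_fn A W (c i)" for i
      unfolding c_def using W \<zeta>
      by (intro smooth_fn_inner smooth_fn_const annihilating_lift_smooth) (auto simp: U_def)
    moreover have "\<zeta> q = (\<Sum>i<CARD('n). c i q *\<^sub>R covector q (b i))" if q: "q \<in> W" for q
    proof -
      let ?Z = "annihilating_lift w0 q (\<zeta> q)"
      have "?Z \<in> span B"
        using annihilating_lift_inner[of q w0] q W by (auto simp: B(6) S_def U_def)
      then have "(\<Sum>v\<in>B. (?Z \<bullet> v) *\<^sub>R v) = ?Z"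
        using B \<open>finite B\<close> by (intro orthonormal_basis_expand) auto
      then have "?Z = (\<Sum>i<CARD('n). (?Z \<bullet> b i) *\<^sub>R b i)"
        using sum.reindex_bij_betw[OF b, of "\<lambda>v. (?Z \<bullet> v) *\<^sub>R v"] by simp
      then have "covector q ?Z = covector q (\<Sum>i<CARD('n). (?Z \<bullet> b i) *\<^sub>R b i)"
        by (rule arg_cong)
      also have "\<dots> = (\<Sum>i<CARD('n). c i q *\<^sub>R covector q (b i))"
        by (simp add: c_def linear_sum[OF linear_covector] linear_scale[OF linear_covector])
      finally show ?thesis
        using covector_annihilating_lift[OF section_mem[OF \<zeta> q]] by simp
    qed
    ultimately show "\<exists>c. (\<forall>i<CARD('n). smooth_fn A W (c i)) \<and>
        (\<forall>q\<in>W. \<zeta> q = (\<Sum>i<CARD('n). c i q *\<^sub>R covector q (b i)))"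
      by blast
  qed
qed

lemma vector_bundle_Eminus: "vector_bundle A CARD('n) (Eminus A f)"
  unfolding vector_bundle_def fibre_Eminus
proof (intro conjI allI impI)
  fix p
  show "subspace (dual_space (image_tangent A f p))"
    by (rule subspace_dual_space[OF subspace_image_tangent])
next
  fix W s assume "s \<in> sections (Eminus A f) W"
  then show "\<forall>p\<in>W. s p \<in> dual_space (image_tangent A f p)" using section_mem by blast
next
  fix W s assume W: "open (W::'a set)"
  show "s \<in> sections (Eminus A f) W \<longleftrightarrow>
      (\<forall>p\<in>W. \<exists>V. open V \<and> p \<in> V \<and> V \<subseteq> W \<and> s \<in> sections (Eminus A f) V)"
  proof
    assume loc: "\<forall>p\<in>W. \<exists>V. open V \<and> p \<in> V \<and> V \<subseteq> W \<and> s \<in> sections (Eminus A f) V"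
    have "smooth_fn A W (\<lambda>q. lift q (s q))"
      using loc section_lift_smooth by (intro smooth_fn_local) blast
    then show "s \<in> sections (Eminus A f) W"
      unfolding sections_Eminus_iff[OF W] using loc section_mem by blast
  qed (use W in blast)
next
  fix p
  obtain U and b :: "nat \<Rightarrow> real ^ 'm" where U: "open U" "p \<in> U"
    "\<And>q. q \<in> U \<Longrightarrow> inj_on (\<lambda>i. covector q (b i)) {..<CARD('n)}"
    "\<And>q. q \<in> U \<Longrightarrow> independent ((\<lambda>i. covector q (b i)) ` {..<CARD('n)})"
    "\<And>q. q \<in> U \<Longrightarrow> span ((\<lambda>i. covector q (b i)) ` {..<CARD('n)}) = dual_space (image_tangent A f q)"
    "\<And>W \<zeta>. open W \<Longrightarrow> W \<subseteq> U \<Longrightarrow> \<zeta> \<in> sections (Eminus A f) W \<Longrightarrow>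
      \<exists>c. (\<forall>i<CARD('n). smooth_fn A W (c i)) \<and> (\<forall>q\<in>W. \<zeta> q = (\<Sum>i<CARD('n). c i q *\<^sub>R covector q (b i)))"
    by (rule Eminus_frame[of p]) blast
  have conv: "s \<in> sections (Eminus A f) W"
    if W: "open W" and c: "\<And>i. i < CARD('n) \<Longrightarrow> smooth_fn A W (c i)"
      and s: "\<And>q. q \<in> W \<Longrightarrow> s q = (\<Sum>i<CARD('n). c i q *\<^sub>R covector q (b i))" for W s c
  proof -
    have "s q = covector q (\<Sum>i<CARD('n). c i q *\<^sub>R b i)" if "q \<in> W" for q
      by (simp add: s[OF that] linear_sum[OF linear_covector] linear_scale[OF linear_covector])
    moreover have "(\<lambda>q. covector q (\<Sum>i<CARD('n). c i q *\<^sub>R b i)) \<in> sections (Eminus A f) W"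
      using c by (intro covector_section W smooth_fn_sum smooth_fn_scaleR smooth_fn_const) auto
    ultimately show ?thesis using section_cong[OF W, of s "\<lambda>q. covector q (\<Sum>i<CARD('n). c i q *\<^sub>R b i)"] by simp
  qed
  show "\<exists>U e. open U \<and> p \<in> U \<and>
      (\<forall>q\<in>U. inj_on (\<lambda>i. e i q) {..<CARD('n)} \<and> independent ((\<lambda>i. e i q) ` {..<CARD('n)}) \<and>
        span ((\<lambda>i. e i q) ` {..<CARD('n)}) = dual_space (image_tangent A f q)) \<and>
      (\<forall>W s. open W \<longrightarrow> W \<subseteq> U \<longrightarrow> (s \<in> sections (Eminus A f) W \<longleftrightarrow>
        (\<exists>c. (\<forall>i<CARD('n). smooth_fn A W (c i)) \<and>
          (\<forall>q\<in>W. s q = (\<Sum>i<CARD('n). c i q *\<^sub>R e i q)))))"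
  proof (intro exI[of _ U] exI[of _ "\<lambda>i q. covector q (b i)"] conjI ballI allI impI)
    fix W s assume W: "open W" "W \<subseteq> U"
    show "s \<in> sections (Eminus A f) W \<longleftrightarrow> (\<exists>c. (\<forall>i<CARD('n). smooth_fn A W (c i)) \<and>
        (\<forall>q\<in>W. s q = (\<Sum>i<CARD('n). c i q *\<^sub>R covector q (b i))))"
    proof
      assume "s \<in> sections (Eminus A f) W"
      then show "\<exists>c. (\<forall>i<CARD('n). smooth_fn A W (c i)) \<and>
          (\<forall>q\<in>W. s q = (\<Sum>i<CARD('n). c i q *\<^sub>R covector q (b i)))"
        by (rule U(6)[OF W])
    next
      assume "\<exists>c. (\<forall>i<CARD('n). smooth_fn A W (c i)) \<and>
          (\<forall>q\<in>W. s q = (\<Sum>i<CARD('n). c i q *\<^sub>R covector q (b i)))"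
      then obtain c where "\<And>i. i < CARD('n) \<Longrightarrow> smooth_fn A W (c i)"
        "\<And>q. q \<in> W \<Longrightarrow> s q = (\<Sum>i<CARD('n). c i q *\<^sub>R covector q (b i))" by blast
      then show "s \<in> sections (Eminus A f) W" by (rule conv[OF W(1)])
    qed
  qed (use U in auto)
qed


section \<open>The connection on the dual bundle\<close>

text \<open>In terms of the ambient space, the induced connection is the projection of the flat derivative.\<close>

lemma deriv_along_tangential_part: "deriv_along (tangential_part A f \<xi> p w) f = tproj p w"
proof -
  obtain u where u: "u \<in> tangent_space A p" "tproj p w = deriv_along u f"
    using tproj_mem[of p w] by (auto simp: image_tangent_def)
  have "tangential_part A f \<xi> p w = u"
    unfolding tangential_part_def
  proof (rule the_equality)
    show "u \<in> tangent_space A p \<and> (\<exists>c. w = deriv_along u f + c *\<^sub>R \<xi> p)"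
      using u by (auto simp: tproj_def algebra_simps)
  next
    fix u' assume "u' \<in> tangent_space A p \<and> (\<exists>c. w = deriv_along u' f + c *\<^sub>R \<xi> p)"
    then obtain c where u': "u' \<in> tangent_space A p" "w = deriv_along u' f + c *\<^sub>R \<xi> p" by blast
    then have "tproj p w = deriv_along u' f"
      using tproj_tangent[of "deriv_along u' f" p]
      by (simp add: linear_add[OF linear_tproj] linear_scale[OF linear_tproj] tproj_\<xi> image_tangent_def)
    then show "u' = u" using u u' f_immersion[of p] by (auto dest: inj_onD)
  qed
  then show ?thesis using u by simp
qed

lemma nabla_plus_eq:
  assumes W: "open W" "p \<in> W" and \<eta>: "\<eta> \<in> sections (Eplus A f) W" and v: "v \<in> tangent_space A p"
  shows "nabla_plus A f \<xi> p v \<eta> = tproj p (deriv_along v \<eta>)"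
proof -
  have "deriv_along v (\<lambda>q. deriv_along (inv_into (tangent_space A q) (\<lambda>u. deriv_along u f) (\<eta> q)) f)
      = deriv_along v \<eta>"
  proof (rule deriv_along_local[OF v W])
    fix q assume "q \<in> W"
    then show "deriv_along (inv_into (tangent_space A q) (\<lambda>u. deriv_along u f) (\<eta> q)) f = \<eta> q"
      using \<eta> f_inv_into_f[of "\<eta> q" "\<lambda>u. deriv_along u f" "tangent_space A q"]
      by (auto simp: Eplus_def image_tangent_def)
  qed
  then show ?thesis
    by (simp add: nabla_plus_def induced_connection_def deriv_along_tangential_part)
qed

abbreviation "E \<equiv> Eminus A f"
abbreviation "D \<equiv> nabla_minus A f \<xi>"

lemma section_lift_smooth_near:
  "\<zeta> \<in> sections E W \<Longrightarrow> open W \<Longrightarrow> p \<in> W \<Longrightarrow> smooth_near A p (\<lambda>q. lift q (\<zeta> q))"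
  using section_lift_smooth smooth_nearI by blast

text \<open>The product rule applied to \<open>\<zeta>(\<eta>) = \<langle>Z, \<eta>\<rangle>\<close>, where \<open>Z\<close> is the extension of \<open>\<zeta>\<close>, together with
  \<open>\<langle>Z, d\<eta>(v)\<rangle> = \<zeta>(\<nabla>\<^sup>+\<^sub>v \<eta>)\<close>, since \<open>Z\<close> annihilates the transversal part of \<open>d\<eta>(v)\<close>. Uniqueness of the dual
  connection follows by testing with projections of constant vectors.\<close>

lemma nabla_minus_eq:
  assumes \<zeta>: "\<zeta> \<in> sections E W" and W: "open W" "p \<in> W" and v: "v \<in> tangent_space A p"
  shows "D p v \<zeta> = covector p (deriv_along v (\<lambda>q. lift q (\<zeta> q)))"
proof -
  let ?L = "\<lambda>q. lift q (\<zeta> q)" and ?\<omega> = "covector p (deriv_along v (\<lambda>q. lift q (\<zeta> q)))"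
  have th: "pairing_theta (w, 0) (0, \<alpha>) = \<alpha> w / 2" for w :: "real ^ 'm" and \<alpha>
    by (simp add: pairing_theta_def)
  have dual: "v (\<lambda>q. \<zeta> q (\<eta> q) / 2) = \<zeta> p (nabla_plus A f \<xi> p v \<eta>) / 2 + ?\<omega> (\<eta> p) / 2"
    if V: "open V" "p \<in> V" and \<eta>: "\<eta> \<in> sections (Eplus A f) V" for V \<eta>
  proof -
    have s: "smooth_near A p \<eta>" using \<eta> V smooth_nearI by (auto simp: Eplus_def)
    have L: "smooth_near A p ?L" using section_lift_smooth_near[OF \<zeta> W] .
    have mem: "\<eta> q \<in> image_tangent A f q" if "q \<in> V" for q using \<eta> that by (auto simp: Eplus_def)
    have "smooth_near A p (\<lambda>q. ?L q \<bullet> \<eta> q)"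
    proof -
      obtain V' where "open V'" "p \<in> V'" "smooth_fn A V' \<eta>" "smooth_fn A V' ?L"
        using smooth_near_common[OF s L] .
      then show ?thesis using smooth_fn_inner smooth_nearI by blast
    qed
    then have "v (\<lambda>q. (1/2) * (?L q \<bullet> \<eta> q)) = (1/2) * (deriv_along v ?L \<bullet> \<eta> p + ?L p \<bullet> deriv_along v \<eta>)"
      using tangent_scale[OF v] tangent_inner[OF v L s] by metis
    moreover have "v (\<lambda>q. \<zeta> q (\<eta> q) / 2) = v (\<lambda>q. (1/2) * (?L q \<bullet> \<eta> q))"
      using V W mem by (intro tangent_local[OF v, of "V \<inter> W"])
        (auto simp: lift_inner[OF section_mem[OF \<zeta>]] tproj_tangent)
    ultimately show ?thesis
      using mem[OF V(2)] by (simp add: nabla_plus_eq[OF V \<eta> v] covector_apply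
          lift_inner[OF section_mem[OF \<zeta> W(2)]] add_divide_distrib)
  qed
  show ?thesis
    unfolding nabla_minus_def fibre_Eminus th
  proof (rule the_equality)
    show "?\<omega> \<in> dual_space (image_tangent A f p) \<and> (\<forall>W \<eta>. open W \<longrightarrow> p \<in> W \<longrightarrow> \<eta> \<in> sections (Eplus A f) W \<longrightarrow>
      v (\<lambda>q. \<zeta> q (\<eta> q) / 2) = \<zeta> p (nabla_plus A f \<xi> p v \<eta>) / 2 + ?\<omega> (\<eta> p) / 2)"
      by (intro conjI allI impI covector_mem) (rule dual)
  next
    fix \<omega> assume \<omega>: "\<omega> \<in> dual_space (image_tangent A f p) \<and> (\<forall>W \<eta>. open W \<longrightarrow> p \<in> W \<longrightarrow> \<eta> \<in> sections (Eplus A f) W \<longrightarrow>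
      v (\<lambda>q. \<zeta> q (\<eta> q) / 2) = \<zeta> p (nabla_plus A f \<xi> p v \<eta>) / 2 + \<omega> (\<eta> p) / 2)"
    show "\<omega> = ?\<omega>"
    proof (rule dual_space_eqI[OF _ covector_mem])
      show "\<omega> \<in> dual_space (image_tangent A f p)" using \<omega> by blast
      fix w assume w: "w \<in> image_tangent A f p"
      show "\<omega> w = ?\<omega> w"
        using \<omega>[THEN conjunct2, rule_format, OF open_UNIV UNIV_I tproj_section[OF open_UNIV, of w]]
          dual[OF open_UNIV UNIV_I tproj_section[OF open_UNIV, of w]]
        by (simp add: tproj_tangent[OF w])
    qed
  qed
qed

lemma nabla_minus_section:
  assumes W: "open W" and X: "X \<in> sections (tangent_bundle A) W" and \<zeta>: "\<zeta> \<in> sections E W"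
  shows "(\<lambda>q. D q (X q) \<zeta>) \<in> sections E W"
proof -
  have "(\<lambda>q. covector q (deriv_along (X q) (\<lambda>q. lift q (\<zeta> q)))) \<in> sections E W"
    by (intro covector_section W deriv_along_smooth[OF X W] section_lift_smooth[OF \<zeta> W])
  then show ?thesis
    using section_cong[OF W, of "\<lambda>q. D q (X q) \<zeta>"] nabla_minus_eq[OF \<zeta> W _ vector_field_tangent[OF X]]
    by simp
qed

lemma connection_nabla_minus: "connection A UNIV E D"
  unfolding connection_def fibre_Eminus lin_on_def
proof (intro allI impI conjI ballI)
  fix W s p assume W: "open W" and s: "s \<in> sections E W" and p: "p \<in> W"
  note eq = nabla_minus_eq[OF _ W p]
  note L = section_lift_smooth_near[OF _ W p]
  {
    fix v assume v: "v \<in> tangent_space A p"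
    show "D p v s \<in> dual_space (image_tangent A f p)"
      by (simp add: eq[OF s v] covector_mem)
    {
      fix t assume t: "t \<in> sections E W"
      show "D p v (\<lambda>q. s q + t q) = D p v s + D p v t"
        by (simp add: eq[OF s v] eq[OF t v] eq[OF section_add[OF W s t] v] lift_add
            deriv_along_add[OF v L[OF s] L[OF t]] linear_add[OF linear_covector])
    next
      fix g :: "'a \<Rightarrow> real" assume g: "smooth_fn A W g"
      show "D p v (\<lambda>q. g q *\<^sub>R s q) = v g *\<^sub>R s p + g p *\<^sub>R D p v s"
        by (simp add: eq[OF s v] eq[OF section_scaleR[OF W g s] v] lift_scaleR
            deriv_along_scaleR[OF v smooth_nearI[OF W p g] L[OF s]] linear_add[OF linear_covector]
            linear_scale[OF linear_covector] covector_lift[OF section_mem[OF s p]])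
    }
    fix c
    show "D p (c *\<^sub>R v) s = c *\<^sub>R D p v s"
      by (simp add: eq[OF s v] eq[OF s subspace_scale[OF subspace_tangent_space v]] deriv_along_scale
          linear_scale[OF linear_covector])
  }
  fix u v assume u: "u \<in> tangent_space A p" and v: "v \<in> tangent_space A p"
  show "D p (u + v) s = D p u s + D p v s"
    by (simp add: eq[OF s u] eq[OF s v] eq[OF s subspace_add[OF subspace_tangent_space u v]]
        deriv_along_plus linear_add[OF linear_covector])
next
  fix W X s assume "open W" "X \<in> sections (tangent_bundle A) W" "s \<in> sections E W"
  then show "(\<lambda>p. D p (X p) s) \<in> sections E W" by (rule nabla_minus_section)
qed


text \<open>The component \<open>\<Phi>\<^sup>- = - \<nu>\<^sub>*\<close> of the induced bundle map.\<close>

abbreviation "\<Phi> \<equiv> \<lambda>p v. restrict0 (image_tangent A f p) (- conormal_deriv A f \<xi> v)"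

lemma \<Phi>_eq:
  assumes "v \<in> tangent_space A p"
  shows "\<Phi> p v = covector p (- deriv_along v \<nu>)"
  using tangent_inner_const[OF assms smooth_near_\<nu>]
  by (simp add: covector_def restrict0_def fun_eq_iff conormal_deriv_def conormal_eq_inner)

text \<open>By the equiaffine condition \<open>d\<nu>(v)\<close> annihilates \<open>\<xi>\<close>, so no multiple of \<open>\<nu>\<close> has to be subtracted.\<close>

lemma lift_\<Phi>: "v \<in> tangent_space A p \<Longrightarrow> lift p (\<Phi> p v) = - deriv_along v \<nu>"
  by (simp add: \<Phi>_eq lift_covector deriv_\<nu>_\<xi>)

lemma deriv_\<nu>_smooth:
  assumes "open W" "X \<in> sections (tangent_bundle A) W"
  shows "smooth_fn A W (\<lambda>q. deriv_along (X q) \<nu>)"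
  using deriv_along_smooth[OF assms(2,1) smooth_fn_subset[OF \<nu>_smooth]] by simp

lemma \<Phi>_section:
  assumes W: "open W" and X: "X \<in> sections (tangent_bundle A) W"
  shows "(\<lambda>q. \<Phi> q (X q)) \<in> sections E W"
proof -
  have "(\<lambda>q. covector q (- deriv_along (X q) \<nu>)) \<in> sections E W"
    by (intro covector_section W smooth_fn_minus deriv_\<nu>_smooth X)
  then show ?thesis
    using section_cong[OF W, of "\<lambda>q. \<Phi> q (X q)"] \<Phi>_eq[OF vector_field_tangent[OF X]] by simp
qed

lemma \<Phi>_add: "u \<in> tangent_space A p \<Longrightarrow> v \<in> tangent_space A p \<Longrightarrow> \<Phi> p (u + v) = \<Phi> p u + \<Phi> p v"
  and \<Phi>_scaleR: "v \<in> tangent_space A p \<Longrightarrow> \<Phi> p (c *\<^sub>R v) = c *\<^sub>R \<Phi> p v"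
  and \<Phi>_mem: "v \<in> tangent_space A p \<Longrightarrow> \<Phi> p v \<in> dual_space (image_tangent A f p)"
  by (simp_all add: \<Phi>_eq subspace_add[OF subspace_tangent_space] subspace_scale[OF subspace_tangent_space]
      deriv_along_plus deriv_along_scale covector_mem
      flip: linear_add[OF linear_covector] linear_scale[OF linear_covector])

lemma bundle_map_\<Phi>: "bundle_map A E \<Phi>"
  unfolding bundle_map_def fibre_Eminus lin_on_def
  by (auto simp: \<Phi>_add \<Phi>_scaleR intro: \<Phi>_mem \<Phi>_section)

text \<open>Here \<open>\<nabla>\<^sup>-\<^sub>X \<Phi>\<^sup>-(Y)\<close> is the restriction of \<open>- X Y \<nu>\<close>, whose antisymmetrisation is \<open>- [X,Y] \<nu>\<close>.\<close>

lemma rel_torsion_free_nabla_minus: "rel_torsion_free A UNIV \<Phi> D"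
  unfolding rel_torsion_free_def
proof (intro allI impI ballI)
  fix W X Y p
  assume W: "open W" and X: "X \<in> sections (tangent_bundle A) W" and Y: "Y \<in> sections (tangent_bundle A) W"
    and p: "p \<in> W"
  have D: "D p (X p) (\<lambda>q. \<Phi> q (Y q)) = covector p (- deriv_along (X p) (\<lambda>q. deriv_along (Y q) \<nu>))"
    if X: "X \<in> sections (tangent_bundle A) W" and Y: "Y \<in> sections (tangent_bundle A) W" for X Y
  proof -
    have Xp: "X p \<in> tangent_space A p" using vector_field_tangent[OF X p] .
    have "deriv_along (X p) (\<lambda>q. lift q (\<Phi> q (Y q))) = deriv_along (X p) (\<lambda>q. - deriv_along (Y q) \<nu>)"
      using lift_\<Phi>[OF vector_field_tangent[OF Y]] by (intro deriv_along_local[OF Xp W p]) auto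
    also have "\<dots> = - deriv_along (X p) (\<lambda>q. deriv_along (Y q) \<nu>)"
      by (rule deriv_along_minus[OF Xp smooth_nearI[OF W p deriv_\<nu>_smooth[OF W Y]]])
    finally show ?thesis
      by (simp add: nabla_minus_eq[OF \<Phi>_section[OF W Y] W p Xp])
  qed
  show "D p (X p) (\<lambda>q. \<Phi> q (Y q)) - D p (Y p) (\<lambda>q. \<Phi> q (X q)) - \<Phi> p (lie_bracket A X Y p) = 0"
    by (simp add: D[OF X Y] D[OF Y X] \<Phi>_eq[OF lie_bracket_tangent[OF X Y W p]]
        deriv_along_lie_bracket[OF smooth_near_\<nu>] linear_0[OF linear_covector]
        flip: linear_diff[OF linear_covector])
qed


section \<open>Projective flatness\<close>

text \<open>The logarithmic derivative of \<open>\<langle>\<nu>, w\<^sub>0\<rangle>\<close> along \<open>X\<close> is \<open>- \<rho>(\<Phi>\<^sup>-(X))\<close>; this dictates the one-form of the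
  projective change.\<close>

definition \<rho> :: "real ^ 'm \<Rightarrow> 'a \<Rightarrow> (real ^ 'm \<Rightarrow> real) \<Rightarrow> real" where
  "\<rho> w0 q = restrict0 (dual_space (image_tangent A f q)) (\<lambda>\<zeta>. lift q \<zeta> \<bullet> w0 * inverse (\<nu> q \<bullet> w0))"

lemma \<rho>_apply: "\<zeta> \<in> dual_space (image_tangent A f q) \<Longrightarrow> \<rho> w0 q \<zeta> = lift q \<zeta> \<bullet> w0 * inverse (\<nu> q \<bullet> w0)"
  by (simp add: \<rho>_def restrict0_def)

lemma \<rho>_section:
  assumes "\<And>q. q \<in> U \<Longrightarrow> \<nu> q \<bullet> w0 \<noteq> 0"
  shows "\<rho> w0 \<in> sections (dual_bundle A E) U"
proof -
  have "\<rho> w0 q \<in> dual_space (dual_space (image_tangent A f q))" for q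
    using subspace_dual_space[OF subspace_image_tangent, of q]
    by (auto simp: dual_space_def[of "dual_space _"] lin_on_def \<rho>_def restrict0_def subspace_add subspace_scale
        lift_add lift_scaleR algebra_simps)
  moreover have "smooth_fn A W (\<lambda>q. \<rho> w0 q (s q))" if W: "open W" "W \<subseteq> U" and s: "s \<in> sections E W" for W s
  proof -
    have "smooth_fn A W (\<lambda>q. lift q (s q) \<bullet> w0 * inverse (\<nu> q \<bullet> w0))"
      using assms W smooth_fn_subset[OF \<nu>_smooth, of W] section_lift_smooth[OF s W(1)]
      by (intro smooth_fn_mult smooth_fn_inverse smooth_fn_inner smooth_fn_const) auto
    then show ?thesis
      using smooth_fn_cong[OF W(1), of "\<lambda>q. \<rho> w0 q (s q)"] \<rho>_apply section_mem[OF s] by simp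
  qed
  ultimately show ?thesis by (auto simp: dual_bundle_def[of A E] fibre_Eminus)
qed

definition flat_conn :: "real ^ 'm \<Rightarrow> ('a, real ^ 'm \<Rightarrow> real) conn" where
  "flat_conn w0 p v s = D p v s + \<rho> w0 p (\<Phi> p v) *\<^sub>R s p + \<rho> w0 p (s p) *\<^sub>R \<Phi> p v"

lemma connection_flat_conn:
  assumes U: "\<And>q. q \<in> U \<Longrightarrow> \<nu> q \<bullet> w0 \<noteq> 0"
  shows "connection A U E (flat_conn w0)"
proof -
  have \<rho>: "\<rho> w0 \<in> sections (dual_bundle A E) U" using \<rho>_section[OF U] .
  have \<rho>_add: "\<rho> w0 p (\<zeta> + \<eta>) = \<rho> w0 p \<zeta> + \<rho> w0 p \<eta>"
    and \<rho>_scaleR: "\<rho> w0 p (c *\<^sub>R \<zeta>) = c * \<rho> w0 p \<zeta>"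
    if "\<zeta> \<in> dual_space (image_tangent A f p)" "\<eta> \<in> dual_space (image_tangent A f p)" for p \<zeta> \<eta> c
    using that subspace_dual_space[OF subspace_image_tangent, of p]
    by (simp_all add: \<rho>_apply subspace_add subspace_scale lift_add lift_scaleR algebra_simps)
  note sub = subspace_dual_space[OF subspace_image_tangent]
  show ?thesis
    unfolding connection_def
  proof (intro allI impI conjI ballI)
    fix W s p assume W: "open W" "W \<subseteq> U" and s: "s \<in> sections E W" and p: "p \<in> W"
    note D = connection_nabla_minus[unfolded connection_def fibre_Eminus, THEN spec, THEN mp, OF W(1),
        THEN mp, OF subset_UNIV, THEN conjunct1, THEN bspec, OF s, THEN bspec, OF p]
    note Dmem = D[THEN conjunct1, THEN bspec]
      and Dlin = D[THEN conjunct2, THEN conjunct1]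
      and Dadd = D[THEN conjunct2, THEN conjunct2, THEN conjunct1, THEN bspec, THEN bspec]
      and Dscale = D[THEN conjunct2, THEN conjunct2, THEN conjunct2, THEN spec, THEN mp, THEN bspec]
    note mem = section_mem[OF s p]
    show "flat_conn w0 p v s \<in> fibre E p" if "v \<in> tangent_space A p" for v
      unfolding flat_conn_def fibre_Eminus
      by (intro subspace_add subspace_scale sub Dmem that mem \<Phi>_mem)
    show "lin_on (tangent_space A p) (\<lambda>v. flat_conn w0 p v s)"
      unfolding lin_on_def
    proof (intro conjI ballI allI)
      fix u v assume u: "u \<in> tangent_space A p" and v: "v \<in> tangent_space A p"
      show "flat_conn w0 p (u + v) s = flat_conn w0 p u s + flat_conn w0 p v s"
        using Dlin u v
        by (simp add: lin_on_def flat_conn_def \<Phi>_add[OF u v] \<rho>_add[OF \<Phi>_mem[OF u] \<Phi>_mem[OF v]] scaleR_add_left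
            scaleR_add_right add_ac)
    next
      fix c v assume v: "v \<in> tangent_space A p"
      show "flat_conn w0 p (c *\<^sub>R v) s = c *\<^sub>R flat_conn w0 p v s"
        using Dlin v
        by (simp add: lin_on_def flat_conn_def \<Phi>_scaleR[OF v] \<rho>_scaleR[OF \<Phi>_mem[OF v] \<Phi>_mem[OF v]] scaleR_add_right
            mult.commute)
    qed
    show "flat_conn w0 p v (\<lambda>q. s q + t q) = flat_conn w0 p v s + flat_conn w0 p v t"
      if t: "t \<in> sections E W" and v: "v \<in> tangent_space A p" for t v
      by (simp add: flat_conn_def Dadd[OF t v] \<rho>_add[OF mem section_mem[OF t p]] algebra_simps)
    show "flat_conn w0 p v (\<lambda>q. g q *\<^sub>R s q) = v g *\<^sub>R s p + g p *\<^sub>R flat_conn w0 p v s"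
      if g: "smooth_fn A W g" and v: "v \<in> tangent_space A p" for g v
      by (simp add: flat_conn_def Dscale[OF g v] \<rho>_scaleR[OF mem mem] algebra_simps)
  next
    fix W X s assume W: "open W" "W \<subseteq> U" and X: "X \<in> sections (tangent_bundle A) W" and s: "s \<in> sections E W"
    have sm: "smooth_fn A W (\<lambda>q. \<rho> w0 q (t q))" if "t \<in> sections E W" for t
      using \<rho> W that by (auto simp: dual_bundle_def[of A E])
    show "(\<lambda>p. flat_conn w0 p (X p) s) \<in> sections E W"
      unfolding flat_conn_def
      by (intro section_add section_scaleR W nabla_minus_section sm \<Phi>_section X s)
  qed
qed

lemma rel_torsion_free_flat_conn: "rel_torsion_free A U \<Phi> (flat_conn w0)"
  unfolding rel_torsion_free_def
proof (intro allI impI ballI)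
  fix W X Y p
  assume W: "open W" and X: "X \<in> sections (tangent_bundle A) W" and Y: "Y \<in> sections (tangent_bundle A) W"
    and p: "p \<in> W"
  have cancel: "(a + y + x) - (b + x + y) - c = a - b - c" for a b c x y :: "real ^ 'm \<Rightarrow> real"
    by simp
  show "flat_conn w0 p (X p) (\<lambda>q. \<Phi> q (Y q)) - flat_conn w0 p (Y p) (\<lambda>q. \<Phi> q (X q)) - \<Phi> p (lie_bracket A X Y p) = 0"
    unfolding flat_conn_def cancel
    using rel_torsion_free_nabla_minus[unfolded rel_torsion_free_def, THEN spec, THEN mp, OF W, THEN mp,
        OF subset_UNIV, THEN bspec, OF X, THEN bspec, OF Y, THEN bspec, OF p] .
qed

text \<open>The trivialisation by the annihilator of \<open>w\<^sub>0\<close>, divided by \<open>\<langle>\<nu>, w\<^sub>0\<rangle>\<close> so that the connection that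
  it carries over from the trivial bundle is \<open>flat_conn\<close>.\<close>

definition flat_lift :: "real ^ 'm \<Rightarrow> 'a \<Rightarrow> (real ^ 'm \<Rightarrow> real) \<Rightarrow> real ^ 'm" where
  "flat_lift w0 q \<zeta> = inverse (\<nu> q \<bullet> w0) *\<^sub>R annihilating_lift w0 q \<zeta>"

lemma flat_lift_smooth:
  assumes "open W" "\<And>q. q \<in> W \<Longrightarrow> \<nu> q \<bullet> w0 \<noteq> 0" "\<zeta> \<in> sections E W"
  shows "smooth_fn A W (\<lambda>q. flat_lift w0 q (\<zeta> q))"
  unfolding flat_lift_def
  using assms smooth_fn_subset[OF \<nu>_smooth, of W]
  by (intro smooth_fn_scaleR smooth_fn_inverse smooth_fn_inner smooth_fn_const annihilating_lift_smooth) auto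

lemma flat_lift_covector:
  assumes "\<nu> q \<bullet> w0 \<noteq> 0" "Z \<bullet> w0 = 0"
  shows "flat_lift w0 q (covector q ((\<nu> q \<bullet> w0) *\<^sub>R Z)) = Z"
  using assms by (simp add: flat_lift_def annihilating_lift_def lift_covector inner_diff_left algebra_simps)

text \<open>With \<open>g = \<langle>\<nu>, w\<^sub>0\<rangle>\<close>, \<open>i = g\<^sup>-\<^sup>1\<close>, \<open>L\<close> the extension of \<open>\<zeta>\<close>, \<open>c = \<langle>L, w\<^sub>0\<rangle> i\<close> and \<open>N = L - c \<nu>\<close>, the product rule
  gives \<open>g d(i N) = - (dg / g) N + dL - dc \<nu> - c d\<nu>\<close>. On the tangent hyperplane \<open>N\<close> restricts to \<open>\<zeta>\<close>, the
  term with \<open>\<nu>\<close> disappears, and the rest is the projective change of the dual connection.\<close>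

lemma flat_conn_eq:
  assumes \<zeta>: "\<zeta> \<in> sections E W" and W: "open W" "p \<in> W" and nz: "\<And>q. q \<in> W \<Longrightarrow> \<nu> q \<bullet> w0 \<noteq> 0"
    and v: "v \<in> tangent_space A p"
  shows "flat_conn w0 p v \<zeta> = covector p ((\<nu> p \<bullet> w0) *\<^sub>R deriv_along v (\<lambda>q. flat_lift w0 q (\<zeta> q)))"
proof -
  define g where "g q = \<nu> q \<bullet> w0" for q
  define i where "i q = inverse (\<nu> q \<bullet> w0)" for q
  define L where "L q = lift q (\<zeta> q)" for q
  define c where "c q = L q \<bullet> w0 * i q" for q
  define N where "N q = annihilating_lift w0 q (\<zeta> q)" for q
  have \<nu>W: "smooth_fn A W \<nu>" using smooth_fn_subset[OF \<nu>_smooth] by simp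
  have gW: "smooth_fn A W g" unfolding g_def by (intro smooth_fn_inner smooth_fn_const \<nu>W W)
  have iW: "smooth_fn A W i"
    unfolding i_def using nz by (intro smooth_fn_inverse smooth_fn_inner smooth_fn_const \<nu>W W) auto
  have LW: "smooth_fn A W L" unfolding L_def by (rule section_lift_smooth[OF \<zeta> W(1)])
  have cW: "smooth_fn A W c" unfolding c_def by (intro smooth_fn_mult smooth_fn_inner smooth_fn_const LW iW W)
  have NW: "smooth_fn A W N" unfolding N_def by (intro annihilating_lift_smooth W nz \<zeta>)
  note near = smooth_nearI[OF W]
  have gi: "g p * i p = 1" using nz[OF W(2)] by (simp add: g_def i_def)
  have "v (\<lambda>q. g q * i q) = v (\<lambda>q. 1)"
    by (rule tangent_local[OF v W]) (use nz in \<open>simp add: g_def i_def\<close>)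
  then have vi: "g p * v i = - (v g * i p)"
    by (simp add: tangent_mult[OF v near[OF gW] near[OF iW]] tangent_const[OF v])
  have vg: "v g = deriv_along v \<nu> \<bullet> w0"
    unfolding g_def by (rule tangent_inner_const[OF v smooth_near_\<nu>])
  have Neq: "N = (\<lambda>q. L q + - (c q *\<^sub>R \<nu> q))"
    by (simp add: N_def annihilating_lift_def L_def c_def i_def fun_eq_iff)
  have c\<nu>: "smooth_near A p (\<lambda>q. c q *\<^sub>R \<nu> q)"
    by (intro near smooth_fn_scaleR W cW \<nu>W)
  then have c\<nu>': "smooth_near A p (\<lambda>q. - (c q *\<^sub>R \<nu> q))"
    by (intro near smooth_fn_minus smooth_fn_scaleR W cW \<nu>W)
  have dN: "deriv_along v N = deriv_along v L - (v c *\<^sub>R \<nu> p + c p *\<^sub>R deriv_along v \<nu>)"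
    unfolding Neq deriv_along_add[OF v near[OF LW] c\<nu>'] deriv_along_minus[OF v c\<nu>]
      deriv_along_scaleR[OF v near[OF cW] smooth_near_\<nu>] by simp
  have "deriv_along v (\<lambda>q. flat_lift w0 q (\<zeta> q)) = v i *\<^sub>R N p + i p *\<^sub>R deriv_along v N"
    unfolding flat_lift_def N_def[symmetric] i_def[symmetric]
    by (rule deriv_along_scaleR[OF v near[OF iW] near[OF NW]])
  then have "g p *\<^sub>R deriv_along v (\<lambda>q. flat_lift w0 q (\<zeta> q)) = - (v g * i p) *\<^sub>R N p + deriv_along v N"
    by (simp add: scaleR_add_right gi flip: vi)
  moreover have "covector p (N p) = \<zeta> p"
    unfolding N_def by (rule covector_annihilating_lift[OF section_mem[OF \<zeta> W(2)]])
  ultimately have "covector p (g p *\<^sub>R deriv_along v (\<lambda>q. flat_lift w0 q (\<zeta> q)))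
      = - (v g * i p) *\<^sub>R \<zeta> p + (covector p (deriv_along v L) - c p *\<^sub>R covector p (deriv_along v \<nu>))"
    by (simp only: dN linear_add[OF linear_covector] linear_diff[OF linear_covector]
        linear_scale[OF linear_covector] covector_\<nu> scaleR_zero_right add_0)
  moreover have "\<rho> w0 p (\<Phi> p v) = - (v g * i p)"
    by (simp add: \<rho>_apply[OF \<Phi>_mem[OF v]] lift_\<Phi>[OF v] vg i_def)
  moreover have "\<rho> w0 p (\<zeta> p) = c p"
    by (simp add: \<rho>_apply[OF section_mem[OF \<zeta> W(2)]] c_def L_def i_def)
  moreover have "\<Phi> p v = - covector p (deriv_along v \<nu>)"
    by (simp add: \<Phi>_eq[OF v] linear_neg[OF linear_covector])
  ultimately show ?thesis
    by (simp add: flat_conn_def nabla_minus_eq[OF \<zeta> W v] g_def L_def[abs_def])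
qed

text \<open>The derivative of a function with values in the fixed space of covectors annihilating \<open>w\<^sub>0\<close> has
  values in the same space. Hence in the trivialisation the connection is iterated differentiation of
  vector-valued functions, and its curvature is \<open>X Y - Y X - [X,Y] = 0\<close>.\<close>

lemma flat_connection_flat_conn:
  assumes U: "\<And>q. q \<in> U \<Longrightarrow> \<nu> q \<bullet> w0 \<noteq> 0"
  shows "flat_connection A U E (flat_conn w0)"
  unfolding flat_connection_def
proof (intro conjI allI impI ballI)
  show conn: "connection A U E (flat_conn w0)" using connection_flat_conn[OF U] .
  fix W X Y s p
  assume W: "open W" "W \<subseteq> U" and X: "X \<in> sections (tangent_bundle A) W"
    and Y: "Y \<in> sections (tangent_bundle A) W" and s: "s \<in> sections E W" and p: "p \<in> W"
  have nz: "\<nu> q \<bullet> w0 \<noteq> 0" if "q \<in> W" for q using that U W(2) by blast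
  let ?P = "\<lambda>q. flat_lift w0 q (s q)"
  have PW: "smooth_fn A W ?P" by (rule flat_lift_smooth[OF W(1) nz s])
  have second: "flat_conn w0 p (X p) (\<lambda>q. flat_conn w0 q (Y q) s)
      = covector p ((\<nu> p \<bullet> w0) *\<^sub>R deriv_along (X p) (\<lambda>q. deriv_along (Y q) ?P))"
    if X: "X \<in> sections (tangent_bundle A) W" and Y: "Y \<in> sections (tangent_bundle A) W" for X Y
  proof -
    have Xp: "X p \<in> tangent_space A p" using vector_field_tangent[OF X p] .
    have "(\<lambda>q. flat_conn w0 q (Y q) s) \<in> sections E W"
      by (rule connection_section[OF conn W Y s])
    note eq = flat_conn_eq[OF this W(1) p nz Xp]
    have "flat_lift w0 q (flat_conn w0 q (Y q) s) = deriv_along (Y q) ?P" if q: "q \<in> W" for q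
    proof -
      have Yq: "Y q \<in> tangent_space A q" using vector_field_tangent[OF Y q] .
      have "Y q (\<lambda>x. ?P x \<bullet> w0) = Y q (\<lambda>x. 0)"
        using annihilating_lift_inner[OF nz]
        by (intro tangent_local[OF Yq W(1) q]) (simp add: flat_lift_def)
      then have "deriv_along (Y q) ?P \<bullet> w0 = 0"
        by (simp add: tangent_inner_const[OF Yq smooth_nearI[OF W(1) q PW]] tangent_const[OF Yq])
      then show ?thesis
        by (simp only: flat_conn_eq[OF s W(1) q nz Yq] flat_lift_covector[OF nz[OF q]])
    qed
    then have "deriv_along (X p) (\<lambda>q. flat_lift w0 q (flat_conn w0 q (Y q) s))
        = deriv_along (X p) (\<lambda>q. deriv_along (Y q) ?P)"
      by (rule deriv_along_local[OF Xp W(1) p])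
    then show ?thesis using eq by simp
  qed
  have "curvature A (flat_conn w0) X Y s p = covector p ((\<nu> p \<bullet> w0) *\<^sub>R
      (deriv_along (X p) (\<lambda>q. deriv_along (Y q) ?P) - deriv_along (Y p) (\<lambda>q. deriv_along (X q) ?P)
        - deriv_along (lie_bracket A X Y p) ?P))"
    by (simp only: curvature_def second[OF X Y] second[OF Y X]
        flat_conn_eq[OF s W(1) p nz lie_bracket_tangent[OF X Y W(1) p]]
        linear_diff[OF linear_covector] linear_scale[OF linear_covector] scaleR_diff_right)
  then show "curvature A (flat_conn w0) X Y s p = 0"
    by (simp add: deriv_along_lie_bracket[OF smooth_nearI[OF W(1) p PW]] linear_0[OF linear_covector])
qed

lemma projectively_flat_nabla_minus: "projectively_flat A E \<Phi> D"
  unfolding projectively_flat_def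
proof (intro conjI allI)
  show "vector_bundle A CARD('n) E" by (rule vector_bundle_Eminus)
  show "bundle_map A E \<Phi>" by (rule bundle_map_\<Phi>)
  show conn: "connection A UNIV E D" by (rule connection_nabla_minus)
  show tf: "rel_torsion_free A UNIV \<Phi> D" by (rule rel_torsion_free_nabla_minus)
  fix p
  define U where "U = {q. \<nu> q \<bullet> \<xi> p \<noteq> 0}"
  have nz: "\<nu> q \<bullet> \<xi> p \<noteq> 0" if "q \<in> U" for q using that by (simp add: U_def)
  have connU: "connection A U E D" using conn unfolding connection_def by simp
  have tfU: "rel_torsion_free A U \<Phi> D" using tf unfolding rel_torsion_free_def by simp
  have "projectively_equivalent A U E \<Phi> D (flat_conn (\<xi> p))"
    unfolding projectively_equivalent_def
  proof (intro conjI connU tfU)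
    show "connection A U E (flat_conn (\<xi> p))" by (rule connection_flat_conn[OF nz])
    show "rel_torsion_free A U \<Phi> (flat_conn (\<xi> p))" by (rule rel_torsion_free_flat_conn)
    show "\<exists>\<rho>\<in>sections (dual_bundle A E) U. \<forall>W. open W \<longrightarrow> W \<subseteq> U \<longrightarrow>
        (\<forall>X\<in>sections (tangent_bundle A) W. \<forall>s\<in>sections E W. \<forall>q\<in>W.
           flat_conn (\<xi> p) q (X q) s = D q (X q) s + \<rho> q (\<Phi> q (X q)) *\<^sub>R s q + \<rho> q (s q) *\<^sub>R \<Phi> q (X q))"
      by (intro bexI[OF _ \<rho>_section[OF nz]]) (simp add: flat_conn_def)
  qed
  then show "\<exists>U D'. open U \<and> p \<in> U \<and> flat_connection A U E D' \<and> projectively_equivalent A U E \<Phi> D D'"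
    using flat_connection_flat_conn[of U, OF nz] open_\<nu>_nonzero[of "\<xi> p"] \<nu>_\<xi>[of p]
    by (intro exI[of _ U] exI[of _ "flat_conn (\<xi> p)"]) (simp add: U_def)
qed


section \<open>The trace of the curvature\<close>

text \<open>The extension of \<open>\<nabla>\<^sup>-\<^sub>Y s\<close> is \<open>dL(Y) - \<langle>dL(Y), \<xi>\<rangle> \<nu>\<close>, where \<open>L\<close> is the extension of \<open>s\<close>, and differentiating
  \<open>\<langle>L, \<xi>\<rangle> = 0\<close> shows that the coefficient of \<open>\<nu>\<close> is \<open>\<langle>L, d\<xi>(Y)\<rangle> = s(d\<xi>(Y))\<close>. In the next derivative only the
  term in which \<open>\<nu>\<close> is differentiated survives the restriction to the hyperplane; the second
  derivatives of \<open>L\<close> cancel against the bracket.\<close>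

lemma curvature_nabla_minus:
  assumes W: "open W" "p \<in> W" and X: "X \<in> sections (tangent_bundle A) W"
    and Y: "Y \<in> sections (tangent_bundle A) W" and s: "s \<in> sections E W"
  shows "curvature A D X Y s p = s p (deriv_along (Y p) \<xi>) *\<^sub>R covector p (deriv_along (X p) \<nu>)
    - s p (deriv_along (X p) \<xi>) *\<^sub>R covector p (deriv_along (Y p) \<nu>)"
proof -
  let ?L = "\<lambda>q. lift q (s q)"
  have LW: "smooth_fn A W ?L" by (rule section_lift_smooth[OF s W(1)])
  have second: "D p (X p) (\<lambda>q. D q (Y q) s) = covector p (deriv_along (X p) (\<lambda>q. deriv_along (Y q) ?L))
      + s p (deriv_along (Y p) \<xi>) *\<^sub>R covector p (deriv_along (X p) \<nu>)"
    if X: "X \<in> sections (tangent_bundle A) W" and Y: "Y \<in> sections (tangent_bundle A) W" for X Y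
  proof -
    let ?LY = "\<lambda>q. deriv_along (Y q) ?L"
    let ?c = "\<lambda>q. - (?LY q \<bullet> \<xi> q)"
    have Xp: "X p \<in> tangent_space A p" and Yp: "Y p \<in> tangent_space A p"
      using vector_field_tangent X Y W(2) by auto
    have LYW: "smooth_fn A W ?LY" by (rule deriv_along_smooth[OF Y W(1) LW])
    have cW: "smooth_fn A W ?c"
      using smooth_fn_subset[OF \<xi>_smooth, of W] by (intro smooth_fn_minus smooth_fn_inner LYW W) auto
    have c\<nu>: "smooth_fn A W (\<lambda>q. ?c q *\<^sub>R \<nu> q)"
      using smooth_fn_subset[OF \<nu>_smooth, of W] by (intro smooth_fn_scaleR cW W) auto
    have "lift q (D q (Y q) s) = ?LY q + ?c q *\<^sub>R \<nu> q" if "q \<in> W" for q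
      by (simp add: nabla_minus_eq[OF s W(1) that vector_field_tangent[OF Y that]] lift_covector)
    then have "deriv_along (X p) (\<lambda>q. lift q (D q (Y q) s)) = deriv_along (X p) (\<lambda>q. ?LY q + ?c q *\<^sub>R \<nu> q)"
      by (rule deriv_along_local[OF Xp W])
    also have "\<dots> = deriv_along (X p) ?LY + (X p ?c *\<^sub>R \<nu> p + ?c p *\<^sub>R deriv_along (X p) \<nu>)"
      by (simp only: deriv_along_add[OF Xp smooth_nearI[OF W LYW] smooth_nearI[OF W c\<nu>]]
          deriv_along_scaleR[OF Xp smooth_nearI[OF W cW] smooth_near_\<nu>])
    finally have "D p (X p) (\<lambda>q. D q (Y q) s)
        = covector p (deriv_along (X p) ?LY) + ?c p *\<^sub>R covector p (deriv_along (X p) \<nu>)"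
      by (simp only: nabla_minus_eq[OF nabla_minus_section[OF W(1) Y s] W Xp]
          linear_add[OF linear_covector] linear_scale[OF linear_covector] covector_\<nu> scaleR_zero_right add_0)
    moreover have "?c p = s p (deriv_along (Y p) \<xi>)"
    proof -
      have "Y p (\<lambda>q. ?L q \<bullet> \<xi> q) = Y p (\<lambda>q. 0)"
        by (rule tangent_local[OF Yp W]) (rule lift_\<xi>[OF section_mem[OF s]])
      then have "?LY p \<bullet> \<xi> p + ?L p \<bullet> deriv_along (Y p) \<xi> = 0"
        by (simp add: tangent_inner[OF Yp smooth_nearI[OF W LW] smooth_near_\<xi>] tangent_const[OF Yp])
      moreover have "?L p \<bullet> deriv_along (Y p) \<xi> = s p (deriv_along (Y p) \<xi>)"
        using \<nu>_deriv_\<xi>[OF Yp]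
        by (simp add: lift_inner[OF section_mem[OF s W(2)]] tproj_tangent image_tangent_iff)
      ultimately show ?thesis by simp
    qed
    ultimately show ?thesis by simp
  qed
  show ?thesis
    unfolding curvature_def second[OF X Y] second[OF Y X]
      nabla_minus_eq[OF s W lie_bracket_tangent[OF X Y W]]
      deriv_along_lie_bracket[OF smooth_nearI[OF W LW]] linear_diff[OF linear_covector]
    by simp
qed

lemma curvature_endo_nabla_minus:
  assumes X: "X \<in> sections (tangent_bundle A) UNIV" and Y: "Y \<in> sections (tangent_bundle A) UNIV"
    and w: "w \<in> dual_space (image_tangent A f p)"
  shows "curvature_endo A E D X Y p w = w (deriv_along (Y p) \<xi>) *\<^sub>R covector p (deriv_along (X p) \<nu>)
    - w (deriv_along (X p) \<xi>) *\<^sub>R covector p (deriv_along (Y p) \<nu>)"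
  unfolding curvature_endo_def
proof (rule the_equality)
  have "(\<lambda>q. covector q (lift p w)) \<in> sections E UNIV"
    by (intro covector_section open_UNIV smooth_fn_const)
  then show "\<exists>W s. open W \<and> p \<in> W \<and> s \<in> sections E W \<and> s p = w \<and>
      w (deriv_along (Y p) \<xi>) *\<^sub>R covector p (deriv_along (X p) \<nu>)
        - w (deriv_along (X p) \<xi>) *\<^sub>R covector p (deriv_along (Y p) \<nu>) = curvature A D X Y s p"
    using curvature_nabla_minus[OF open_UNIV UNIV_I X Y] covector_lift[OF w]
    by (intro exI[of _ UNIV] exI[of _ "\<lambda>q. covector q (lift p w)"]) auto
next
  fix z assume "\<exists>W s. open W \<and> p \<in> W \<and> s \<in> sections E W \<and> s p = w \<and> z = curvature A D X Y s p"
  then obtain W s where "open W" "p \<in> W" "s \<in> sections E W" "s p = w" "z = curvature A D X Y s p" by blast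
  then show "z = w (deriv_along (Y p) \<xi>) *\<^sub>R covector p (deriv_along (X p) \<nu>)
      - w (deriv_along (X p) \<xi>) *\<^sub>R covector p (deriv_along (Y p) \<nu>)"
    using curvature_nabla_minus[of W p X Y s] vector_field_subset[OF X subset_UNIV]
      vector_field_subset[OF Y subset_UNIV] by simp
qed

lemma trace_curvature_nabla_minus:
  assumes X: "X \<in> sections (tangent_bundle A) UNIV" and Y: "Y \<in> sections (tangent_bundle A) UNIV"
  shows "subspace_trace (fibre E p) (curvature_endo A E D X Y p) = 0"
proof -
  note Xp = vector_field_tangent[OF X UNIV_I] and Yp = vector_field_tangent[OF Y UNIV_I]
  have T: "deriv_along (X p) \<xi> \<in> image_tangent A f p" "deriv_along (Y p) \<xi> \<in> image_tangent A f p"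
    using \<nu>_deriv_\<xi>[OF Xp] \<nu>_deriv_\<xi>[OF Yp] by (simp_all add: image_tangent_iff)
  obtain F :: "(real ^ 'm \<Rightarrow> real) set" where F: "finite F" "span F = dual_space (image_tangent A f p)"
  proof -
    obtain U and b :: "nat \<Rightarrow> real ^ 'm" where "p \<in> U"
      "\<And>q. q \<in> U \<Longrightarrow> span ((\<lambda>i. covector q (b i)) ` {..<CARD('n)}) = dual_space (image_tangent A f q)"
      by (rule Eminus_frame[of p]) blast
    then show ?thesis using that[of "(\<lambda>i. covector p (b i)) ` {..<CARD('n)}"] by blast
  qed
  have "subspace_trace (fibre E p) (curvature_endo A E D X Y p)
      = covector p (deriv_along (X p) \<nu>) (deriv_along (Y p) \<xi>)
        - covector p (deriv_along (Y p) \<nu>) (deriv_along (X p) \<xi>)"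
    unfolding fibre_Eminus
    by (rule subspace_trace_evaluation[OF F covector_mem covector_mem]) (rule curvature_endo_nabla_minus[OF X Y])
  also have "\<dots> = deriv_along (X p) \<nu> \<bullet> deriv_along (Y p) \<xi> - deriv_along (Y p) \<nu> \<bullet> deriv_along (X p) \<xi>"
    using T by (simp add: covector_apply)
  also have "\<dots> = 0"
  proof -
    \<comment> \<open>The derivative along \<open>X\<close> of \<open>\<langle>d\<nu>(Y), \<xi>\<rangle> = 0\<close>.\<close>
    have second: "deriv_along (X p) (\<lambda>q. deriv_along (Y q) \<nu>) \<bullet> \<xi> p + deriv_along (Y p) \<nu> \<bullet> deriv_along (X p) \<xi> = 0"
      if X: "X \<in> sections (tangent_bundle A) UNIV" and Y: "Y \<in> sections (tangent_bundle A) UNIV" for X Y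
    proof -
      note Xp = vector_field_tangent[OF X UNIV_I, of p]
      have "(\<lambda>q. deriv_along (Y q) \<nu> \<bullet> \<xi> q) = (\<lambda>q. 0)"
        using deriv_\<nu>_\<xi>[OF vector_field_tangent[OF Y UNIV_I]] by simp
      then show ?thesis
        using tangent_inner[OF Xp smooth_nearI[OF open_UNIV UNIV_I deriv_\<nu>_smooth[OF open_UNIV Y]] smooth_near_\<xi>]
          tangent_const[OF Xp] by simp
    qed
    have "deriv_along (lie_bracket A X Y p) \<nu> \<bullet> \<xi> p = 0"
      by (rule deriv_\<nu>_\<xi>[OF lie_bracket_tangent[OF X Y open_UNIV UNIV_I]])
    then show ?thesis
      using second[OF X Y] second[OF Y X]
      by (simp add: deriv_along_lie_bracket[OF smooth_near_\<nu>] inner_diff_left)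
  qed
  finally show ?thesis .
qed

end

theorem theorem4p9:
  fixes A :: "('a::{t2_space, second_countable_topology}, 'n::finite) atlas"
    and f \<xi> :: "'a \<Rightarrow> real ^ 'm::finite"
    and Q :: "('a, real ^ 'm, real ^ 'm \<Rightarrow> real) quasi_codazzi"
  assumes "smooth_atlas A"
    and "CARD('m) = CARD('n) + 1"
    and "equiaffine_immersion A f \<xi>"
    and "Q = induced_quasi_codazzi A f \<xi>"
  shows "projectively_flat A (qc_Eminus Q) (\<lambda>p v. snd (qc_Phi Q p v)) (qc_nabla_minus Q)
    \<and> (\<forall>X\<in>sections (tangent_bundle A) UNIV. \<forall>Y\<in>sections (tangent_bundle A) UNIV. \<forall>p.
         subspace_trace (fibre (qc_Eminus Q) p)
           (curvature_endo A (qc_Eminus Q) (qc_nabla_minus Q) X Y p) = 0)"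
proof -
  interpret equiaffine_setting A f \<xi>
    using assms by unfold_locales auto
  show ?thesis
    using projectively_flat_nabla_minus trace_curvature_nabla_minus
    by (simp add: assms(4) induced_quasi_codazzi_def)
qed

end
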